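(* Let $d\ge 2$ be an integer. Let $(D)$ be a degree of regularity from Hölder to $C^{\infty}$, and let $\mathcal{D}$ be the collection of orientation-preserving homeomorphisms of the circle $\mathbb{S}^1$ with regularity $(D)$. Then there is no complete numerical Borel invariant for $\mathcal{D}$-conjugacy of free $\mathbb{Z}^d$ actions by orientation-preserving $C^{\infty}$ diffeomorphisms of the circle. That is, with $\mathcal{A}$ the space of such actions, there is no Borel function $\varphi:\mathcal{A}\to\mathbb{R}$ such that for all $\rho,\sigma\in\mathcal{A}$: $\rho$ and $\sigma$ are $\mathcal{D}$-conjugate if and only if $\varphi(\rho)=\varphi(\sigma)$.
   Context: $\mathbb{S}^1=\mathbb{R}/\mathbb{Z}$. $\mathcal{H}$ is the set of orientation-preserving homeomorphisms of $\mathbb{S}^1$. For an integer $k\ge 1$ or $k=\infty$, $\mathcal{H}^k$ is the set of orientation-preserving $C^k$-diffeomorphisms of $\mathbb{S}^1$. For $0<\beta<1$ and an integer $k\ge 0$, $\mathcal{H}^{k+\beta}$ is the set of elements of $\mathcal{H}^k$ (with $\mathcal{H}^0=\mathcal{H}$) whose $k$-th derivative is $\beta$-Hölder continuous. "A degree of regularity from Hölder to $C^\infty$" means that $\mathcal{D}$ is one of: $\bigcup_{0<\beta<1}\mathcal{H}^{0+\beta}$ (Hölder homeomorphisms), $\mathcal{H}^{k+\beta}$ with $k\ge 0$ an integer and $0<\beta<1$, $\mathcal{H}^k$ with $k\ge1$ an integer, or $\mathcal{H}^{\infty}$. $\mathcal{H}^{\infty}$ carries the metric $d_{\infty}(f,g)=\sum_{k\ge1}\frac{d_k(f,g)}{2^k(1+d_k(f,g))}$,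 where $d_k(f,g)=\max\{\|f-g\|_k,\|f^{-1}-g^{-1}\|_k\}$ and $\|f\|_k=\max_{0\le i\le k}\max_{x}|D^if(x)|$ (the order-zero term of a difference being measured by distance on the circle). A $\mathbb{Z}^d$ action by orientation-preserving $C^\infty$ diffeomorphisms is a homomorphism $\rho:\mathbb{Z}^d\to\mathcal{H}^\infty$, identified with the $d$-tuple of commuting generators $(\rho(e_1),\dots,\rho(e_d))\in(\mathcal{H}^\infty)^d$; it is free if $\rho(v)$ has no fixed point for every $v\ne0$. $\mathcal{A}$, the set of free such actions, has the subspace topology from $(\mathcal{H}^{\infty})^d$ and the associated Borel structure. Actions $\rho,\sigma$ are $\mathcal{D}$-conjugate if there is $h\in\mathcal{D}$ with $\rho(v)=h\circ\sigma(v)\circ h^{-1}$ for all $v\in\mathbb{Z}^d$. *)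

theory Defs
  imports "HOL-Analysis.Analysis"
begin

section \<open>The circle\<close>

quotient_type circle = real / "\<lambda>x y :: real. x - y \<in> \<int>"
proof (rule equivpI)
  show "reflp (\<lambda>x y :: real. x - y \<in> \<int>)"
    by (simp add: reflp_def)
  show "symp (\<lambda>x y :: real. x - y \<in> \<int>)"
    by (metis (no_types, lifting) Ints_minus minus_diff_eq sympI)
  show "transp (\<lambda>x y :: real. x - y \<in> \<int>)"
  proof (rule transpI)
    fix x y z :: real assume "x - y \<in> \<int>" "y - z \<in> \<int>"
    then have "(x - y) + (y - z) \<in> \<int>" by (rule Ints_add)
    then show "x - z \<in> \<int>" by simp
  qed
qed

lemma round_add_int: "round (x + of_int n :: real) = round x + n"
  unfolding round_def by linarith

lemma dist_int_triangle:
  fixes a b :: real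
  shows "\<bar>(a + b) - of_int (round (a + b))\<bar>
           \<le> \<bar>a - of_int (round a)\<bar> + \<bar>b - of_int (round b)\<bar>"
proof -
  have "\<bar>(a + b) - of_int (round (a + b))\<bar> \<le> \<bar>(a + b) - of_int (round a + round b)\<bar>"
    by (rule round_diff_minimal)
  then show ?thesis by simp
qed

lemma dist_int_minus:
  fixes a :: real
  shows "\<bar>- a - of_int (round (- a))\<bar> = \<bar>a - of_int (round a)\<bar>"
  using round_diff_minimal[of "- a" "- round a"] round_diff_minimal[of a "- round (- a)"]
  by simp

instantiation circle :: metric_space
begin

(* the distance from x - y to the nearest integer *)
lift_definition dist_circle :: "circle \<Rightarrow> circle \<Rightarrow> real"
  is "\<lambda>x y. \<bar>(x - y) - of_int (round (x - y))\<bar>"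
proof -
  fix x x' y y' :: real
  assume "x - x' \<in> \<int>" "y - y' \<in> \<int>"
  then have "(x - x') - (y - y') \<in> \<int>" by (rule Ints_diff)
  then obtain n where "(x - x') - (y - y') = of_int n" by (auto elim: Ints_cases)
  then have *: "x - y = (x' - y') + of_int n" by simp
  show "\<bar>(x - y) - of_int (round (x - y))\<bar> = \<bar>(x' - y') - of_int (round (x' - y'))\<bar>"
    unfolding * round_add_int by simp
qed

definition uniformity_circle :: "(circle \<times> circle) filter"
  where "uniformity_circle = (INF e\<in>{0 <..}. principal {(x, y). dist x y < e})"

definition open_circle :: "circle set \<Rightarrow> bool"
  where "open_circle U \<longleftrightarrow> (\<forall>x\<in>U. eventually (\<lambda>(x', y). x' = x \<longrightarrow> y \<in> U) uniformity)"

instance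
proof
  show "uniformity = (INF e\<in>{0 <..}. principal {(x :: circle, y). dist x y < e})"
    by (rule uniformity_circle_def)
  show "open U \<longleftrightarrow> (\<forall>x\<in>U. eventually (\<lambda>(x', y). x' = x \<longrightarrow> y \<in> U) uniformity)"
    for U :: "circle set"
    by (rule open_circle_def)
  show "dist x y = 0 \<longleftrightarrow> x = y" for x y :: circle
    by transfer (metis Ints_cases Ints_of_int abs_eq_0 eq_iff_diff_eq_0 round_of_int)
  show "dist x y \<le> dist x z + dist y z" for x y z :: circle
  proof transfer
    fix x y z :: real
    show "\<bar>x - y - of_int (round (x - y))\<bar>
            \<le> \<bar>x - z - of_int (round (x - z))\<bar> + \<bar>y - z - of_int (round (y - z))\<bar>"
      using dist_int_triangle[of "x - z" "z - y"] dist_int_minus[of "y - z"] by simp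
  qed
qed

end

(* the topology of the metric is the quotient topology *)
lemma open_circle_iff: "open U \<longleftrightarrow> open (abs_circle -` U)"
proof
  have "continuous_on UNIV abs_circle" unfolding continuous_on_iff
  proof (intro ballI allI impI)
    fix x e :: real assume "e > 0"
    then show "\<exists>d>0. \<forall>y\<in>UNIV. dist y x < d \<longrightarrow> dist (abs_circle y) (abs_circle x) < e"
      using round_diff_minimal[of _ 0]
      by (intro exI[of _ e]) (auto simp: dist_circle.abs_eq dist_real_def intro: le_less_trans)
  qed
  then show "open U \<Longrightarrow> open (abs_circle -` U)" by (rule open_vimage[rotated])
next
  assume o: "open (abs_circle -` U)"
  show "open U" unfolding open_dist
  proof
    fix x assume "x \<in> U"
    obtain t where t: "x = abs_circle t" by (metis Quotient3_abs_rep Quotient3_circle)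
    obtain e where e: "e > 0" "\<And>s. \<bar>s - t\<bar> < e \<Longrightarrow> abs_circle s \<in> U"
      using o \<open>x \<in> U\<close> t unfolding open_dist dist_real_def by auto
    have "y \<in> U" if "dist y x < e" for y
    proof -
      obtain s where s: "y = abs_circle s" by (metis Quotient3_abs_rep Quotient3_circle)
      define s' where "s' = s - of_int (round (s - t))"
      have "\<bar>s' - t\<bar> < e" using that by (simp add: s t dist_circle.abs_eq s'_def algebra_simps)
      moreover have "abs_circle s' = y" by (simp add: s s'_def circle.abs_eq_iff)
      ultimately show ?thesis using e by blast
    qed
    then show "\<exists>e>0. \<forall>y. dist y x < e \<longrightarrow> y \<in> U" using e by blast
  qed
qed

section \<open>Homeomorphisms and diffeomorphisms of the circle\<close>

definition is_lift :: "(real \<Rightarrow> real) \<Rightarrow> (circle \<Rightarrow> circle) \<Rightarrow> bool"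
  where "is_lift F f \<longleftrightarrow>
    continuous_on UNIV F \<and> (\<forall>t. abs_circle (F t) = f (abs_circle t))"

definition homeo_plus :: "(circle \<Rightarrow> circle) set"
  where "homeo_plus =
    {f. homeomorphism UNIV UNIV f (inv f) \<and> (\<exists>F. is_lift F f \<and> strict_mono F)}"

(* Two lifts of the same map differ by an integer constant, so the derivatives of order
   at least 1 do not depend on the choice. *)
definition lift :: "(circle \<Rightarrow> circle) \<Rightarrow> real \<Rightarrow> real"
  where "lift f = (SOME F. is_lift F f)"

definition is_Ck :: "nat \<Rightarrow> (circle \<Rightarrow> circle) \<Rightarrow> bool"
  where "is_Ck k f \<longleftrightarrow>
    (\<forall>i<k. \<forall>t. (deriv ^^ i) (lift f) differentiable at t) \<and>
    continuous_on UNIV ((deriv ^^ k) (lift f))"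

(* Only used for orders i \<ge> 1, where the derivative of the lift is 1-periodic. *)
definition circle_deriv :: "nat \<Rightarrow> (circle \<Rightarrow> circle) \<Rightarrow> circle \<Rightarrow> real"
  where "circle_deriv i f x = (deriv ^^ i) (lift f) (rep_circle x)"

definition diffeo :: "nat \<Rightarrow> (circle \<Rightarrow> circle) set"
  where "diffeo k = {f \<in> homeo_plus. k \<ge> 1 \<longrightarrow> is_Ck k f \<and> is_Ck k (inv f)}"

definition diffeo_smooth :: "(circle \<Rightarrow> circle) set"
  where "diffeo_smooth = (\<Inter>k\<in>{1..}. diffeo k)"

definition is_Hoelder :: "real \<Rightarrow> ('a::metric_space \<Rightarrow> 'b::metric_space) \<Rightarrow> bool"
  where "is_Hoelder \<beta> u \<longleftrightarrow> (\<exists>C. \<forall>x y. dist (u x) (u y) \<le> C * dist x y powr \<beta>)"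

definition diffeo_Hoelder :: "nat \<Rightarrow> real \<Rightarrow> (circle \<Rightarrow> circle) set"
  where "diffeo_Hoelder k \<beta> =
    {f \<in> diffeo k. if k = 0 then is_Hoelder \<beta> f else is_Hoelder \<beta> (circle_deriv k f)}"

definition regularity_classes :: "(circle \<Rightarrow> circle) set set"
  where "regularity_classes =
    {\<Union>\<beta>\<in>{0<..<1}. diffeo_Hoelder 0 \<beta>} \<union>
    {diffeo_Hoelder k \<beta> | k \<beta>. 0 < \<beta> \<and> \<beta> < 1} \<union>
    {diffeo k | k. k \<ge> 1} \<union>
    {diffeo_smooth}"

section \<open>The metric on the smooth diffeomorphisms\<close>

definition deriv_gap :: "nat \<Rightarrow> (circle \<Rightarrow> circle) \<Rightarrow> (circle \<Rightarrow> circle) \<Rightarrow> circle \<Rightarrow> real"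
  where "deriv_gap i f g x =
    (if i = 0 then dist (f x) (g x) else \<bar>circle_deriv i f x - circle_deriv i g x\<bar>)"

definition deriv_dist :: "nat \<Rightarrow> (circle \<Rightarrow> circle) \<Rightarrow> (circle \<Rightarrow> circle) \<Rightarrow> real"
  where "deriv_dist i f g = (SUP x. deriv_gap i f g x)"

definition norm_diff :: "nat \<Rightarrow> (circle \<Rightarrow> circle) \<Rightarrow> (circle \<Rightarrow> circle) \<Rightarrow> real"
  where "norm_diff k f g = (MAX i\<in>{0..k}. deriv_dist i f g)"

definition dist_Ck :: "nat \<Rightarrow> (circle \<Rightarrow> circle) \<Rightarrow> (circle \<Rightarrow> circle) \<Rightarrow> real"
  where "dist_Ck k f g = max (norm_diff k f g) (norm_diff k (inv f) (inv g))"

definition dist_summand :: "nat \<Rightarrow> (circle \<Rightarrow> circle) \<Rightarrow> (circle \<Rightarrow> circle) \<Rightarrow> real"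
  where "dist_summand k f g = dist_Ck k f g / (2 ^ k * (1 + dist_Ck k f g))"

(* The summation index is shifted by one. The value 0 outside diffeo_smooth is a dummy:
   the locale Metric_space asks for nonnegativity without restricting to the carrier. *)
definition dist_smooth :: "(circle \<Rightarrow> circle) \<Rightarrow> (circle \<Rightarrow> circle) \<Rightarrow> real"
  where "dist_smooth f g =
    (if f \<in> diffeo_smooth \<and> g \<in> diffeo_smooth
     then \<Sum>k. dist_summand (Suc k) f g
     else 0)"

lemma lift_shift:
  assumes "is_lift F f"
  obtains c where "\<And>t. F (t + 1) = F t + c"
proof -
  have c: "continuous_on UNIV F" and F: "\<And>t. abs_circle (F t) = f (abs_circle t)"
    using assms by (auto simp: is_lift_def)
  define g where "g t = F (t + 1) - F t" for t
  have "g t \<in> \<int>" for t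
  proof -
    have "abs_circle (t + 1) = abs_circle t" by (simp add: circle.abs_eq_iff)
    then have "abs_circle (F (t + 1)) = abs_circle (F t)" by (simp add: F)
    then show ?thesis by (simp add: circle.abs_eq_iff g_def)
  qed
  note gi = this
  have cg: "continuous_on UNIV g" unfolding g_def
    by (intro continuous_intros continuous_on_compose2[OF c]) auto
  have "g constant_on UNIV"
  proof (rule continuous_discrete_range_constant[OF connected_UNIV cg])
    fix x :: real
    have "1 \<le> norm (g y - g x)" if "g y \<noteq> g x" for y
    proof -
      obtain m n where mn: "g y = of_int m" "g x = of_int n" using gi by (metis Ints_cases)
      with that have "m \<noteq> n" by auto
      then have "1 \<le> \<bar>m - n\<bar>" by linarith
      then have "1 \<le> \<bar>real_of_int (m - n)\<bar>" by linarith
      then show ?thesis unfolding mn by simp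
    qed
    then show "\<exists>e>0. \<forall>y. y \<in> UNIV \<and> g y \<noteq> g x \<longrightarrow> e \<le> norm (g y - g x)"
      by (intro exI[of _ 1]) auto
  qed
  then obtain c where "\<And>t. g t = c" unfolding constant_on_def by auto
  then show ?thesis by (intro that[of c]) (simp add: g_def algebra_simps)
qed

lemma deriv_shift:
  fixes G :: "real \<Rightarrow> real"
  assumes "\<And>t. G (t + 1) = G t + c"
  shows "deriv G (t + 1) = deriv G t"
proof -
  have "(G has_field_derivative D) (at (t + 1)) \<longleftrightarrow> (G has_field_derivative D) (at t)" for D
  proof -
    have "(G has_field_derivative D) (at (t + 1)) \<longleftrightarrow> ((\<lambda>x. G (x + 1)) has_field_derivative D) (at t)"
      by (rule DERIV_shift)
    also have "(\<lambda>x. G (x + 1)) = (\<lambda>x. G x + c)" using assms by auto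
    also have "((\<lambda>x. G x + c) has_field_derivative D) (at t) \<longleftrightarrow> (G has_field_derivative D) (at t)"
    proof
      assume "((\<lambda>x. G x + c) has_field_derivative D) (at t)"
      from DERIV_diff[OF this DERIV_const[of c]] show "(G has_field_derivative D) (at t)" by simp
    next
      assume "(G has_field_derivative D) (at t)"
      from DERIV_add[OF this DERIV_const[of c]]
      show "((\<lambda>x. G x + c) has_field_derivative D) (at t)" by simp
    qed
    finally show ?thesis .
  qed
  then show ?thesis unfolding deriv_def by simp
qed

lemma diffeo_smoothD:
  assumes "f \<in> diffeo_smooth"
  shows "f \<in> homeo_plus" "is_lift (lift f) f" "is_Ck k f" 
proof -
  have *: "f \<in> diffeo (Suc k)" for k using assms by (auto simp: diffeo_smooth_def)
  then show "f \<in> homeo_plus" by (auto simp: diffeo_def)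
  then show L: "is_lift (lift f) f" unfolding lift_def homeo_plus_def by (metis (mono_tags, lifting) CollectD someI_ex)
  show "is_Ck k f"
  proof (cases k)
    case 0 then show ?thesis using L by (simp add: is_Ck_def is_lift_def)
  next
    case (Suc n) then show ?thesis using *[of n] by (simp add: diffeo_def)
  qed
qed

lemma inv_diffeo_smooth: assumes "f \<in> diffeo_smooth" shows "inv f \<in> diffeo_smooth"
proof -
  have f: "f \<in> homeo_plus" by (rule diffeo_smoothD[OF assms])
  then have h: "homeomorphism UNIV UNIV f (inv f)" by (simp add: homeo_plus_def)
  then have b: "bij f" unfolding homeomorphism_def by (metis UNIV_I bijI inj_on_inverseI)
  obtain F where F: "is_lift F f" "strict_mono F" using f by (auto simp: homeo_plus_def)
  obtain c where c: "\<And>t. F (t+1) = F t + c" using lift_shift[OF F(1)] by blast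
  have c0: "c > 0" using c[of 0] strict_monoD[OF F(2), of 0 1] by simp
  have cn: "F (real n) = F 0 + n * c" for n
  proof (induction n)
    case (Suc n)
    show ?case using c[of "real n"] Suc by (simp add: algebra_simps)
  qed auto
  have cn': "F (- real n) = F 0 - n * c" for n
  proof (induction n)
    case (Suc n)
    show ?case using c[of "- real (Suc n)"] Suc by (simp add: algebra_simps)
  qed auto
  have cF: "continuous_on UNIV F" using F by (simp add: is_lift_def)
  have sj: "\<exists>x. F x = y" for y
  proof -
    obtain n where n: "\<bar>y - F 0\<bar> < real n * c" using reals_Archimedean3[OF c0] by blast
    have "\<exists>x. - real n \<le> x \<and> x \<le> real n \<and> F x = y"
      by (rule IVT') (use n cn[of n] cn'[of n] continuous_on_subset[OF cF] in auto)
    then show ?thesis by auto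
  qed
  have bF: "bij F" by (metis F(2) bijI sj strict_mono_imp_inj_on surjI surj_def)
  have l: "is_lift (inv F) (inv f)" unfolding is_lift_def
  proof safe
    have "isCont (inv F) y" for y
    proof -
      obtain x where x: "F x = y" using sj by blast
      have "isCont (inv F) (F x)"
        by (rule isCont_inverse_function[where d = 1])
           (use bF cF in \<open>auto simp: bij_is_inj continuous_on_eq_continuous_at\<close>)
      then show ?thesis using x by simp
    qed
    then show "continuous_on UNIV (inv F)" by (simp add: continuous_at_imp_continuous_on)
  next
    fix t
    have "f (abs_circle (inv F t)) = abs_circle t"
      using F(1) bF unfolding is_lift_def by (metis bij_inv_eq_iff)
    then show "abs_circle (inv F t) = inv f (abs_circle t)" using b by (metis bij_inv_eq_iff)
  qed
  have m: "strict_mono (inv F)" 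
    by (metis F(2) bF bij_inv_eq_iff strict_monoI strict_mono_less)
  have ii: "inv (inv f) = f" using b by (simp add: inv_inv_eq)
  have "inv f \<in> homeo_plus" unfolding homeo_plus_def using l m h ii homeomorphism_symD by auto
  then show ?thesis using assms ii unfolding diffeo_smooth_def diffeo_def by auto
qed

lemma deriv_bounded:
  assumes f: "f \<in> diffeo_smooth" and i: "i > 0"
  obtains B where "\<And>x. \<bar>circle_deriv i f x\<bar> \<le> B"
proof -
  obtain c where c: "\<And>t. lift f (t + 1) = lift f t + c" using lift_shift[OF diffeo_smoothD(2)[OF f]] by blast
  have per: "i > 0 \<Longrightarrow> (deriv ^^ i) (lift f) (t + 1) = (deriv ^^ i) (lift f) t" for t i
  proof (induction i arbitrary: t)
    case (Suc i)
    show ?case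
    proof (cases "i = 0")
      case True then show ?thesis using deriv_shift[of "lift f" c] c by simp
    next
      case False then show ?thesis using deriv_shift[of "(deriv ^^ i) (lift f)" 0] Suc by simp
    qed
  qed auto
  let ?G = "(deriv ^^ i) (lift f)"
  interpret periodic_fun_simple ?G 1 by standard (use per[OF i] in auto)
  have "continuous_on UNIV ?G" using diffeo_smoothD(3)[OF f, of i] by (simp add: is_Ck_def)
  then have "bounded (?G ` {0..1})"
    by (intro compact_imp_bounded compact_continuous_image) (auto intro: continuous_on_subset)
  then obtain B where B: "\<forall>x\<in>{0..1}. \<bar>?G x\<bar> \<le> B" unfolding bounded_iff by auto
  have "\<bar>?G t\<bar> \<le> B" for t
  proof -
    have "?G t = ?G (frac t)" unfolding frac_def using minus_of_int[of t "\<lfloor>t\<rfloor>"] by simp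
    then show ?thesis using B by (simp add: frac_lt_1 less_imp_le)
  qed
  then show ?thesis by (intro that[of B]) (simp add: circle_deriv_def)
qed

lemma dist_circle_le: "dist (x::circle) y \<le> 1"
proof (transfer)
  fix x y :: real
  show "\<bar>x - y - of_int (round (x - y))\<bar> \<le> 1" using of_int_round_abs_le[of "x - y"] by linarith
qed

lemma bdd_above_deriv_gap: assumes "f \<in> diffeo_smooth" "g \<in> diffeo_smooth"
  shows "bdd_above (range (deriv_gap i f g))"
proof (cases "i = 0")
  case True then show ?thesis by (intro bdd_aboveI[of _ 1]) (auto simp: deriv_gap_def dist_circle_le)
next
  case False
  obtain B where B: "\<And>x. \<bar>circle_deriv i f x\<bar> \<le> B" using deriv_bounded[OF assms(1)] False by blast
  obtain C where C: "\<And>x. \<bar>circle_deriv i g x\<bar> \<le> C" using deriv_bounded[OF assms(2)] False by blast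
  have "deriv_gap i f g x \<le> B + C" for x using B[of x] C[of x] False by (auto simp: deriv_gap_def)
  then show ?thesis by (intro bdd_aboveI[of _ "B+C"]) auto
qed

lemma deriv_gap_le: assumes "f \<in> diffeo_smooth" "g \<in> diffeo_smooth" shows "deriv_gap i f g x \<le> deriv_dist i f g"
  unfolding deriv_dist_def by (intro cSUP_upper bdd_above_deriv_gap assms) auto

lemma deriv_gap_nonneg: "0 \<le> deriv_gap i f g x" by (simp add: deriv_gap_def)

lemma deriv_dist_nonneg: assumes "f \<in> diffeo_smooth" "g \<in> diffeo_smooth" shows "0 \<le> deriv_dist i f g"
  using deriv_gap_le[OF assms] deriv_gap_nonneg order_trans by blast

lemma deriv_dist_triangle: assumes "f \<in> diffeo_smooth" "g \<in> diffeo_smooth" "h \<in> diffeo_smooth" 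
  shows "deriv_dist i f h \<le> deriv_dist i f g + deriv_dist i g h"
  unfolding deriv_dist_def[of i f h]
proof (rule cSUP_least)
  fix x
  have "deriv_gap i f h x \<le> deriv_gap i f g x + deriv_gap i g h x" by (auto simp: deriv_gap_def dist_triangle)
  also have "\<dots> \<le> deriv_dist i f g + deriv_dist i g h" by (intro add_mono deriv_gap_le assms)
  finally show "deriv_gap i f h x \<le> \<dots>" .
qed auto

lemma deriv_dist_commute: "deriv_dist i f g = deriv_dist i g f" by (simp add: deriv_dist_def deriv_gap_def dist_commute abs_minus_commute)

lemma deriv_dist_le_norm_diff: "i \<le> k \<Longrightarrow> deriv_dist i f g \<le> norm_diff k f g" unfolding norm_diff_def by (intro Max_ge) auto

lemma norm_diff_triangle: assumes "f \<in> diffeo_smooth" "g \<in> diffeo_smooth" "h \<in> diffeo_smooth" 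
  shows "norm_diff k f h \<le> norm_diff k f g + norm_diff k g h"
proof -
  have "deriv_dist i f h \<le> norm_diff k f g + norm_diff k g h" if "i \<le> k" for i
    using deriv_dist_triangle[OF assms, of i] deriv_dist_le_norm_diff[OF that, of f g] deriv_dist_le_norm_diff[OF that, of g h] by linarith
  then show ?thesis unfolding norm_diff_def[of k f h] by (intro Max.boundedI) auto
qed

lemma dist_Ck_nonneg: assumes "f \<in> diffeo_smooth" "g \<in> diffeo_smooth" shows "0 \<le> dist_Ck k f g"
  using deriv_dist_nonneg[OF assms, of 0] deriv_dist_le_norm_diff[of 0 k f g] unfolding dist_Ck_def by linarith

lemma dist_Ck_triangle: assumes "f \<in> diffeo_smooth" "g \<in> diffeo_smooth" "h \<in> diffeo_smooth" 
  shows "dist_Ck k f h \<le> dist_Ck k f g + dist_Ck k g h"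
  using norm_diff_triangle[OF assms, of k] norm_diff_triangle[of "inv f" "inv g" "inv h" k] assms inv_diffeo_smooth
  unfolding dist_Ck_def by (smt (verit))

lemma div_one_plus_mono: "0 \<le> (a::real) \<Longrightarrow> a \<le> b \<Longrightarrow> a / (1 + a) \<le> b / (1 + b)"
  by (simp add: divide_simps algebra_simps)

lemma div_one_plus_triangle: assumes "0 \<le> (a::real)" "0 \<le> b" "0 \<le> c" "a \<le> b + c" shows "a / (1 + a) \<le> b / (1 + b) + c / (1 + c)"
proof -
  have "a/(1+a) \<le> (b+c)/(1+(b+c))" using assms by (intro div_one_plus_mono) auto
  also have "\<dots> = b/(1+(b+c)) + c/(1+(b+c))" by (simp add: add_divide_distrib)
  also have "\<dots> \<le> b / (1 + b) + c / (1 + c)" using assms by (intro add_mono divide_left_mono) auto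
  finally show ?thesis .
qed

lemma dist_summand_eq: "dist_summand k f g = (1/2) ^ k * (dist_Ck k f g / (1 + dist_Ck k f g))"
  by (simp add: dist_summand_def power_divide divide_simps)

lemma dist_summand_nonneg: assumes "f \<in> diffeo_smooth" "g \<in> diffeo_smooth" shows "0 \<le> dist_summand k f g"
  using dist_Ck_nonneg[OF assms] by (simp add: dist_summand_def)

lemma summable_dist_summand: assumes "f \<in> diffeo_smooth" "g \<in> diffeo_smooth"
  shows "summable (\<lambda>k. dist_summand (Suc k) f g)"
proof (subst summable_Suc_iff, rule summable_comparison_test')
  show "summable (\<lambda>k. (1/2::real) ^ k)" by (rule summable_geometric) simp
  fix k :: nat
  have "dist_Ck k f g / (1 + dist_Ck k f g) \<le> 1" using dist_Ck_nonneg[OF assms, of k] by simp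
  then have "dist_summand k f g \<le> (1/2) ^ k * 1" unfolding dist_summand_eq by (intro mult_left_mono) auto
  then show "norm (dist_summand k f g) \<le> (1/2) ^ k" using dist_summand_nonneg[OF assms, of k] by simp
qed

lemma dist_smooth_eq: "f \<in> diffeo_smooth \<Longrightarrow> g \<in> diffeo_smooth \<Longrightarrow> dist_smooth f g = (\<Sum>k. dist_summand (Suc k) f g)"
  unfolding dist_smooth_def by simp

lemma Metric_space_smooth: "Metric_space diffeo_smooth dist_smooth"
proof
  fix f g
  show "dist_smooth f g = dist_smooth g f"
    by (simp add: dist_smooth_def dist_summand_def dist_Ck_def norm_diff_def deriv_dist_commute[of _ f g] deriv_dist_commute[of _ "inv f" "inv g"])
  have *: "0 \<le> dist_smooth f g" if "f \<in> diffeo_smooth" "g \<in> diffeo_smooth"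
    unfolding dist_smooth_eq[OF that] by (intro suminf_nonneg summable_dist_summand dist_summand_nonneg that)
  show "0 \<le> dist_smooth f g"
    using * by (cases "f \<in> diffeo_smooth \<and> g \<in> diffeo_smooth") (auto simp: dist_smooth_def)
  assume fg: "f \<in> diffeo_smooth" "g \<in> diffeo_smooth"
  show "dist_smooth f g = 0 \<longleftrightarrow> f = g"
  proof
    assume "dist_smooth f g = 0"
    then have "dist_summand (Suc 0) f g = 0" unfolding dist_smooth_eq[OF fg]
      using suminf_eq_zero_iff[OF summable_dist_summand[OF fg] dist_summand_nonneg[OF fg]] by auto
    then have "dist_Ck 1 f g = 0" using dist_Ck_nonneg[OF fg, of 1] by (auto simp: dist_summand_def)
    then have "deriv_dist 0 f g \<le> 0" using deriv_dist_le_norm_diff[of 0 1 f g] unfolding dist_Ck_def by linarith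
    then have "deriv_gap 0 f g x \<le> 0" for x using deriv_gap_le[OF fg] order_trans by blast
    then show "f = g" by (auto simp: deriv_gap_def)
  next
    assume "f = g"
    have "deriv_dist i h h = 0" for i h by (simp add: deriv_dist_def deriv_gap_def)
    then show "dist_smooth f g = 0" using \<open>f = g\<close> by (simp add: dist_smooth_def dist_summand_def dist_Ck_def norm_diff_def)
  qed
next
  fix f g h assume a: "f \<in> diffeo_smooth" "g \<in> diffeo_smooth" "h \<in> diffeo_smooth" 
  have "dist_summand k f h \<le> dist_summand k f g + dist_summand k g h" for k
    unfolding dist_summand_eq distrib_left[symmetric] by (intro mult_left_mono div_one_plus_triangle dist_Ck_nonneg dist_Ck_triangle a) auto
  then show "dist_smooth f h \<le> dist_smooth f g + dist_smooth g h"
    unfolding dist_smooth_eq[OF a(1,3)] dist_smooth_eq[OF a(1,2)] dist_smooth_eq[OF a(2,3)]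
    by (subst suminf_add) (intro suminf_le summable_dist_summand summable_add a | simp)+
qed

definition smooth_topology :: "(circle \<Rightarrow> circle) topology"
  where "smooth_topology = Metric_space.mtopology diffeo_smooth dist_smooth"

section \<open>Free actions\<close>

definition smooth_action :: "(int ^ 'd \<Rightarrow> circle \<Rightarrow> circle) \<Rightarrow> bool"
  where "smooth_action \<rho> \<longleftrightarrow>
    (\<forall>v. \<rho> v \<in> diffeo_smooth) \<and> (\<forall>v w. \<rho> (v + w) = \<rho> v \<circ> \<rho> w)"

definition free_actions :: "(int ^ 'd \<Rightarrow> circle \<Rightarrow> circle) set"
  where "free_actions = {\<rho>. smooth_action \<rho> \<and> (\<forall>v. v \<noteq> 0 \<longrightarrow> (\<forall>x. \<rho> v x \<noteq> x))}"

definition generators :: "(int ^ 'd \<Rightarrow> circle \<Rightarrow> circle) \<Rightarrow> 'd \<Rightarrow> circle \<Rightarrow> circle"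
  where "generators \<rho> i = \<rho> (axis i 1)"

(* An action is determined by its generators, so this is the subspace topology under the
   identification of an action with the tuple of its generators. *)
definition action_topology :: "(int ^ 'd \<Rightarrow> circle \<Rightarrow> circle) topology"
  where "action_topology =
    pullback_topology free_actions generators (product_topology (\<lambda>_. smooth_topology) UNIV)"

definition borel_of :: "'a topology \<Rightarrow> 'a measure"
  where "borel_of X = sigma (topspace X) {U. openin X U}"

definition conjugate_by ::
    "(circle \<Rightarrow> circle) set \<Rightarrow> (int ^ 'd \<Rightarrow> circle \<Rightarrow> circle) \<Rightarrow> (int ^ 'd \<Rightarrow> circle \<Rightarrow> circle) \<Rightarrow> bool"
  where "conjugate_by \<D> \<rho> \<sigma> \<longleftrightarrow> (\<exists>h\<in>\<D>. \<forall>v. \<rho> v = h \<circ> \<sigma> v \<circ> inv h)"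

end

theory Submission
  imports Defs "HOL-Probability.Probability"
begin

text \<open>A fast approximation (Anosov--Katok) construction attaches to every binary sequence \<open>x\<close> a
  homeomorphism \<open>H x\<close>, the limit of the compositions of those maps \<open>h n\<close> for which \<open>x n\<close> holds.
  Here \<open>h n\<close> is a very steep smooth diffeomorphism that commutes with the rotation by \<open>1 / q n\<close>,
  and \<open>q (n + 1)\<close> is chosen so large, depending on \<open>h 0, \<dots>, h n\<close>, that for suitable
  rationally independent angles of the form \<open>\<Sum>n. c n / q n\<close> the conjugates by \<open>H x\<close> of the
  rotations are smooth and depend continuously on \<open>x\<close>. Sequences with a common tail yield
  smoothly conjugate actions. Conversely, irrationality forces every conjugacy between the actions
  of \<open>x\<close> and \<open>y\<close> to be \<open>H x\<close> composed with a rotation and the inverse of \<open>H y\<close>, which is not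
  Hoelder if \<open>x n\<close> holds and \<open>y n\<close> fails for infinitely many \<open>n\<close>. A Borel invariant, evaluated on
  the action of a random \<open>x\<close>, obeys Kolmogorov's zero-one law, so almost surely it takes the same
  value at \<open>x\<close> and at the complement of \<open>x\<close>, although in one of the two orders these actions are
  not conjugate.\<close>

text \<open>The regularity classes enter only through two extremes: each contains every smooth
  diffeomorphism, and each of their members is Hoelder for some exponent. Hoelder homeomorphisms
  with one fixed exponent are closed neither under inversion nor under composition, so conjugacy in
  such a class is not known beforehand to be symmetric or transitive; the order of \<open>x\<close>
  and \<open>y\<close> therefore matters in the non-conjugacy argument. The conjugated rotations can
  be smooth although \<open>HH x\<close> need not even be Hoelder, because stage n separates into
  two moves. Inserting \<open>h n\<close> changes nothing for an angle that is a multiple of 1 /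
  \<open>q n\<close>; the angle is then corrected by at most (n + 1) / \<open>q (n + 1)\<close>, a
  length chosen after \<open>h n\<close>. The factor n + 1 eventually exceeds the entries of any
  fixed integer vector, so one sequence of denominators serves the whole group. Every choice at
  stage n is made for the partial compositions of all sequences simultaneously; hence the angles do
  not depend on \<open>x\<close>, and sequences that agree below n have nearby actions.\<close>

section \<open>Smooth functions of a real variable\<close>

text \<open>Peeling off the innermost derivative turns the product, chain and reciprocal rules into
  one-step inductions.\<close>

primrec Ck :: "nat \<Rightarrow> (real \<Rightarrow> real) \<Rightarrow> bool" where
  "Ck 0 f \<longleftrightarrow> continuous_on UNIV f"
| "Ck (Suc k) f \<longleftrightarrow> (\<forall>t. f differentiable at t) \<and> Ck k (deriv f)"

definition smooth :: "(real \<Rightarrow> real) \<Rightarrow> bool"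
  where "smooth f \<longleftrightarrow> (\<forall>k. Ck k f)"

lemma differentiable_DERIV_deriv:
  fixes f :: "real \<Rightarrow> real"
  shows "f differentiable at t \<Longrightarrow> (f has_field_derivative deriv f t) (at t)"
  by (simp add: DERIV_deriv_iff_real_differentiable)

lemma Ck_SucI:
  assumes "\<And>t. (f has_field_derivative g t) (at t)" "Ck k g"
  shows "Ck (Suc k) f"
proof -
  have "deriv f = g" using assms(1) by (intro ext DERIV_imp_deriv) auto
  then show ?thesis using assms by (auto simp: real_differentiable_def)
qed

lemma Ck_SucE:
  assumes "Ck (Suc k) f"
  obtains g where "\<And>t. (f has_field_derivative g t) (at t)" "Ck k g" "deriv f = g"
  using assms that[of "deriv f"] by (auto simp: differentiable_DERIV_deriv)

lemma Ck_Suc_mono: "Ck (Suc k) f \<Longrightarrow> Ck k f"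
proof (induction k arbitrary: f)
  case 0
  then show ?case
    by (auto intro!: continuous_at_imp_continuous_on differentiable_imp_continuous_within)
qed auto

lemma Ck_const: "Ck k (\<lambda>_. c)"
  by (induction k arbitrary: c) (auto simp: deriv_const)

lemma Ck_ident: "Ck k (\<lambda>x. x)"
proof (cases k)
  case (Suc n)
  then show ?thesis using Ck_const[of n 1] by (auto intro!: Ck_SucI[where g = "\<lambda>_. 1"] derivative_eq_intros)
qed auto

lemma Ck_add: "Ck k f \<Longrightarrow> Ck k g \<Longrightarrow> Ck k (\<lambda>x. f x + g x)"
proof (induction k arbitrary: f g)
  case 0 then show ?case by (auto intro: continuous_intros)
next
  case (Suc k)
  from Suc.prems obtain f' g' where "\<And>t. (f has_field_derivative f' t) (at t)" "Ck k f'"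
    "\<And>t. (g has_field_derivative g' t) (at t)" "Ck k g'" by (meson Ck_SucE)
  then show ?case by (intro Ck_SucI[where g = "\<lambda>x. f' x + g' x"] derivative_intros Suc.IH) auto
qed

lemma Ck_mult: "Ck k f \<Longrightarrow> Ck k g \<Longrightarrow> Ck k (\<lambda>x. f x * g x)"
proof (induction k arbitrary: f g)
  case 0 then show ?case by (auto intro: continuous_intros)
next
  case (Suc k)
  from Suc.prems obtain f' g' where *: "\<And>t. (f has_field_derivative f' t) (at t)" "Ck k f'"
    "\<And>t. (g has_field_derivative g' t) (at t)" "Ck k g'" by (meson Ck_SucE)
  moreover have "Ck k f" "Ck k g" using Suc.prems by (auto intro: Ck_Suc_mono)
  ultimately show ?case
    by (intro Ck_SucI[where g = "\<lambda>x. f' x * g x + g' x * f x"] DERIV_mult Ck_add Suc.IH) auto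
qed

lemma Ck_compose: "Ck k f \<Longrightarrow> Ck k g \<Longrightarrow> Ck k (\<lambda>x. f (g x))"
proof (induction k arbitrary: f g)
  case 0 then show ?case by (auto intro: continuous_on_compose2)
next
  case (Suc k)
  from Suc.prems obtain f' g' where *: "\<And>t. (f has_field_derivative f' t) (at t)" "Ck k f'"
    "\<And>t. (g has_field_derivative g' t) (at t)" "Ck k g'" by (meson Ck_SucE)
  moreover have "Ck k g" using Suc.prems by (auto intro: Ck_Suc_mono)
  ultimately show ?case
    by (intro Ck_SucI[OF DERIV_chain2[OF *(1) *(3)]] Ck_mult Suc.IH[of f' g])
qed

lemma Ck_inverse: "Ck k f \<Longrightarrow> (\<And>x. f x \<noteq> 0) \<Longrightarrow> Ck k (\<lambda>x. inverse (f x))"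
proof (induction k)
  case 0 then show ?case by (auto intro: continuous_intros)
next
  case (Suc k)
  from Suc.prems obtain f' where *: "\<And>t. (f has_field_derivative f' t) (at t)" "Ck k f'" by (meson Ck_SucE)
  moreover have "Ck k f" using Suc.prems by (auto intro: Ck_Suc_mono)
  then have "Ck k (\<lambda>x. inverse (f x))" using Suc by auto
  moreover have "((\<lambda>x. inverse (f x)) has_field_derivative -1 * f' t * (inverse (f t) * inverse (f t))) (at t)" for t
    using DERIV_inverse_fun[OF *(1)[of t] Suc.prems(2)] by (simp add: algebra_simps)
  ultimately show ?case
    by (intro Ck_SucI[where g = "\<lambda>t. -1 * f' t * (inverse (f t) * inverse (f t))"] Ck_mult Ck_const) auto
qed

lemma Ck_sin_cos: "Ck k (\<lambda>x. sin (x :: real)) \<and> Ck k (\<lambda>x. cos (x :: real))"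
proof (induction k)
  case 0 then show ?case by (auto intro: continuous_intros)
next
  case (Suc k)
  have "Ck (Suc k) (\<lambda>x. sin (x :: real))"
    using Suc by (intro Ck_SucI[where g = cos]) (auto intro!: derivative_eq_intros)
  moreover have "Ck k (\<lambda>x. -1 * sin (x :: real))" using Suc by (intro Ck_mult Ck_const) auto
  then have "Ck (Suc k) (\<lambda>x. cos (x :: real))"
    by (rule Ck_SucI[rotated]) (auto intro!: derivative_eq_intros)
  ultimately show ?case by auto
qed

lemma smooth_const: "smooth (\<lambda>_. c)" and smooth_ident: "smooth (\<lambda>x. x)"
  and smooth_add: "smooth f \<Longrightarrow> smooth g \<Longrightarrow> smooth (\<lambda>x. f x + g x)"
  and smooth_mult: "smooth f \<Longrightarrow> smooth g \<Longrightarrow> smooth (\<lambda>x. f x * g x)"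
  and smooth_compose: "smooth f \<Longrightarrow> smooth g \<Longrightarrow> smooth (\<lambda>x. f (g x))"
  and smooth_sin: "smooth (\<lambda>x. sin x)"
  by (auto simp: smooth_def Ck_const Ck_ident Ck_add Ck_mult Ck_compose Ck_sin_cos)

lemma smooth_deriv: "smooth f \<Longrightarrow> smooth (deriv f)"
  by (metis Ck.simps(2) smooth_def)

lemma smooth_higher_deriv: "smooth f \<Longrightarrow> smooth ((deriv ^^ i) f)"
  by (induction i) (auto simp: smooth_deriv)

lemma smooth_DERIV: "smooth f \<Longrightarrow> (f has_field_derivative deriv f t) (at t)"
  by (metis Ck.simps(2) smooth_def differentiable_DERIV_deriv)

lemma smooth_higher_DERIV:
  "smooth f \<Longrightarrow> ((deriv ^^ i) f has_field_derivative (deriv ^^ Suc i) f t) (at t)"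
  using smooth_DERIV[OF smooth_higher_deriv] by simp

lemma smooth_continuous: "smooth f \<Longrightarrow> continuous_on UNIV f"
  by (metis Ck.simps(1) smooth_def)

lemma smoothI:
  assumes "\<And>i t. (deriv ^^ i) f differentiable at t"
  shows "smooth f"
proof -
  have "Ck k ((deriv ^^ i) f)" for k i
  proof (induction k arbitrary: i)
    case 0 then show ?case
      using assms by (auto intro!: continuous_at_imp_continuous_on differentiable_imp_continuous_within)
  next
    case (Suc k) then show ?case using assms Suc[of "Suc i"] by simp
  qed
  then show ?thesis by (metis smooth_def funpow_0)
qed

lemma DERIV_inv:
  fixes f :: "real \<Rightarrow> real"
  assumes f: "\<And>t. (f has_field_derivative f' t) (at t)" "\<And>t. f' t \<noteq> 0"
    and b: "bij f" and c: "continuous_on UNIV (inv f)"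
  shows "(inv f has_field_derivative inverse (f' (inv f t))) (at t)"
proof (rule DERIV_inverse_function[where f = f and a = "t - 1" and b = "t + 1"])
  show "isCont (inv f) t" using c by (simp add: continuous_on_eq_continuous_at)
  show "f (inv f y) = y" for y using b by (simp add: bij_is_surj surj_f_inv_f)
qed (use f in auto)

text \<open>Bootstrapping: the derivative of the inverse is the reciprocal of \<open>deriv f\<close>
  composed with the inverse, hence as regular as the inverse itself, which thus gains one order per
  step.\<close>

lemma smooth_inv:
  assumes f: "smooth f" and nz: "\<And>t. deriv f t \<noteq> 0"
    and b: "bij f" and c: "continuous_on UNIV (inv f)"
  shows "smooth (inv f)"
proof -
  have "Ck k (inv f)" for k
  proof (induction k)
    case 0 then show ?case using c by simp
  next
    case (Suc k)
    have "Ck k (deriv f)" using f smooth_deriv smooth_def by blast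
    then have "Ck k (\<lambda>t. inverse (deriv f (inv f t)))"
      using Suc nz Ck_inverse[OF Ck_compose[of k "deriv f" "inv f"]] by simp
    then show ?case
      using DERIV_inv[OF smooth_DERIV[OF f] nz b c] by (rule Ck_SucI[rotated])
  qed
  then show ?thesis by (simp add: smooth_def)
qed

text \<open>A form of Faa di Bruno's formula in which only the dependence on \<open>s\<close> is made explicit.\<close>

lemma higher_deriv_compose_shift:
  assumes H: "smooth H" and G: "smooth G"
  obtains b where "\<And>j. smooth (b j)"
    "\<And>s u. (deriv ^^ i) (\<lambda>u. H (s + G u)) u = (\<Sum>j\<le>i. (deriv ^^ j) H (s + G u) * b j u)"
proof -
  have "\<exists>b. (\<forall>j. smooth (b j)) \<and> (\<forall>s u. (deriv ^^ i) (\<lambda>u. H (s + G u)) u =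
    (\<Sum>j\<le>i. (deriv ^^ j) H (s + G u) * b j u))"
  proof (induction i)
    case 0
    show ?case by (rule exI[of _ "\<lambda>_ _. 1"]) (auto intro: smooth_const)
  next
    case (Suc i)
    then obtain b where b: "\<And>j. smooth (b j)"
      "\<And>s u. (deriv ^^ i) (\<lambda>u. H (s + G u)) u = (\<Sum>j\<le>i. (deriv ^^ j) H (s + G u) * b j u)" by blast
    \<comment> \<open>By the product rule the new derivative either falls on a coefficient and keeps
      the order of the derivative of \<open>H\<close>, or falls on \<open>H\<close> and raises that
      order by one.\<close>
    define c where "c j = (\<lambda>u. (if j \<le> i then deriv (b j) u else 0) +
      (if j = 0 then 0 else b (j - 1) u * deriv G u))" for j
    have "smooth (c j)" for j
    proof -
      have "smooth (\<lambda>u. if j \<le> i then deriv (b j) u else 0)"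
        by (cases "j \<le> i") (auto intro: smooth_const smooth_deriv b)
      moreover have "smooth (\<lambda>u. if j = 0 then 0 else b (j - 1) u * deriv G u)"
        by (cases "j = 0") (auto intro!: smooth_const smooth_mult smooth_deriv b G)
      ultimately show ?thesis unfolding c_def by (rule smooth_add)
    qed
    moreover have "(deriv ^^ Suc i) (\<lambda>u. H (s + G u)) u = (\<Sum>j\<le>Suc i. (deriv ^^ j) H (s + G u) * c j u)" for s u
    proof -
      let ?D = "\<lambda>j. (deriv ^^ j) H (s + G u)"
      have 1: "((\<lambda>u. (deriv ^^ j) H (s + G u)) has_field_derivative ?D (Suc j) * deriv G u) (at u)" for j
      proof (rule DERIV_chain2[OF smooth_higher_DERIV[OF H]])
        show "((\<lambda>u. s + G u) has_field_derivative deriv G u) (at u)"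
          using DERIV_add[OF DERIV_const[of s] smooth_DERIV[OF G]] by simp
      qed
      have "((\<lambda>u. \<Sum>j\<le>i. (deriv ^^ j) H (s + G u) * b j u) has_field_derivative
        (\<Sum>j\<le>i. ?D (Suc j) * deriv G u * b j u + deriv (b j) u * ?D j)) (at u)"
        by (intro DERIV_sum DERIV_mult 1 smooth_DERIV b)
      moreover have "(deriv ^^ i) (\<lambda>u. H (s + G u)) = (\<lambda>u. \<Sum>j\<le>i. (deriv ^^ j) H (s + G u) * b j u)"
        using b(2) by auto
      ultimately have "(deriv ^^ Suc i) (\<lambda>u. H (s + G u)) u =
          (\<Sum>j\<le>i. ?D (Suc j) * deriv G u * b j u + deriv (b j) u * ?D j)"
        by (simp add: DERIV_imp_deriv)
      also have "\<dots> = (\<Sum>j\<le>i. ?D j * deriv (b j) u) + (\<Sum>j\<le>i. ?D (Suc j) * (b j u * deriv G u))"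
        by (simp add: sum.distrib algebra_simps)
      also have "(\<Sum>j\<le>i. ?D j * deriv (b j) u) = (\<Sum>j\<le>Suc i. ?D j * (if j \<le> i then deriv (b j) u else 0))"
        by simp
      also have "(\<Sum>j\<le>i. ?D (Suc j) * (b j u * deriv G u)) =
          (\<Sum>j\<le>Suc i. ?D j * (if j = 0 then 0 else b (j - 1) u * deriv G u))"
        by (subst sum.atMost_Suc_shift) (simp del: sum.atMost_Suc)
      also have "(\<Sum>j\<le>Suc i. ?D j * (if j \<le> i then deriv (b j) u else 0)) +
          (\<Sum>j\<le>Suc i. ?D j * (if j = 0 then 0 else b (j - 1) u * deriv G u)) =
          (\<Sum>j\<le>Suc i. ?D j * c j u)"
        unfolding sum.distrib[symmetric] c_def distrib_left by (rule refl)
      finally show ?thesis .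
    qed
    ultimately show ?case by blast
  qed
  then show ?thesis using that by blast
qed

text \<open>The range of controlled orders grows with n, so a single sequence of estimates reaches
  every order i, from index max N i on. Each order then converges uniformly, and the limits may be
  differentiated term by term.\<close>

lemma smooth_limit:
  fixes F :: "nat \<Rightarrow> real \<Rightarrow> real"
  assumes sm: "\<And>n. smooth (F n)" and lim: "\<And>u. (\<lambda>n. F n u) \<longlonglongrightarrow> F' u"
    and close: "\<And>i n u. n \<ge> N \<Longrightarrow> n \<ge> i \<Longrightarrow>
      \<bar>(deriv ^^ i) (F (Suc n)) u - (deriv ^^ i) (F n) u\<bar> \<le> (1 / 2) ^ n"
  shows "smooth F'"
    and "\<And>i n u. n \<ge> N \<Longrightarrow> n \<ge> i \<Longrightarrow> \<bar>(deriv ^^ i) F' u - (deriv ^^ i) (F n) u\<bar> \<le> 2 * (1 / 2) ^ n"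
proof -
  let ?D = "\<lambda>i n. (deriv ^^ i) (F n)"
  have close': "\<bar>?D i (n + k) u - ?D i n u\<bar> \<le> 2 * (1 / 2) ^ n" if "n \<ge> N" "n \<ge> i" for i n k u
  proof -
    \<comment> \<open>The exact geometric partial sum, unlike its upper bound, is reproduced by the
      induction.\<close>
    have "\<bar>?D i (n + k) u - ?D i n u\<bar> \<le> 2 * (1 / 2) ^ n - 2 * (1 / 2) ^ (n + k)"
    proof (induction k)
      case (Suc k)
      have "\<bar>?D i (Suc (n + k)) u - ?D i (n + k) u\<bar> \<le> (1 / 2) ^ (n + k)"
        using that by (intro close) auto
      then show ?case using Suc by simp
    qed auto
    also have "\<dots> \<le> 2 * (1 / 2) ^ n" by simp
    finally show ?thesis .
  qed
  have "Cauchy (\<lambda>n. ?D i n u)" for i u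
  proof (rule metric_CauchyI)
    fix e :: real assume "e > 0"
    then obtain M where M: "(1 / 2) ^ M < e / 4" using real_arch_pow_inv[of "e / 4" "1 / 2"] by auto
    define n where "n = max M (max N i)"
    have "(1 / 2 :: real) ^ n \<le> (1 / 2) ^ M" by (intro power_decreasing) (auto simp: n_def)
    then have n: "2 * (1 / 2 :: real) ^ n < e / 2" using M by linarith
    have "dist (?D i m u) (?D i m' u) < e" if "m \<ge> n" "m' \<ge> n" for m m'
    proof -
      have "\<bar>?D i (n + (m - n)) u - ?D i n u\<bar> \<le> 2 * (1 / 2) ^ n"
        "\<bar>?D i (n + (m' - n)) u - ?D i n u\<bar> \<le> 2 * (1 / 2) ^ n"
        by (intro close'; auto simp: n_def)+
      then show ?thesis using n that by (simp add: dist_real_def)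
    qed
    then show "\<exists>n. \<forall>m\<ge>n. \<forall>m'\<ge>n. dist (?D i m u) (?D i m' u) < e" by blast
  qed
  then have "\<exists>l. (\<lambda>n. ?D i n u) \<longlonglongrightarrow> l" for i u by (metis Cauchy_convergent convergent_def)
  then obtain g where g: "\<And>i u. (\<lambda>n. ?D i n u) \<longlonglongrightarrow> g i u" by metis
  have gclose: "\<bar>g i u - ?D i n u\<bar> \<le> 2 * (1 / 2) ^ n" if "n \<ge> N" "n \<ge> i" for i n u
  proof (rule tendsto_upperbound[where F = sequentially])
    show "(\<lambda>k. \<bar>?D i (n + k) u - ?D i n u\<bar>) \<longlonglongrightarrow> \<bar>g i u - ?D i n u\<bar>"
      using LIMSEQ_ignore_initial_segment[OF g[of i u], of n] by (intro tendsto_intros) (simp add: add.commute)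
  qed (use close'[OF that] in auto)
  have gder: "(g i has_field_derivative g (Suc i) t) (at t)" for i t
  proof -
    have "\<exists>g'. \<forall>x\<in>UNIV. (\<lambda>n. ?D i n x) \<longlonglongrightarrow> g' x \<and> (g' has_derivative (\<lambda>h. g (Suc i) x * h)) (at x within UNIV)"
    proof (rule has_derivative_sequence[where f' = "\<lambda>n x h. ?D (Suc i) n x * h" and ?x0.0 = 0])
      show "(\<lambda>n. ?D i n 0) \<longlonglongrightarrow> g i 0" by (rule g)
      show "(?D i n has_derivative (*) (?D (Suc i) n x)) (at x within UNIV)" for n x
        using smooth_higher_DERIV[OF sm[of n], of i x] by (simp add: has_field_derivative_def)
      fix e :: real assume "e > 0"
      obtain M where M: "(1 / 2) ^ M < e / 4" using \<open>e > 0\<close> real_arch_pow_inv[of "e / 4" "1 / 2"] by auto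
      have "\<bar>?D (Suc i) n x * h - g (Suc i) x * h\<bar> \<le> e * \<bar>h\<bar>" if "n \<ge> max M (max N (Suc i))" for n x h
      proof -
        have "(1 / 2 :: real) ^ n \<le> (1 / 2) ^ M" using that by (intro power_decreasing) auto
        moreover have "\<bar>g (Suc i) x - ?D (Suc i) n x\<bar> \<le> 2 * (1 / 2) ^ n" using that by (intro gclose) auto
        ultimately have "\<bar>?D (Suc i) n x - g (Suc i) x\<bar> \<le> e" using M \<open>e > 0\<close> by linarith
        then show ?thesis by (metis abs_ge_zero abs_mult left_diff_distrib mult_right_mono)
      qed
      then show "\<forall>\<^sub>F n in sequentially. \<forall>x\<in>UNIV. \<forall>h. norm (?D (Suc i) n x * h - g (Suc i) x * h) \<le> e * norm h"
        by (intro eventually_sequentiallyI[of "max M (max N (Suc i))"]) auto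
    qed auto
    then obtain g' where g': "\<And>x. (\<lambda>n. ?D i n x) \<longlonglongrightarrow> g' x"
      "(g' has_derivative (\<lambda>h. g (Suc i) t * h)) (at t)" by auto
    have "g' = g i" using LIMSEQ_unique[OF g g'(1)] by (metis ext)
    then show ?thesis using g'(2) by (simp add: has_field_derivative_def)
  qed
  have eq: "(deriv ^^ i) F' = g i" for i
  proof (induction i)
    case 0 then show ?case using LIMSEQ_unique[OF lim] g[of 0] by (auto intro!: ext)
  next
    case (Suc i) then show ?case using gder[of i] by (auto intro!: ext DERIV_imp_deriv)
  qed
  show "smooth F'" by (rule smoothI) (use gder in \<open>auto simp: eq real_differentiable_def\<close>)
  show "\<bar>(deriv ^^ i) F' u - ?D i n u\<bar> \<le> 2 * (1 / 2) ^ n" if "n \<ge> N" "n \<ge> i" for i n u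
    using gclose[OF that] by (simp add: eq)
qed

section \<open>Lifts of degree one\<close>

lemma abs_rep_circle: "abs_circle (rep_circle x) = x"
  by (rule Quotient3_abs_rep[OF Quotient3_circle])

lemma dist_abs_circle_le: "dist (abs_circle s) (abs_circle t) \<le> \<bar>s - t\<bar>"
  using round_diff_minimal[of "s - t" 0] by (simp add: dist_circle.abs_eq)

lemma dist_abs_circle_eq:
  assumes "\<bar>s - t\<bar> \<le> 1 / 4"
  shows "dist (abs_circle s) (abs_circle t) = \<bar>s - t\<bar>"
proof -
  have "s - t \<le> 1 / 4" "- (1 / 4) \<le> s - t" using assms by linarith+
  then have "round (s - t) = 0" by (intro round_unique) auto
  then show ?thesis by (simp add: dist_circle.abs_eq)
qed

text \<open>Carries Lipschitz estimates from the line to the circle without a case distinction on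
  wrapping around.\<close>

lemma circle_near_reps:
  obtains s t where "x = abs_circle s" "y = abs_circle t" "\<bar>s - t\<bar> = dist x y"
proof -
  define s where "s = rep_circle x - of_int (round (rep_circle x - rep_circle y))"
  have "abs_circle s = abs_circle (rep_circle x)" by (simp add: s_def circle.abs_eq_iff)
  then have s: "abs_circle s = x" by (simp add: abs_rep_circle)
  have "dist (abs_circle (rep_circle x)) (abs_circle (rep_circle y)) = \<bar>s - rep_circle y\<bar>"
    by (simp add: dist_circle.abs_eq s_def algebra_simps)
  then show ?thesis using that[of s "rep_circle y"] s by (simp add: abs_rep_circle)
qed

text \<open>These are the lifts of the orientation-preserving circle homeomorphisms; with
  \<open>circ\<close> they replace the arbitrary choice made by \<open>lift\<close>.\<close>

definition deg_one :: "(real \<Rightarrow> real) \<Rightarrow> bool"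
  where "deg_one F \<longleftrightarrow> continuous_on UNIV F \<and> strict_mono F \<and> (\<forall>t. F (t + 1) = F t + 1)"

definition circ :: "(real \<Rightarrow> real) \<Rightarrow> circle \<Rightarrow> circle"
  where "circ F x = abs_circle (F (rep_circle x))"

lemma shift_of_int:
  fixes F :: "real \<Rightarrow> real"
  assumes "\<And>t. F (t + 1) = F t + c"
  shows "F (t + of_int n) = F t + of_int n * c"
proof (induction n)
  case (nonneg n)
  show ?case
  proof (induction n)
    case (Suc n) then show ?case using assms[of "t + real n"] by (simp add: algebra_simps)
  qed auto
next
  case (neg n)
  have "F (t - real n) = F t - real n * c" for n
  proof (induction n)
    case (Suc n) then show ?case using assms[of "t - real (Suc n)"] by (simp add: algebra_simps)
  qed auto
  from this[of "Suc n"] show ?case by (simp add: algebra_simps)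
qed

lemma deg_one_of_int: "deg_one F \<Longrightarrow> F (t + of_int n) = F t + of_int n"
  using shift_of_int[of F 1 t n] by (simp add: deg_one_def)

lemma deg_one_less_iff: "deg_one F \<Longrightarrow> F s < F t \<longleftrightarrow> s < t"
  and deg_one_le_iff: "deg_one F \<Longrightarrow> F s \<le> F t \<longleftrightarrow> s \<le> t"
  and deg_one_inj: "deg_one F \<Longrightarrow> inj F"
  by (auto simp: deg_one_def strict_mono_less strict_mono_less_eq strict_mono_imp_inj_on)

lemma circ_abs:
  assumes "deg_one F"
  shows "circ F (abs_circle t) = abs_circle (F t)"
proof -
  have "abs_circle (rep_circle (abs_circle t)) = abs_circle t" by (rule abs_rep_circle)
  then obtain n where "rep_circle (abs_circle t) - t = of_int n"
    by (auto simp: circle.abs_eq_iff elim: Ints_cases)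
  then have "rep_circle (abs_circle t) = t + of_int n" by simp
  then show ?thesis using deg_one_of_int[OF assms] by (simp add: circ_def circle.abs_eq_iff)
qed

lemma circ_eqI:
  assumes "deg_one F" "\<And>t. abs_circle (F t) = f (abs_circle t)"
  shows "f = circ F"
  by (metis abs_rep_circle assms(2) circ_def ext)

lemma is_lift_circ: "deg_one F \<Longrightarrow> is_lift F (circ F)"
  by (simp add: is_lift_def circ_abs) (simp add: deg_one_def)

lemma deg_one_surj:
  assumes F: "deg_one F"
  shows "surj F"
  unfolding surj_def
proof
  fix y
  obtain n :: nat where n: "\<bar>y - F 0\<bar> < real n" using reals_Archimedean2 by blast
  have "F (real n) = F 0 + n" "F (- real n) = F 0 - n"
    using deg_one_of_int[OF F, of 0 "int n"] deg_one_of_int[OF F, of 0 "- int n"] by auto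
  then have "\<exists>x. - real n \<le> x \<and> x \<le> real n \<and> F x = y"
    using n F by (intro IVT') (auto simp: deg_one_def intro: continuous_on_subset)
  then show "\<exists>x. y = F x" by auto
qed

lemma deg_one_bij: "deg_one F \<Longrightarrow> bij F"
  using deg_one_surj deg_one_inj by (simp add: bij_def)

lemma deg_one_inv_cancel:
  assumes "deg_one F"
  shows "F (inv F t) = t" "inv F (F t) = t"
  using deg_one_bij[OF assms] by (auto simp: bij_def surj_f_inv_f)

lemma continuous_strict_mono_bij:
  fixes F :: "real \<Rightarrow> real"
  assumes m: "strict_mono F" and b: "bij F"
  shows "continuous_on UNIV F"
proof -
  have "open (F ` UNIV)" using b by (simp add: bij_is_surj)
  then show ?thesis
    using m by (intro continuous_onI_mono) (auto simp: strict_mono_less_eq)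
qed

text \<open>A monotone bijection of the line is automatically continuous. Inverses, rescalings and
  the limit \<open>HH x\<close> are recognized as lifts in this way.\<close>

lemma deg_oneI:
  assumes F: "mono F" "\<And>t. F (t + 1) = F t + 1" and G: "\<And>t. F (G t) = t" "\<And>t. G (F t) = t"
  shows "deg_one F"
proof -
  have b: "bij F" by (rule bij_betw_byWitness[where f' = G]) (auto simp: G)
  then have sm: "strict_mono F" using F(1) by (simp add: strict_mono_iff_mono bij_is_inj)
  then show ?thesis using F(2) continuous_strict_mono_bij[OF sm b] by (simp add: deg_one_def)
qed

lemma deg_one_inv:
  assumes F: "deg_one F"
  shows "deg_one (inv F)"
proof (rule deg_oneI[where G = F])
  show "mono (inv F)"
  proof (rule monoI)
    show "inv F s \<le> inv F t" if "s \<le> t" for s t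
      using that deg_one_le_iff[OF F, of "inv F s" "inv F t"] by (simp add: deg_one_inv_cancel[OF F])
  qed
  show "inv F (t + 1) = inv F t + 1" for t
    using deg_one_inj[OF F] deg_one_of_int[OF F, of "inv F t" 1]
    by (auto simp: inv_f_eq deg_one_inv_cancel[OF F])
qed (auto simp: deg_one_inv_cancel[OF F])

lemma deg_one_comp:
  assumes "deg_one F" "deg_one G"
  shows "deg_one (\<lambda>t. F (G t))"
  using assms unfolding deg_one_def
  by (auto simp: strict_mono_def intro: continuous_on_compose2)

lemma deg_one_add: "deg_one (\<lambda>t. s + t)"
  by (auto simp: deg_one_def strict_mono_def intro: continuous_intros)

lemma inv_comp_deg_one:
  assumes "deg_one F" "deg_one G"
  shows "inv (\<lambda>t. F (G t)) = (\<lambda>t. inv G (inv F t))"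
  using o_inv_distrib[OF deg_one_bij[OF assms(1)] deg_one_bij[OF assms(2)]] by (simp add: comp_def)

lemma circ_comp: "deg_one F \<Longrightarrow> circ F \<circ> circ G = circ (\<lambda>t. F (G t))"
  using circ_abs[of F] by (simp add: circ_def[of G] circ_def[of "\<lambda>t. F (G t)"] fun_eq_iff)

lemma circ_id: "circ (\<lambda>t. t) = id"
  by (auto simp: circ_def abs_rep_circle)

lemma circ_inv_comp:
  assumes "deg_one F"
  shows "circ F \<circ> circ (inv F) = id" "circ (inv F) \<circ> circ F = id"
  using assms deg_one_inv[OF assms]
  by (simp_all add: circ_comp deg_one_inv_cancel circ_id)

lemma inv_circ: "deg_one F \<Longrightarrow> inv (circ F) = circ (inv F)"
  by (intro inv_unique_comp circ_inv_comp)

lemma circ_bij: "deg_one F \<Longrightarrow> bij (circ F)"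
  using circ_inv_comp o_bij by blast

lemma continuous_circ:
  assumes "deg_one F"
  shows "continuous_on UNIV (circ F)"
  unfolding continuous_on_open_vimage[OF open_UNIV] Int_UNIV_right
proof (intro allI impI)
  show "open (circ F -` U)" if "open U" for U
  proof -
    have "abs_circle -` (circ F -` U) = F -` (abs_circle -` U)"
      using assms by (auto simp: circ_abs)
    moreover have "open (abs_circle -` U)" using that by (simp flip: open_circle_iff)
    then have "open (F -` (abs_circle -` U))"
      using assms unfolding deg_one_def by (metis open_vimage)
    ultimately show ?thesis by (simp add: open_circle_iff)
  qed
qed

lemma circ_homeo_plus:
  assumes F: "deg_one F"
  shows "circ F \<in> homeo_plus"
proof -
  have "homeomorphism UNIV UNIV (circ F) (inv (circ F))"
    unfolding inv_circ[OF F] homeomorphism_def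
    using continuous_circ[OF F] continuous_circ[OF deg_one_inv[OF F]] circ_inv_comp[OF F]
      bij_is_surj[OF circ_bij[OF F]] bij_is_surj[OF circ_bij[OF deg_one_inv[OF F]]]
    by (auto simp: fun_eq_iff)
  then show ?thesis
    using is_lift_circ[OF F] F by (auto simp: homeo_plus_def deg_one_def)
qed

lemma continuous_Ints_constant:
  fixes g :: "real \<Rightarrow> real"
  assumes "continuous_on UNIV g" "\<And>t. g t \<in> \<int>"
  obtains n where "\<And>t. g t = of_int n"
proof -
  have "g constant_on UNIV"
  proof (rule continuous_discrete_range_constant[OF connected_UNIV assms(1)])
    fix x :: real
    have "1 \<le> norm (g y - g x)" if "g y \<noteq> g x" for y
      using that assms(2)[of x] assms(2)[of y]
      by (metis Ints_diff Ints_nonzero_abs_ge1 real_norm_def right_minus_eq)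
    then show "\<exists>e>0. \<forall>y. y \<in> UNIV \<and> g y \<noteq> g x \<longrightarrow> e \<le> norm (g y - g x)"
      by (intro exI[of _ 1]) auto
  qed
  then obtain c where "\<And>t. g t = c" unfolding constant_on_def by auto
  moreover obtain n where "g 0 = of_int n" using assms(2)[of 0] by (auto elim: Ints_cases)
  ultimately show ?thesis using that by metis
qed

lemma lifts_differ_by_int:
  fixes F G :: "real \<Rightarrow> real"
  assumes "continuous_on UNIV F" "continuous_on UNIV G" "\<And>t. abs_circle (F t) = abs_circle (G t)"
  obtains n where "\<And>t. F t = G t + of_int n"
proof -
  have "continuous_on UNIV (\<lambda>t. F t - G t)" using assms by (intro continuous_intros)
  moreover have "F t - G t \<in> \<int>" for t using assms(3)[of t] by (simp add: circle.abs_eq_iff)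
  ultimately obtain n where n: "\<And>t. F t - G t = of_int n" using continuous_Ints_constant by blast
  have "F t = G t + of_int n" for t using n[of t] by simp
  then show ?thesis using that by blast
qed

text \<open>Monotonicity makes the degree positive. If it were at least 2, the lift would pass
  through F 0 + 1 strictly between 0 and 1, giving a second point of the circle with the image of
  \<open>abs_circle 0\<close>.\<close>

lemma homeo_plus_lift:
  assumes "f \<in> homeo_plus"
  obtains F where "deg_one F" "f = circ F"
proof -
  obtain F where F: "is_lift F f" "strict_mono F" and h: "homeomorphism UNIV UNIV f (inv f)"
    using assms by (auto simp: homeo_plus_def)
  have inj: "inj f" using h unfolding homeomorphism_def by (metis UNIV_I inj_on_inverseI)
  have cF: "continuous_on UNIV F" and Ff: "\<And>t. abs_circle (F t) = f (abs_circle t)"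
    using F by (auto simp: is_lift_def)
  have "abs_circle (F (t + 1)) = abs_circle (F t)" for t
    unfolding Ff by (rule arg_cong[where f = f]) (simp add: circle.abs_eq_iff)
  moreover have "continuous_on UNIV (\<lambda>t. F (t + 1))"
    by (intro continuous_intros continuous_on_compose2[OF cF]) auto
  ultimately obtain n where n: "\<And>t. F (t + 1) = F t + of_int n"
    using lifts_differ_by_int[of "\<lambda>t. F (t + 1)" F] cF by blast
  have "F 0 < F 1" using F by (simp add: strict_mono_def)
  then have "n > 0" using n[of 0] by simp
  have "n = 1"
  proof (rule ccontr)
    assume "n \<noteq> 1"
    with \<open>n > 0\<close> have "n \<ge> 2" by simp
    then have "F 0 + 1 < F 1" using n[of 0] by simp
    then have "\<exists>x\<ge>0. x \<le> 1 \<and> F x = F 0 + 1"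
      by (intro IVT') (auto intro: continuous_on_subset[OF cF])
    then obtain x where x: "0 \<le> x" "x \<le> 1" "F x = F 0 + 1" by blast
    then have "abs_circle (F x) = abs_circle (F 0)" by (simp add: circle.abs_eq_iff)
    then have "abs_circle x = abs_circle 0" using inj by (simp add: Ff inj_eq)
    then have "x \<in> \<int>" by (simp add: circle.abs_eq_iff)
    moreover have "x \<noteq> 0" "x \<noteq> 1" using x \<open>F 0 + 1 < F 1\<close> by auto
    ultimately show False using x by (auto elim!: Ints_cases)
  qed
  then have "deg_one F" using cF F n by (simp add: deg_one_def)
  with that[of F] circ_eqI[OF this Ff] show ?thesis by simp
qed

section \<open>Smooth lifts\<close>

definition diff_lift :: "(real \<Rightarrow> real) \<Rightarrow> bool"
  where "diff_lift F \<longleftrightarrow> deg_one F \<and> smooth F \<and> smooth (inv F)"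

lemma diff_lift_comp: "diff_lift F \<Longrightarrow> diff_lift G \<Longrightarrow> diff_lift (\<lambda>t. F (G t))"
  by (simp add: diff_lift_def deg_one_comp[of F G] inv_comp_deg_one smooth_compose[of F G]
      smooth_compose[of "inv G" "inv F"])

lemma diff_lift_inv: "diff_lift F \<Longrightarrow> diff_lift (inv F)"
  by (simp add: diff_lift_def deg_one_inv inv_inv_eq deg_one_bij)

lemma inv_add: "inv (\<lambda>t. s + t :: real) = (\<lambda>t. - s + t)"
  by (rule inv_equality) auto

lemma diff_lift_add: "diff_lift (\<lambda>t. s + t)"
  by (simp only: diff_lift_def deg_one_add inv_add)
    (intro conjI TrueI smooth_add[OF smooth_const smooth_ident])

lemma diff_lift_id: "diff_lift (\<lambda>t. t)"
  using diff_lift_add[of 0] by simp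

text \<open>The constant is the integer left open by the choice in \<open>lift\<close>; it
  disappears after one differentiation.\<close>

lemma lift_circ:
  assumes F: "deg_one F"
  obtains c where "lift (circ F) = (\<lambda>t. F t + c)"
proof -
  have "is_lift (lift (circ F)) (circ F)"
    unfolding lift_def by (rule someI[of "\<lambda>F'. is_lift F' (circ F)"]) (rule is_lift_circ[OF F])
  then obtain n where "\<And>t. lift (circ F) t = F t + of_int n"
    using is_lift_circ[OF F] lifts_differ_by_int[of "lift (circ F)" F] unfolding is_lift_def by auto
  then show ?thesis using that by blast
qed

lemma higher_deriv_add_const:
  assumes "smooth F" "i > 0"
  shows "(deriv ^^ i) (\<lambda>t. F t + c) = (deriv ^^ i) F"
proof -
  have "deriv (\<lambda>t. F t + c) = deriv F"
    using DERIV_add[OF smooth_DERIV[OF assms(1)] DERIV_const[of c]] by (auto intro!: DERIV_imp_deriv)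
  moreover obtain j where "i = Suc j" using assms(2) by (cases i) auto
  ultimately show ?thesis by (simp add: funpow_swap1)
qed

lemma circle_deriv_circ:
  assumes "deg_one F" "smooth F" "i > 0"
  shows "circle_deriv i (circ F) x = (deriv ^^ i) F (rep_circle x)"
proof -
  obtain c where "lift (circ F) = (\<lambda>t. F t + c)" using lift_circ[OF assms(1)] by blast
  then show ?thesis using assms by (simp add: circle_deriv_def higher_deriv_add_const)
qed

lemma is_Ck_circ:
  assumes "deg_one F" "smooth F"
  shows "is_Ck k (circ F)"
proof -
  obtain c where c: "lift (circ F) = (\<lambda>t. F t + c)" using lift_circ[OF assms(1)] by blast
  have s: "smooth (\<lambda>t. F t + c)" using assms by (intro smooth_add smooth_const)
  show ?thesis
    unfolding is_Ck_def c using smooth_higher_DERIV[OF s] smooth_continuous[OF smooth_higher_deriv[OF s]]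
    by (auto simp: real_differentiable_def)
qed

lemma circ_diffeo_smooth: "diff_lift F \<Longrightarrow> circ F \<in> diffeo_smooth"
  by (simp add: diffeo_smooth_def diffeo_def diff_lift_def circ_homeo_plus is_Ck_circ inv_circ deg_one_inv)

lemma deriv_shift_of_int:
  fixes G :: "real \<Rightarrow> real"
  assumes "\<And>t. G (t + 1) = G t + c"
  shows "(deriv ^^ i) G (t + of_int n) = (deriv ^^ i) G t + (if i = 0 then of_int n * c else 0)"
proof -
  have "\<exists>d. (\<forall>t. (deriv ^^ i) G (t + 1) = (deriv ^^ i) G t + d) \<and> (d = (if i = 0 then c else 0))"
  proof (induction i)
    case (Suc i)
    then obtain d where "\<forall>t. (deriv ^^ i) G (t + 1) = (deriv ^^ i) G t + d" by blast
    then show ?case using deriv_shift[of "(deriv ^^ i) G" d] by auto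
  qed (use assms in auto)
  then show ?thesis using shift_of_int[of "(deriv ^^ i) G"] by (auto split: if_splits)
qed

lemma periodic_continuous_bounded:
  fixes g :: "real \<Rightarrow> real"
  assumes "continuous_on UNIV g" "\<And>t. g (t + 1) = g t"
  obtains B where "B \<ge> 0" "\<And>t. \<bar>g t\<bar> \<le> B"
proof -
  have "bounded (g ` {0..1})"
    using assms(1) by (intro compact_imp_bounded compact_continuous_image) (auto intro: continuous_on_subset)
  then obtain B where B: "\<And>x. x \<in> {0..1} \<Longrightarrow> \<bar>g x\<bar> \<le> B" unfolding bounded_iff by (metis image_eqI real_norm_def)
  have "\<bar>g t\<bar> \<le> B" for t
  proof -
    have "g t = g (frac t)"
      using shift_of_int[of g 0 "frac t" "\<lfloor>t\<rfloor>"] assms(2) by (simp add: frac_def)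
    then show ?thesis using B[of "frac t"] by (simp add: frac_lt_1 less_imp_le)
  qed
  moreover have "B \<ge> 0" using B[of 0] by auto
  ultimately show ?thesis using that by blast
qed

lemma periodic_deriv_Lipschitz:
  fixes f :: "real \<Rightarrow> real"
  assumes d: "\<And>t. (f has_field_derivative f' t) (at t)" and c: "continuous_on UNIV f'"
    and p: "\<And>t. f (t + 1) = f t + a"
  obtains B where "B \<ge> 0" "\<And>s t. \<bar>f s - f t\<bar> \<le> B * \<bar>s - t\<bar>"
proof -
  have f': "f' = deriv f" using DERIV_imp_deriv[OF d] by auto
  then have "f' (t + 1) = f' t" for t using deriv_shift[of f a] p by simp
  then obtain B where B: "B \<ge> 0" "\<And>t. \<bar>f' t\<bar> \<le> B" using periodic_continuous_bounded[OF c] by metis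
  have "norm (f s - f t) \<le> B * norm (s - t)" for s t
    using d B by (intro field_differentiable_bound[of UNIV]) auto
  then show ?thesis using that[of B] B by auto
qed

lemma higher_deriv_Lipschitz:
  assumes "deg_one F" "smooth F"
  obtains B where "B \<ge> 0" "\<And>s t. \<bar>(deriv ^^ i) F s - (deriv ^^ i) F t\<bar> \<le> B * \<bar>s - t\<bar>"
proof (rule periodic_deriv_Lipschitz[of "(deriv ^^ i) F" "(deriv ^^ Suc i) F"])
  show "(deriv ^^ i) F (t + 1) = (deriv ^^ i) F t + (if i = 0 then 1 else 0)" for t
    using deriv_shift_of_int[of F 1 i t 1] assms(1) by (simp add: deg_one_def)
qed (use assms smooth_higher_DERIV smooth_continuous[OF smooth_higher_deriv] in blast)+

text \<open>In \<open>higher_deriv_compose_shift\<close> the angle occurs only inside derivatives of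
  H, which are Lipschitz, while the coefficients do not involve it. This makes the derivatives of a
  conjugated translation Lipschitz in the angle, uniformly in u.\<close>

lemma conj_higher_deriv_Lipschitz:
  assumes H: "diff_lift H"
  obtains C where "C \<ge> 0" "\<And>s t u. \<bar>(deriv ^^ i) (\<lambda>u. H (s + inv H u)) u -
    (deriv ^^ i) (\<lambda>u. H (t + inv H u)) u\<bar> \<le> C * \<bar>s - t\<bar>"
proof -
  have dH: "deg_one H" "smooth H" "smooth (inv H)" using H by (auto simp: diff_lift_def)
  obtain b where b: "\<And>j. smooth (b j)"
    "\<And>s u. (deriv ^^ i) (\<lambda>u. H (s + inv H u)) u = (\<Sum>j\<le>i. (deriv ^^ j) H (s + inv H u) * b j u)"
    using higher_deriv_compose_shift[OF dH(2,3)] by blast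
  have "\<forall>j. \<exists>A\<ge>0. \<forall>s t. \<bar>(deriv ^^ j) H s - (deriv ^^ j) H t\<bar> \<le> A * \<bar>s - t\<bar>"
    using higher_deriv_Lipschitz[OF dH(1,2)] by metis
  then obtain A where A: "\<And>j. A j \<ge> 0" "\<And>j s t. \<bar>(deriv ^^ j) H s - (deriv ^^ j) H t\<bar> \<le> A j * \<bar>s - t\<bar>"
    by metis
  \<comment> \<open>No periodicity of the coefficients is available, so they are bounded on one
    period only; other points are reduced to it through the shift behaviour of the
    conjugate.\<close>
  have "\<exists>B. \<forall>u\<in>{0..1}. \<bar>b j u\<bar> \<le> B" for j
  proof -
    have "bounded (b j ` {0..1})"
      by (intro compact_imp_bounded compact_continuous_image continuous_on_subset[OF smooth_continuous[OF b(1)]]) auto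
    then show ?thesis unfolding bounded_iff by auto
  qed
  then obtain B where B: "\<And>j u. u \<in> {0..1} \<Longrightarrow> \<bar>b j u\<bar> \<le> B j" by metis
  have B0: "B j \<ge> 0" for j using B[of 0 j] by auto
  define C where "C = (\<Sum>j\<le>i. A j * B j)"
  let ?D = "\<lambda>s u. (deriv ^^ i) (\<lambda>u. H (s + inv H u)) u"
  have C: "\<bar>?D s u - ?D t u\<bar> \<le> C * \<bar>s - t\<bar>" if u: "u \<in> {0..1}" for s t u
  proof -
    have "\<bar>?D s u - ?D t u\<bar> = \<bar>\<Sum>j\<le>i. ((deriv ^^ j) H (s + inv H u) - (deriv ^^ j) H (t + inv H u)) * b j u\<bar>"
      unfolding b(2) by (simp add: sum_subtractf algebra_simps)
    also have "\<dots> \<le> (\<Sum>j\<le>i. \<bar>((deriv ^^ j) H (s + inv H u) - (deriv ^^ j) H (t + inv H u)) * b j u\<bar>)"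
      by (rule sum_abs)
    also have "\<dots> \<le> (\<Sum>j\<le>i. A j * \<bar>s - t\<bar> * B j)"
    proof (rule sum_mono)
      fix j
      have "\<bar>(deriv ^^ j) H (s + inv H u) - (deriv ^^ j) H (t + inv H u)\<bar> \<le> A j * \<bar>s - t\<bar>"
        using A(2)[of j "s + inv H u" "t + inv H u"] by simp
      then show "\<bar>((deriv ^^ j) H (s + inv H u) - (deriv ^^ j) H (t + inv H u)) * b j u\<bar> \<le> A j * \<bar>s - t\<bar> * B j"
        unfolding abs_mult using B[OF u] A(1) by (intro mult_mono) auto
    qed
    also have "\<dots> = C * \<bar>s - t\<bar>" by (simp add: C_def sum_distrib_left sum_distrib_right algebra_simps)
    finally show ?thesis .
  qed
  have "deg_one (\<lambda>u. H (s + inv H u))" for s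
    by (intro deg_one_comp[OF dH(1)] deg_one_comp[OF deg_one_add[of s] deg_one_inv[OF dH(1)]])
  then have shift: "?D s (frac u + of_int \<lfloor>u\<rfloor>) = ?D s (frac u) + (if i = 0 then of_int \<lfloor>u\<rfloor> else 0)" for s u
    using deriv_shift_of_int[of "\<lambda>u. H (s + inv H u)" 1 i "frac u" "\<lfloor>u\<rfloor>"] by (simp add: deg_one_def)
  have "\<bar>?D s u - ?D t u\<bar> \<le> C * \<bar>s - t\<bar>" for s t u
  proof -
    have "?D s u - ?D t u = ?D s (frac u) - ?D t (frac u)"
      using shift[of s u] shift[of t u] by (simp add: frac_def)
    then show ?thesis using C[of "frac u" s t] by (simp add: frac_lt_1 less_imp_le)
  qed
  moreover have "C \<ge> 0" unfolding C_def using A(1) B0 by (intro sum_nonneg) auto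
  ultimately show ?thesis using that by blast
qed

lemma conj_close:
  assumes H: "diff_lift H" and e: "e > 0"
  obtains d where "d > 0" "\<And>i s t u. i \<le> n \<Longrightarrow> \<bar>s - t\<bar> \<le> d \<Longrightarrow>
    \<bar>(deriv ^^ i) (\<lambda>u. H (s + inv H u)) u - (deriv ^^ i) (\<lambda>u. H (t + inv H u)) u\<bar> \<le> e"
proof -
  let ?D = "\<lambda>i s u. (deriv ^^ i) (\<lambda>u. H (s + inv H u)) u"
  have "\<forall>i. \<exists>C\<ge>0. \<forall>s t u. \<bar>?D i s u - ?D i t u\<bar> \<le> C * \<bar>s - t\<bar>"
    using conj_higher_deriv_Lipschitz[OF H] by metis
  then obtain C where C: "\<And>i. C i \<ge> 0" "\<And>i s t u. \<bar>?D i s u - ?D i t u\<bar> \<le> C i * \<bar>s - t\<bar>" by metis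
  define A where "A = (\<Sum>i\<le>n. C i) + 1"
  have A: "A > 0" unfolding A_def using C(1) by (smt (verit) sum_nonneg)
  have "\<bar>?D i s u - ?D i t u\<bar> \<le> e" if "i \<le> n" "\<bar>s - t\<bar> \<le> e / A" for i s t u
  proof -
    have "C i \<le> (\<Sum>i\<le>n. C i)" using C(1) that(1) by (intro member_le_sum) auto
    then have "C i \<le> A" unfolding A_def by simp
    then have "C i * \<bar>s - t\<bar> \<le> A * (e / A)" using that C(1) A by (intro mult_mono) auto
    then show ?thesis using C(2)[of i s u t] A by simp
  qed
  then show ?thesis using that[of "e / A"] A e by simp
qed

section \<open>The regularity classes\<close>

text \<open>Distances on the circle are at most 1, so lowering the exponent only increases their
  powers.\<close>

lemma Lipschitz_imp_Hoelder:
  fixes u :: "circle \<Rightarrow> 'b::metric_space"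
  assumes B: "B \<ge> 0" "\<And>x y. dist (u x) (u y) \<le> B * dist x y" and "0 < \<beta>" "\<beta> < 1"
  shows "is_Hoelder \<beta> u"
  unfolding is_Hoelder_def
proof (intro exI allI)
  fix x y :: circle
  have "dist x y powr 1 \<le> dist x y powr \<beta>"
    using assms dist_circle_le[of x y] by (intro powr_mono') auto
  then have "dist x y \<le> dist x y powr \<beta>" by simp
  then show "dist (u x) (u y) \<le> B * dist x y powr \<beta>"
    using B(1) B(2)[of x y] by (meson mult_left_mono order_trans)
qed

lemma circ_Lipschitz:
  assumes F: "deg_one F" and B: "\<And>s t. \<bar>F s - F t\<bar> \<le> B * \<bar>s - t\<bar>"
  shows "dist (circ F x) (circ F y) \<le> B * dist x y"
proof -
  obtain s t where st: "x = abs_circle s" "y = abs_circle t" "\<bar>s - t\<bar> = dist x y"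
    by (rule circle_near_reps)
  have "dist (circ F x) (circ F y) \<le> \<bar>F s - F t\<bar>"
    using dist_abs_circle_le by (simp add: st F circ_abs)
  then show ?thesis using B[of s t] st(3) by simp
qed

lemma is_Ck_imp_Hoelder:
  assumes f: "f \<in> homeo_plus" and Ck: "is_Ck k f" "k \<ge> 1" and \<beta>: "0 < \<beta>" "\<beta> < 1"
  shows "is_Hoelder \<beta> f"
proof -
  obtain F where F: "deg_one F" "f = circ F" using homeo_plus_lift[OF f] by blast
  obtain c where c: "lift f = (\<lambda>t. F t + c)" using lift_circ[OF F(1)] F(2) by auto
  have "lift f differentiable at t" for t using Ck unfolding is_Ck_def by (auto dest: spec[of _ 0])
  then have d: "(lift f has_field_derivative deriv (lift f) t) (at t)" for t
    by (rule differentiable_DERIV_deriv)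
  have "continuous_on UNIV (deriv (lift f))"
  proof (cases "k = 1")
    case True then show ?thesis using Ck by (simp add: is_Ck_def)
  next
    case False
    then have "deriv (lift f) differentiable at t" for t
      using Ck unfolding is_Ck_def by (auto dest: spec[of _ 1])
    then show ?thesis
      by (auto intro!: continuous_at_imp_continuous_on differentiable_imp_continuous_within)
  qed
  moreover have "lift f (t + 1) = lift f t + 1" for t using F(1) by (simp add: c deg_one_def)
  ultimately obtain B where B: "B \<ge> 0" "\<And>s t. \<bar>lift f s - lift f t\<bar> \<le> B * \<bar>s - t\<bar>"
    using periodic_deriv_Lipschitz[OF d] by metis
  have "dist (f x) (f y) \<le> B * dist x y" for x y
    unfolding F(2) using B(2) by (intro circ_Lipschitz[OF F(1)]) (simp add: c)
  then show ?thesis using Lipschitz_imp_Hoelder B(1) \<beta> by blast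
qed

text \<open>The one property of the classes used to exclude conjugacies. Once a continuous
  derivative exists the map is Lipschitz, and the exponent 1 / 2 is an arbitrary choice.\<close>

lemma regularity_class_Hoelder:
  assumes D: "\<D> \<in> regularity_classes" and f: "f \<in> \<D>"
  obtains \<beta> where "0 < \<beta>" "\<beta> < 1" "f \<in> homeo_plus" "is_Hoelder \<beta> f"
proof -
  have *: "\<exists>\<beta>>0. \<beta> < 1 \<and> f \<in> homeo_plus \<and> is_Hoelder \<beta> f" if "f \<in> diffeo k" "k \<ge> 1" for k
    using that is_Ck_imp_Hoelder[of f k "1/2"] by (auto simp: diffeo_def intro!: exI[of _ "1/2"])
  have "\<exists>\<beta>>0. \<beta> < 1 \<and> f \<in> homeo_plus \<and> is_Hoelder \<beta> f"
    using D unfolding regularity_classes_def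
  proof (elim UnE)
    assume "\<D> \<in> {\<Union>\<beta>\<in>{0<..<1}. diffeo_Hoelder 0 \<beta>}"
    then show ?thesis using f by (auto simp: diffeo_Hoelder_def diffeo_def)
  next
    assume "\<D> \<in> {diffeo_Hoelder k \<beta> | k \<beta>. 0 < \<beta> \<and> \<beta> < 1}"
    then obtain k \<beta> where k: "\<D> = diffeo_Hoelder k \<beta>" "0 < \<beta>" "\<beta> < 1" by auto
    show ?thesis
    proof (cases "k = 0")
      case True then show ?thesis using f k by (auto simp: diffeo_Hoelder_def diffeo_def)
    next
      case False then show ?thesis using f k by (intro *[of k]) (auto simp: diffeo_Hoelder_def)
    qed
  qed (use f * in \<open>auto simp: diffeo_smooth_def\<close>)
  then show ?thesis using that by blast
qed

text \<open>The one property of the classes used to produce conjugacies.\<close>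

lemma circ_in_regularity_class:
  assumes D: "\<D> \<in> regularity_classes" and F: "diff_lift F"
  shows "circ F \<in> \<D>"
proof -
  have dF: "deg_one F" "smooth F" using F by (auto simp: diff_lift_def)
  have s: "circ F \<in> diffeo_smooth" by (rule circ_diffeo_smooth[OF F])
  have k: "circ F \<in> diffeo k" for k
  proof (cases "k = 0")
    case True then show ?thesis using circ_homeo_plus[OF dF(1)] by (simp add: diffeo_def)
  next
    case False then show ?thesis using s by (auto simp: diffeo_smooth_def)
  qed
  have kb: "circ F \<in> diffeo_Hoelder k \<beta>" if \<beta>: "0 < \<beta>" "\<beta> < 1" for k \<beta>
  proof (cases "k = 0")
    case True
    have "is_Hoelder \<beta> (circ F)"
      using is_Ck_imp_Hoelder[OF circ_homeo_plus is_Ck_circ[of F 1]] dF \<beta> by simp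
    then show ?thesis using k True by (simp add: diffeo_Hoelder_def)
  next
    case False
    obtain B where B: "B \<ge> 0" "\<And>s t. \<bar>(deriv ^^ k) F s - (deriv ^^ k) F t\<bar> \<le> B * \<bar>s - t\<bar>"
      using higher_deriv_Lipschitz[OF dF] by metis
    have cd: "circle_deriv k (circ F) (abs_circle t) = (deriv ^^ k) F t" for t
    proof -
      obtain n where n: "rep_circle (abs_circle t) - t = of_int n"
        using abs_rep_circle[of "abs_circle t"] by (auto simp: circle.abs_eq_iff elim: Ints_cases)
      then have n: "rep_circle (abs_circle t) = t + of_int n" by simp
      show ?thesis
        using circle_deriv_circ[OF dF, of k "abs_circle t"] False dF(1)
          deriv_shift_of_int[of F 1 k t n] by (simp add: n deg_one_def)
    qed
    have "dist (circle_deriv k (circ F) x) (circle_deriv k (circ F) y) \<le> B * dist x y" for x y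
    proof -
      obtain s t where st: "x = abs_circle s" "y = abs_circle t" "\<bar>s - t\<bar> = dist x y"
        by (rule circle_near_reps)
      then show ?thesis using B(2)[of s t] by (simp add: cd dist_real_def)
    qed
    then have "is_Hoelder \<beta> (circle_deriv k (circ F))" using Lipschitz_imp_Hoelder[OF B(1)] \<beta> by blast
    then show ?thesis using k False by (simp add: diffeo_Hoelder_def)
  qed
  have "circ F \<in> (\<Union>\<beta>\<in>{0<..<1}. diffeo_Hoelder 0 \<beta>)"
    using kb[of "1/2" 0] by (intro UN_I[of "1/2"]) auto
  then show ?thesis using D k kb s unfolding regularity_classes_def by auto
qed

section \<open>Steep maps with a prescribed rotational symmetry\<close>

section \<open>Steep diffeomorphisms\<close>

text \<open>The integers attract with slope 1 / 2 and the half-integers repel with slope 3 / 2;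
  dividing by 4 * pi keeps the derivative between these values. High iterates crush [0, 1 / 4], so
  their inverses are steep at 0.\<close>

definition north_south :: "real \<Rightarrow> real"
  where "north_south u = u - sin (2 * pi * u) / (4 * pi)"

lemma DERIV_north_south: "(north_south has_field_derivative 1 - cos (2 * pi * u) / 2) (at u)"
proof -
  have "((\<lambda>u. u - sin (2 * pi * u) / (4 * pi)) has_field_derivative
      1 - (cos (2 * pi * u) * (2 * pi)) / (4 * pi)) (at u)"
    by (auto intro!: derivative_eq_intros)
  then show ?thesis by (simp add: north_south_def[abs_def] field_simps)
qed

lemma deriv_north_south_pos: "1 - cos (2 * pi * u) / 2 > 0"
  using cos_le_one[of "2 * pi * u"] by linarith

lemma smooth_north_south: "smooth north_south"
proof -
  have "smooth (\<lambda>u. sin (2 * pi * u))"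
    by (rule smooth_compose[OF smooth_sin smooth_mult[OF smooth_const smooth_ident]])
  then have "smooth (\<lambda>u. u + (- 1 / (4 * pi)) * sin (2 * pi * u))"
    by (rule smooth_add[OF smooth_ident smooth_mult[OF smooth_const]])
  then show ?thesis by (simp add: north_south_def[abs_def])
qed

lemma deg_one_north_south: "deg_one north_south"
proof -
  have "strict_mono north_south"
    unfolding strict_mono_def using DERIV_north_south deriv_north_south_pos
    by (metis DERIV_pos_imp_increasing)
  moreover have "north_south (t + 1) = north_south t + 1" for t
    using sin_periodic[of "2 * pi * t"] by (simp add: north_south_def algebra_simps)
  ultimately show ?thesis using smooth_continuous[OF smooth_north_south] by (simp add: deg_one_def)
qed

lemma diff_lift_north_south: "diff_lift north_south"
proof -
  have "smooth (inv north_south)"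
  proof (rule smooth_inv[OF smooth_north_south])
    show "deriv north_south t \<noteq> 0" for t
      using deriv_north_south_pos[of t] by (simp add: DERIV_imp_deriv[OF DERIV_north_south])
    show "continuous_on UNIV (inv north_south)"
      using deg_one_inv[OF deg_one_north_south] by (simp add: deg_one_def)
  qed (rule deg_one_bij[OF deg_one_north_south])
  then show ?thesis by (simp add: diff_lift_def smooth_north_south deg_one_north_south)
qed

lemma diff_lift_funpow: "diff_lift F \<Longrightarrow> diff_lift (F ^^ m)"
proof (induction m)
  case 0 then show ?case using diff_lift_id by (simp add: id_def)
next
  case (Suc m) then show ?case using diff_lift_comp[of F "F ^^ m"] by (simp add: comp_def)
qed

text \<open>The orbit decreases and stays positive; its limit is a fixed point in [0, 1 / 4], where
  0 is the only one.\<close>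

lemma north_south_tendsto: "(\<lambda>m. (north_south ^^ m) (1 / 4)) \<longlonglongrightarrow> 0"
proof -
  let ?a = "\<lambda>m. (north_south ^^ m) (1 / 4)"
  have z: "north_south 0 = 0" by (simp add: north_south_def)
  have less: "0 < north_south u \<and> north_south u < u" if "0 < u" "u \<le> 1 / 4" for u
  proof
    show "0 < north_south u" using deg_one_less_iff[OF deg_one_north_south, of 0 u] that z by simp
    have "2 * pi * u < 2 * pi * (1 / 2)" using that by (intro mult_strict_left_mono) auto
    then have "sin (2 * pi * u) > 0" using that by (intro sin_gt_zero) auto
    then show "north_south u < u" by (simp add: north_south_def)
  qed
  have a: "0 < ?a m \<and> ?a m \<le> 1 / 4" for m
  proof (induction m)
    case (Suc m) then show ?case using less[of "?a m"] by auto
  qed auto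
  have "decseq ?a" using less a by (intro decseq_SucI) (auto intro: less_imp_le)
  then obtain l where l: "?a \<longlonglongrightarrow> l" using decseq_convergent[of ?a 0] a by (metis less_imp_le)
  have l0: "0 \<le> l" "l \<le> 1 / 4"
    using a LIMSEQ_le_const[OF l, of 0] LIMSEQ_le_const2[OF l, of "1 / 4"] by (meson less_imp_le)+
  have "isCont north_south l" using DERIV_isCont[OF DERIV_north_south] .
  then have "(\<lambda>m. north_south (?a m)) \<longlonglongrightarrow> north_south l" using l by (rule isCont_tendsto_compose)
  moreover have "(\<lambda>m. north_south (?a m)) \<longlonglongrightarrow> l" using LIMSEQ_Suc[OF l] by simp
  ultimately have "north_south l = l" by (rule LIMSEQ_unique)
  then have "l = 0" using less[of l] l0 by force
  then show ?thesis using l by simp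
qed

text \<open>The inverse of a high iterate of \<open>north_south\<close> undoes the contraction of 1
  / 4 to a point below \<epsilon>.\<close>

lemma diff_lift_steep:
  assumes "\<epsilon> > 0"
  obtains g where "diff_lift g" "g 0 = 0" "g \<epsilon> \<ge> 1 / 4"
proof -
  obtain m where m: "(north_south ^^ m) (1 / 4) < \<epsilon>"
    using order_tendstoD(2)[OF north_south_tendsto assms] by (auto simp: eventually_sequentially)
  let ?G = "north_south ^^ m"
  have d: "diff_lift ?G" by (rule diff_lift_funpow[OF diff_lift_north_south])
  then have G: "deg_one ?G" by (simp add: diff_lift_def)
  have "?G 0 = 0" by (induction m) (auto simp: north_south_def)
  then have "inv ?G 0 = 0" using deg_one_inv_cancel(2)[OF G, of 0] by simp
  moreover have "1 / 4 \<le> inv ?G \<epsilon>"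
    using m deg_one_le_iff[OF G, of "1/4" "inv ?G \<epsilon>"] by (simp add: deg_one_inv_cancel[OF G])
  ultimately show ?thesis using that diff_lift_inv[OF d] by blast
qed

text \<open>All integers are fixed, so no point leaves the unit interval between its neighbouring
  integers.\<close>

lemma deg_one_displacement:
  assumes g: "deg_one g" "g 0 = 0"
  shows "\<bar>g v - v\<bar> \<le> 1"
proof -
  have "g (of_int n) = of_int n" for n using deg_one_of_int[OF g(1), of 0 n] g(2) by simp
  moreover have "v \<le> of_int (\<lfloor>v\<rfloor> + 1)" by linarith
  ultimately have "g v \<le> of_int (\<lfloor>v\<rfloor> + 1)" "of_int \<lfloor>v\<rfloor> \<le> g v"
    using deg_one_le_iff[OF g(1), of "of_int \<lfloor>v\<rfloor>" v] deg_one_le_iff[OF g(1), of v "of_int (\<lfloor>v\<rfloor> + 1)"]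
    by (simp_all del: of_int_add)
  then show ?thesis by linarith
qed

text \<open>Multiplication by q lifts g through the q-fold covering of the circle. The result
  commutes with the rotation by 1 / q, and its displacement shrinks by the factor q.\<close>

lemma deg_one_rescale:
  fixes g :: "real \<Rightarrow> real" and q :: nat and u :: real
  assumes g: "deg_one g" and q: "q > 0"
  shows "deg_one (\<lambda>u. g (q * u) / q)" "g (q * (u + 1 / q)) / q = g (q * u) / q + 1 / q"
    and "inv (\<lambda>u :: real. g (q * u) / q) = (\<lambda>u :: real. inv g (q * u) / q)"
proof -
  show "deg_one (\<lambda>u. g (q * u) / q)"
  proof (rule deg_oneI[where G = "\<lambda>u. inv g (q * u) / q"])
    show "mono (\<lambda>u :: real. g (q * u) / q)"
      using deg_one_le_iff[OF g] q by (auto intro!: monoI divide_right_mono)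
    show "g (q * (t + 1)) / q = g (q * t) / q + 1" for t :: real
      using deg_one_of_int[OF g, of "q * t" "int q"] q by (simp add: algebra_simps add_divide_distrib)
  qed (use q in \<open>auto simp: deg_one_inv_cancel[OF g]\<close>)
  show "g (q * (u + 1 / q)) / q = g (q * u) / q + 1 / q"
    using g q by (simp add: distrib_left deg_one_def add_divide_distrib)
  show "inv (\<lambda>u :: real. g (q * u) / q) = (\<lambda>u :: real. inv g (q * u) / q)"
    using q by (intro inv_equality) (auto simp: deg_one_inv_cancel[OF g])
qed

lemma smooth_rescale: "smooth g \<Longrightarrow> smooth (\<lambda>u. g (a * u) / b)"
  using smooth_mult[OF smooth_const[of "1 / b"] smooth_compose[of g "\<lambda>u. a * u"]]
    smooth_mult[OF smooth_const[of a] smooth_ident] by simp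

lemma diff_lift_rescale: "diff_lift g \<Longrightarrow> q > 0 \<Longrightarrow> diff_lift (\<lambda>u. g (real q * u) / real q)"
  using deg_one_rescale(1,3)[of g q] by (simp add: diff_lift_def smooth_rescale)

lemma diff_lift_bi_Lipschitz:
  assumes "diff_lift H"
  obtains L where "\<And>s t. \<bar>H s - H t\<bar> \<le> L * \<bar>s - t\<bar>" "\<And>s t. \<bar>inv H s - inv H t\<bar> \<le> L * \<bar>s - t\<bar>"
proof -
  have *: "deg_one H" "smooth H" "deg_one (inv H)" "smooth (inv H)"
    using assms deg_one_inv by (auto simp: diff_lift_def)
  obtain A where A: "\<And>s t. \<bar>H s - H t\<bar> \<le> A * \<bar>s - t\<bar>"
    using higher_deriv_Lipschitz[OF *(1,2), of 0] by (metis funpow_0)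
  obtain B where B: "\<And>s t. \<bar>inv H s - inv H t\<bar> \<le> B * \<bar>s - t\<bar>"
    using higher_deriv_Lipschitz[OF *(3,4), of 0] by (metis funpow_0)
  have "A * \<bar>s - t\<bar> \<le> max A B * \<bar>s - t\<bar>" "B * \<bar>s - t\<bar> \<le> max A B * \<bar>s - t\<bar>" for s t
    by (auto intro!: mult_right_mono)
  then show ?thesis using that[of "max A B"] A B order_trans by meson
qed

section \<open>Inductive choice of the steep maps and the denominators\<close>

section \<open>The tower of conjugating maps\<close>

text \<open>The set \<open>\<H>\<close> holds the maps that may precede h. The closeness clause
  makes q' large after h has been chosen, for the compositions with and without h; its range (n + 1)
  / q' covers both the displacement of the next steep map and the next correction of an angle. The
  last clause will defeat every Hoelder condition: its exponent n outgrows the inverse of any fixed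
  Hoelder exponent, and 8 / q' leaves room for the maps of higher levels. The factor n + 2 makes the
  denominators at least double and lets their ratios tend to infinity, as the irrationality argument
  requires.\<close>

definition tower_step ::
    "nat \<Rightarrow> nat \<Rightarrow> (real \<Rightarrow> real) set \<Rightarrow> (real \<Rightarrow> real) \<Rightarrow> nat \<Rightarrow> bool"
  where "tower_step n q \<H> h q' \<longleftrightarrow>
    diff_lift h \<and> (\<forall>u. h (u + 1 / q) = h u + 1 / q) \<and>
    (\<forall>u. \<bar>h u - u\<bar> \<le> 1 / q \<and> \<bar>inv h u - u\<bar> \<le> 1 / q) \<and>
    q dvd q' \<and> (n + 2) * q \<le> q' \<and>
    (\<forall>H \<in> \<H> \<union> (\<lambda>H t. H (h t)) ` \<H>. \<forall>s t. \<bar>s - t\<bar> \<le> (n + 1) / q' \<longrightarrow>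
      \<bar>H s - H t\<bar> \<le> (1 / 2) ^ n \<and>
      (\<forall>i\<le>n. \<forall>u. \<bar>(deriv ^^ i) (\<lambda>u. H (s + inv H u)) u -
        (deriv ^^ i) (\<lambda>u. H (t + inv H u)) u\<bar> \<le> (1 / 2) ^ n)) \<and>
    (\<exists>(L :: real) (\<epsilon> :: real). L \<ge> 1 \<and> \<epsilon> > 0 \<and>
      (\<forall>H\<in>\<H>. \<forall>s t. \<bar>H s - H t\<bar> \<le> L * \<bar>s - t\<bar> \<and> \<bar>inv H s - inv H t\<bar> \<le> L * \<bar>s - t\<bar>) \<and>
      h \<epsilon> - h 0 \<ge> 1 / (4 * q) \<and> L * (\<epsilon> + 8 / q') \<le> (1 / (4 * q * L)) ^ n)"

lemma eventually_const_div_le: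
  fixes c d :: real and q :: nat
  assumes "d > 0" "q > 0"
  shows "\<forall>\<^sub>F N in sequentially. c / (q * N) \<le> d"
proof -
  have "(\<lambda>N. c / q * (1 / real N)) \<longlonglongrightarrow> c / q * 0" by (intro tendsto_intros lim_1_over_n)
  then have "\<forall>\<^sub>F N in sequentially. c / q * (1 / real N) < d" using assms by (intro order_tendstoD) auto
  then show ?thesis by eventually_elim simp
qed

text \<open>Order of the choices: a common bi-Lipschitz constant L of \<open>\<H>\<close>, then
  \<epsilon>, then h steep on [0, \<epsilon>], and finally q' = q * N. As \<open>\<H>\<close> is
  finite, N is subject to finitely many conditions, each of which holds eventually.\<close>

lemma tower_step_exists:
  assumes fin: "finite \<H>" and dl: "\<And>H. H \<in> \<H> \<Longrightarrow> diff_lift H" and q: "q > 0"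
  obtains h q' where "tower_step n q \<H> h q'"
proof -
  have "\<exists>L. \<forall>s t. \<bar>H s - H t\<bar> \<le> L * \<bar>s - t\<bar> \<and> \<bar>inv H s - inv H t\<bar> \<le> L * \<bar>s - t\<bar>" if "H \<in> \<H>" for H
    using diff_lift_bi_Lipschitz[OF dl[OF that]] by metis
  then obtain l where l: "\<And>H s t. H \<in> \<H> \<Longrightarrow> \<bar>H s - H t\<bar> \<le> l H * \<bar>s - t\<bar> \<and> \<bar>inv H s - inv H t\<bar> \<le> l H * \<bar>s - t\<bar>"
    by metis
  define L where "L = 1 + (\<Sum>H\<in>\<H>. \<bar>l H\<bar>)"
  have L1: "L \<ge> 1" by (simp add: L_def sum_nonneg)
  have "\<bar>l H\<bar> \<le> L" if "H \<in> \<H>" for H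
    using member_le_sum[of H \<H> "\<lambda>H. \<bar>l H\<bar>"] that fin by (simp add: L_def)
  then have "l H * \<bar>s - t\<bar> \<le> L * \<bar>s - t\<bar>" if "H \<in> \<H>" for H s t
    using that by (intro mult_right_mono) (auto simp: abs_le_iff)
  then have L: "\<forall>H\<in>\<H>. \<forall>s t. \<bar>H s - H t\<bar> \<le> L * \<bar>s - t\<bar> \<and> \<bar>inv H s - inv H t\<bar> \<le> L * \<bar>s - t\<bar>"
    using l by (meson order_trans)
  define R where "R = (1 / (4 * q * L)) ^ n"
  have R: "R > 0" using q L1 by (simp add: R_def)
  \<comment> \<open>Half of the budget R is spent on \<epsilon>, the other half is kept for 8 /
    q'.\<close>
  define \<epsilon> where "\<epsilon> = R / (2 * L)"
  have e: "\<epsilon> > 0" using R L1 by (simp add: \<epsilon>_def)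
  \<comment> \<open>Rescaling multiplies the argument by q, so steepness is requested at q *
    \<epsilon>.\<close>
  obtain g where g: "diff_lift g" "g 0 = 0" "g (q * \<epsilon>) \<ge> 1 / 4"
    using diff_lift_steep[of "q * \<epsilon>"] e q by auto
  then have dg: "deg_one g" by (simp add: diff_lift_def)
  have ig0: "inv g 0 = 0" using deg_one_inv_cancel(2)[OF dg, of 0] g by simp
  define h where "h u = g (q * u) / q" for u :: real
  have h: "diff_lift h" unfolding h_def[abs_def] by (rule diff_lift_rescale[OF g(1) q])
  have "\<bar>g (q * u) / q - u\<bar> \<le> 1 / q" "\<bar>inv g (q * u) / q - u\<bar> \<le> 1 / q" for u :: real
    using deg_one_displacement[OF dg g(2), of "q * u"] deg_one_displacement[OF deg_one_inv[OF dg] ig0, of "q * u"] q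
    by (auto simp: abs_le_iff divide_simps algebra_simps)
  then have disp: "\<bar>h u - u\<bar> \<le> 1 / q \<and> \<bar>inv h u - u\<bar> \<le> 1 / q" for u
    using deg_one_rescale(3)[OF dg q] by (simp add: h_def[abs_def])
  have per: "h (u + 1 / q) = h u + 1 / q" for u
    unfolding h_def by (rule deg_one_rescale(2)[OF dg q])
  define \<H>' where "\<H>' = \<H> \<union> (\<lambda>H t. H (h t)) ` \<H>"
  have fin': "finite \<H>'" using fin by (simp add: \<H>'_def)
  have dl': "diff_lift H" if "H \<in> \<H>'" for H using that dl diff_lift_comp[OF _ h] by (auto simp: \<H>'_def)
  have "\<forall>H\<in>\<H>'. \<forall>\<^sub>F N in sequentially. \<forall>s t. \<bar>s - t\<bar> \<le> (n + 1) / (q * N) \<longrightarrow>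
      \<bar>H s - H t\<bar> \<le> (1 / 2) ^ n \<and>
      (\<forall>i\<le>n. \<forall>u. \<bar>(deriv ^^ i) (\<lambda>u. H (s + inv H u)) u -
        (deriv ^^ i) (\<lambda>u. H (t + inv H u)) u\<bar> \<le> (1 / 2) ^ n)"
  proof
    fix H assume H: "H \<in> \<H>'"
    obtain d where d: "d > 0" "\<And>i s t u. i \<le> n \<Longrightarrow> \<bar>s - t\<bar> \<le> d \<Longrightarrow>
        \<bar>(deriv ^^ i) (\<lambda>u. H (s + inv H u)) u - (deriv ^^ i) (\<lambda>u. H (t + inv H u)) u\<bar> \<le> (1 / 2) ^ n"
      using conj_close[OF dl'[OF H], of "(1 / 2) ^ n" n] by auto
    obtain A where A: "A \<ge> 0" "\<And>s t. \<bar>H s - H t\<bar> \<le> A * \<bar>s - t\<bar>"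
      using higher_deriv_Lipschitz[of H 0] dl'[OF H] by (metis funpow_0 diff_lift_def)
    define d' where "d' = min d ((1 / 2) ^ n / (A + 1))"
    have "\<forall>\<^sub>F N in sequentially. real (n + 1) / (q * N) \<le> d'"
      using d(1) A(1) q by (intro eventually_const_div_le) (auto simp: d'_def)
    then show "\<forall>\<^sub>F N in sequentially. \<forall>s t. \<bar>s - t\<bar> \<le> (n + 1) / (q * N) \<longrightarrow>
      \<bar>H s - H t\<bar> \<le> (1 / 2) ^ n \<and>
      (\<forall>i\<le>n. \<forall>u. \<bar>(deriv ^^ i) (\<lambda>u. H (s + inv H u)) u -
        (deriv ^^ i) (\<lambda>u. H (t + inv H u)) u\<bar> \<le> (1 / 2) ^ n)"
    proof eventually_elim
      case (elim N)
      show ?case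
      proof (intro allI impI conjI)
        fix s t :: real assume st: "\<bar>s - t\<bar> \<le> real (n + 1) / real (q * N)"
        then have st: "\<bar>s - t\<bar> \<le> d'" using elim by simp
        then have "A * \<bar>s - t\<bar> \<le> (A + 1) * ((1 / 2) ^ n / (A + 1))"
          using A(1) by (intro mult_mono) (auto simp: d'_def)
        then show "\<bar>H s - H t\<bar> \<le> (1 / 2) ^ n" using A(2)[of s t] A(1) by simp
        fix i u assume "i \<le> n"
        then show "\<bar>(deriv ^^ i) (\<lambda>u. H (s + inv H u)) u -
          (deriv ^^ i) (\<lambda>u. H (t + inv H u)) u\<bar> \<le> (1 / 2) ^ n" using st by (intro d(2)) (auto simp: d'_def)
      qed
    qed
  qed
  then have "\<forall>\<^sub>F N in sequentially. \<forall>H\<in>\<H>'. \<forall>s t. \<bar>s - t\<bar> \<le> (n + 1) / (q * N) \<longrightarrow>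
      \<bar>H s - H t\<bar> \<le> (1 / 2) ^ n \<and>
      (\<forall>i\<le>n. \<forall>u. \<bar>(deriv ^^ i) (\<lambda>u. H (s + inv H u)) u -
        (deriv ^^ i) (\<lambda>u. H (t + inv H u)) u\<bar> \<le> (1 / 2) ^ n)"
    by (rule eventually_ball_finite[OF fin'])
  moreover have "\<forall>\<^sub>F N in sequentially. 8 / (q * N) \<le> \<epsilon>"
    using e q by (rule eventually_const_div_le)
  moreover have "\<forall>\<^sub>F N in sequentially. n + 2 \<le> N" by (rule eventually_ge_at_top)
  ultimately have "\<forall>\<^sub>F N in sequentially. tower_step n q \<H> h (q * N)"
  proof eventually_elim
    case (elim N)
    have "h \<epsilon> - h 0 \<ge> 1 / (4 * q)" using g(2,3) q by (simp add: h_def divide_simps)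
    moreover have "L * (\<epsilon> + 8 / (q * N)) \<le> L * (\<epsilon> + \<epsilon>)"
      using elim L1 by (intro mult_left_mono add_mono) auto
    then have "L * (\<epsilon> + 8 / (q * N)) \<le> R" using L1 by (simp add: \<epsilon>_def)
    ultimately have "\<exists>(L :: real) (\<epsilon> :: real). L \<ge> 1 \<and> \<epsilon> > 0 \<and>
      (\<forall>H\<in>\<H>. \<forall>s t. \<bar>H s - H t\<bar> \<le> L * \<bar>s - t\<bar> \<and> \<bar>inv H s - inv H t\<bar> \<le> L * \<bar>s - t\<bar>) \<and>
      h \<epsilon> - h 0 \<ge> 1 / (4 * q) \<and> L * (\<epsilon> + 8 / real (q * N)) \<le> (1 / (4 * q * L)) ^ n"
      using L L1 e unfolding R_def by (intro exI[of _ L] exI[of _ \<epsilon>]) simp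
    moreover have "(n + 2) * q \<le> q * N" using mult_le_mono2[OF elim(3), of q] by (simp add: mult.commute)
    ultimately show ?case
      unfolding tower_step_def using h per disp elim(1) by (auto simp: \<H>'_def)
  qed
  then show ?thesis using that by (auto simp: eventually_sequentially)
qed

text \<open>New maps enter on the inside, next to the translation that is conjugated, so that they
  can commute with it.\<close>

primrec partial_conj :: "(nat \<Rightarrow> real \<Rightarrow> real) \<Rightarrow> (nat \<Rightarrow> bool) \<Rightarrow> nat \<Rightarrow> real \<Rightarrow> real" where
  "partial_conj h x 0 = (\<lambda>t. t)"
| "partial_conj h x (Suc n) = (if x n then (\<lambda>t. partial_conj h x n (h n t)) else partial_conj h x n)"

locale tower =
  fixes q :: "nat \<Rightarrow> nat" and h :: "nat \<Rightarrow> real \<Rightarrow> real" and \<H> :: "nat \<Rightarrow> (real \<Rightarrow> real) set"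
  assumes q0: "q 0 = 1" and level0: "\<H> 0 = {\<lambda>t. t}"
    and level_Suc: "\<And>n. \<H> (Suc n) = \<H> n \<union> (\<lambda>H t. H (h n t)) ` \<H> n"
    and step: "\<And>n. tower_step n (q n) (\<H> n) (h n) (q (Suc n))"

lemma tower_exists: obtains q h \<H> where "tower q h \<H>"
proof -
  define P :: "nat \<Rightarrow> nat \<times> (real \<Rightarrow> real) set \<times> (real \<Rightarrow> real) \<Rightarrow> bool"
    where "P n s = (case s of (q, \<H>, h) \<Rightarrow> q > 0 \<and> finite \<H> \<and> (\<forall>H\<in>\<H>. diff_lift H) \<and>
      (n = 0 \<longrightarrow> q = 1 \<and> \<H> = {\<lambda>t. t}))" for n s
  define Q :: "nat \<Rightarrow> nat \<times> (real \<Rightarrow> real) set \<times> (real \<Rightarrow> real) \<Rightarrow> nat \<times> (real \<Rightarrow> real) set \<times> (real \<Rightarrow> real) \<Rightarrow> bool"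
    where "Q n s s' = (case s of (q, \<H>, _) \<Rightarrow> case s' of (q', \<H>', h) \<Rightarrow>
      tower_step n q \<H> h q' \<and> \<H>' = \<H> \<union> (\<lambda>H t. H (h t)) ` \<H>)" for n s s'
  have "\<exists>S. \<forall>n. P n (S n) \<and> Q n (S n) (S (Suc n))"
  proof (rule dependent_nat_choice)
    \<comment> \<open>The third component of the initial state is a placeholder: the map chosen at
      step n is stored in state n + 1.\<close>
    show "\<exists>s. P 0 s" by (rule exI[of _ "(1, {\<lambda>t. t}, \<lambda>t. t)"]) (simp add: P_def diff_lift_id)
    fix s n assume "P n s"
    then obtain q \<H> h0 where s: "s = (q, \<H>, h0)" "q > 0" "finite \<H>" "\<And>H. H \<in> \<H> \<Longrightarrow> diff_lift H"
      by (cases s) (auto simp: P_def)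
    obtain h q' where t: "tower_step n q \<H> h q'" using tower_step_exists[OF s(3,4,2)] by blast
    define \<H>' where "\<H>' = \<H> \<union> (\<lambda>H t. H (h t)) ` \<H>"
    have "diff_lift h" "(n + 2) * q \<le> q'" using t unfolding tower_step_def by blast+
    moreover have "0 < (n + 2) * q" using s(2) by simp
    ultimately have "diff_lift h" "q' > 0" by linarith+
    then have "P (Suc n) (q', \<H>', h)" using s diff_lift_comp by (auto simp: P_def \<H>'_def)
    moreover have "Q n s (q', \<H>', h)" using t by (simp add: Q_def s(1) \<H>'_def)
    ultimately show "\<exists>s'. P (Suc n) s' \<and> Q n s s'" by blast
  qed
  then obtain S where S: "\<And>n. P n (S n)" "\<And>n. Q n (S n) (S (Suc n))" by blast
  have "tower (\<lambda>n. fst (S n)) (\<lambda>n. snd (snd (S (Suc n)))) (\<lambda>n. fst (snd (S n)))"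
    using S(1)[of 0] S(2) unfolding P_def Q_def case_prod_beta by unfold_locales simp_all
  then show ?thesis using that by blast
qed

lemma geometric_limit:
  fixes a :: "nat \<Rightarrow> real"
  assumes a: "\<And>k. \<bar>a (Suc k) - a k\<bar> \<le> C * (1 / 2) ^ k"
  obtains l where "a \<longlonglongrightarrow> l" "\<bar>l - a 0\<bar> \<le> 2 * C"
proof -
  let ?d = "\<lambda>k. a (Suc k) - a k"
  have g: "(\<lambda>k. C * (1 / 2) ^ k) sums (C * 2)"
    using sums_mult[OF geometric_sums[of "1 / 2 :: real"], of C] by simp
  have n: "summable (\<lambda>k. norm (?d k))"
    using a by (intro summable_comparison_test'[OF sums_summable[OF g]]) auto
  have "norm (suminf ?d) \<le> (\<Sum>k. norm (?d k))" by (rule summable_norm[OF n])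
  also have "\<dots> \<le> (\<Sum>k. C * (1 / 2) ^ k)" using a by (intro suminf_le n sums_summable[OF g]) auto
  also have "\<dots> = 2 * C" using sums_unique[OF g] by simp
  finally have "\<bar>suminf ?d\<bar> \<le> 2 * C" by simp
  moreover have "(\<lambda>n. \<Sum>k<n. ?d k) \<longlonglongrightarrow> suminf ?d"
    using summable_LIMSEQ[OF summable_norm_cancel[OF n]] .
  then have "(\<lambda>n. (a n - a 0) + a 0) \<longlonglongrightarrow> suminf ?d + a 0"
    by (intro tendsto_add tendsto_const) (simp add: sum_lessThan_telescope)
  then have "a \<longlonglongrightarrow> suminf ?d + a 0" by simp
  ultimately show ?thesis using that[of "suminf ?d + a 0"] by simp
qed

lemma geometric_limit_dist:
  fixes a :: "nat \<Rightarrow> real"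
  assumes l: "a \<longlonglongrightarrow> l" and a: "\<And>k. \<bar>a (Suc (n + k)) - a (n + k)\<bar> \<le> C * (1 / 2) ^ k"
  shows "\<bar>l - a n\<bar> \<le> 2 * C"
proof -
  obtain l' where l': "(\<lambda>k. a (n + k)) \<longlonglongrightarrow> l'" "\<bar>l' - a n\<bar> \<le> 2 * C"
    using geometric_limit[of "\<lambda>k. a (n + k)" C] a by auto
  have "(\<lambda>k. a (n + k)) \<longlonglongrightarrow> l" using LIMSEQ_ignore_initial_segment[OF l, of n] by (simp add: add.commute)
  then show ?thesis using LIMSEQ_unique l' by blast
qed

lemma tendsto_of_geometric_bound:
  fixes a :: "nat \<Rightarrow> real"
  assumes "\<And>n. n \<ge> N \<Longrightarrow> \<bar>a n - l\<bar> \<le> C * (1 / 2) ^ n"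
  shows "a \<longlonglongrightarrow> l"
proof (rule Lim_transform_bound[where g = "\<lambda>n. C * (1 / 2) ^ n", THEN Lim_null[THEN iffD2]])
  show "\<forall>\<^sub>F n in sequentially. norm (a n - l) \<le> norm (C * (1 / 2) ^ n)"
    using assms by (intro eventually_sequentiallyI[of N]) (force simp: abs_le_iff)
  show "(\<lambda>n. C * (1 / 2) ^ n) \<longlonglongrightarrow> 0"
    using tendsto_mult[OF tendsto_const[of C] LIMSEQ_power_zero[of "1 / 2 :: real"]] by simp
qed

section \<open>Limits of the partial compositions and of their inverses\<close>

context tower
begin

abbreviation P :: "(nat \<Rightarrow> bool) \<Rightarrow> nat \<Rightarrow> real \<Rightarrow> real" where "P \<equiv> partial_conj h"

lemma diff_lift_h: "diff_lift (h n)"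
  using step[of n] unfolding tower_step_def by blast

lemma h_period: "h n (u + 1 / q n) = h n u + 1 / q n"
  using step[of n] unfolding tower_step_def by blast

lemma h_displacement: "\<bar>h n u - u\<bar> \<le> 1 / q n" "\<bar>inv (h n) u - u\<bar> \<le> 1 / q n"
  using step[of n] unfolding tower_step_def by blast+

lemma q_dvd_Suc: "q n dvd q (Suc n)" and q_growth: "(n + 2) * q n \<le> q (Suc n)"
  using step[of n] unfolding tower_step_def by blast+

lemma level_close:
  assumes "H \<in> \<H> (Suc n)" "\<bar>s - t\<bar> \<le> real (n + 1) / q (Suc n)"
  shows "\<bar>H s - H t\<bar> \<le> (1 / 2) ^ n"
    and "i \<le> n \<Longrightarrow> \<bar>(deriv ^^ i) (\<lambda>u. H (s + inv H u)) u - (deriv ^^ i) (\<lambda>u. H (t + inv H u)) u\<bar> \<le> (1 / 2) ^ n"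
proof -
  have "\<forall>H\<in>\<H> (Suc n). \<forall>s t. \<bar>s - t\<bar> \<le> real (n + 1) / q (Suc n) \<longrightarrow>
      \<bar>H s - H t\<bar> \<le> (1 / 2) ^ n \<and>
      (\<forall>i\<le>n. \<forall>u. \<bar>(deriv ^^ i) (\<lambda>u. H (s + inv H u)) u -
        (deriv ^^ i) (\<lambda>u. H (t + inv H u)) u\<bar> \<le> (1 / 2) ^ n)"
    using step[of n] unfolding tower_step_def level_Suc by (elim conjE)
  then have *: "\<bar>H s - H t\<bar> \<le> (1 / 2) ^ n \<and>
      (\<forall>i\<le>n. \<forall>u. \<bar>(deriv ^^ i) (\<lambda>u. H (s + inv H u)) u -
        (deriv ^^ i) (\<lambda>u. H (t + inv H u)) u\<bar> \<le> (1 / 2) ^ n)"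
    using assms by meson
  show "\<bar>H s - H t\<bar> \<le> (1 / 2) ^ n"
    and "i \<le> n \<Longrightarrow> \<bar>(deriv ^^ i) (\<lambda>u. H (s + inv H u)) u - (deriv ^^ i) (\<lambda>u. H (t + inv H u)) u\<bar> \<le> (1 / 2) ^ n"
    using * by auto
qed

lemma steep:
  obtains L \<epsilon> :: real where "L \<ge> 1" "\<epsilon> > 0"
    "\<And>H s t. H \<in> \<H> n \<Longrightarrow> \<bar>H s - H t\<bar> \<le> L * \<bar>s - t\<bar>"
    "\<And>H s t. H \<in> \<H> n \<Longrightarrow> \<bar>inv H s - inv H t\<bar> \<le> L * \<bar>s - t\<bar>"
    "h n \<epsilon> - h n 0 \<ge> 1 / (4 * q n)" "L * (\<epsilon> + 8 / q (Suc n)) \<le> (1 / (4 * q n * L)) ^ n"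
  using step[of n] unfolding tower_step_def by auto

lemma q_pos: "q n > 0"
proof (induction n)
  case (Suc n)
  then have "0 < (n + 2) * q n" by simp
  then show ?case using q_growth[of n] by linarith
qed (simp add: q0)

lemma q_dvd: "m \<le> n \<Longrightarrow> q m dvd q n"
  by (induction rule: dec_induct) (auto intro: dvd_trans q_dvd_Suc)

lemma inverse_q_le: "1 / q (n + k) \<le> 1 / q n * (1 / 2) ^ k"
proof (induction k)
  case (Suc k)
  have "2 * q (n + k) \<le> (n + k + 2) * q (n + k)" by simp
  then have "2 * q (n + k) \<le> q (Suc (n + k))" using q_growth[of "n + k"] by linarith
  then have "2 * real (q (n + k)) \<le> real (q (Suc (n + k)))" by (metis of_nat_le_iff of_nat_mult of_nat_numeral)
  then have "1 / real (q (Suc (n + k))) \<le> 1 / (2 * real (q (n + k)))"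
    using q_pos[of "n + k"] by (intro divide_left_mono) auto
  then show ?case using Suc by simp
qed auto

lemma inverse_q_le_power: "1 / q n \<le> (1 / 2) ^ n"
  using inverse_q_le[of 0 n] by (simp add: q0)

lemma diff_lift_level: "H \<in> \<H> n \<Longrightarrow> diff_lift H"
  by (induction n arbitrary: H) (auto simp: level0 level_Suc diff_lift_id intro: diff_lift_comp diff_lift_h)

lemma P_level: "P x n \<in> \<H> n"
  by (induction n) (auto simp: level0 level_Suc)

lemma diff_lift_P: "diff_lift (P x n)"
  using diff_lift_level P_level .

lemma deg_one_P: "deg_one (P x n)"
  using diff_lift_P by (simp add: diff_lift_def)

lemma deg_one_h: "deg_one (h n)"
  using diff_lift_h by (simp add: diff_lift_def)

lemma inv_P_Suc: "inv (P x (Suc n)) = (if x n then (\<lambda>t. inv (h n) (inv (P x n) t)) else inv (P x n))"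
  by (simp add: inv_comp_deg_one[OF deg_one_P deg_one_h])

text \<open>In the inverse the new map is applied last, so its displacement is the whole change and
  no distortion intervenes.\<close>

lemma inv_P_step: "\<bar>inv (P x (Suc n)) u - inv (P x n) u\<bar> \<le> 1 / q n"
  using h_displacement(2)[of n "inv (P x n) u"] unfolding inv_P_Suc by auto

text \<open>Here the displacement of the new map is distorted by \<open>P x (Suc n)\<close>. It is
  at most 1 / \<open>q (Suc n)\<close>, and that denominator was chosen after all maps of level
  \<open>Suc n\<close>.\<close>

lemma P_step: "\<bar>P x (Suc (Suc n)) u - P x (Suc n) u\<bar> \<le> (1 / 2) ^ n"
proof (cases "x (Suc n)")
  case True
  have "1 / q (Suc n) \<le> real (n + 1) / q (Suc n)" by (intro divide_right_mono) auto
  then have "\<bar>h (Suc n) u - u\<bar> \<le> real (n + 1) / q (Suc n)" using h_displacement(1)[of "Suc n" u] by linarith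
  from level_close(1)[OF P_level this, of x] show ?thesis using True by (simp del: partial_conj.simps add: partial_conj.simps(2)[of _ _ "Suc n"])
qed (simp del: partial_conj.simps add: partial_conj.simps(2)[of _ _ "Suc n"])

definition HH :: "(nat \<Rightarrow> bool) \<Rightarrow> real \<Rightarrow> real"
  where "HH x u = lim (\<lambda>n. P x n u)"

text \<open>A limit in its own right: that it inverts \<open>HH x\<close> is a theorem, and the
  continuity of \<open>HH x\<close> is obtained from it through \<open>deg_oneI\<close>.\<close>

definition GG :: "(nat \<Rightarrow> bool) \<Rightarrow> real \<Rightarrow> real"
  where "GG x u = lim (\<lambda>n. inv (P x n) u)"

lemma HH_tendsto: "(\<lambda>n. P x n u) \<longlonglongrightarrow> HH x u"
proof -
  obtain l where "(\<lambda>n. P x (Suc n) u) \<longlonglongrightarrow> l"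
    using geometric_limit[of "\<lambda>n. P x (Suc n) u" 1] P_step by (metis mult_1)
  then have "(\<lambda>n. P x n u) \<longlonglongrightarrow> l" by (rule LIMSEQ_imp_Suc)
  then show ?thesis unfolding HH_def by (simp add: limI)
qed

lemma GG_tendsto: "(\<lambda>n. inv (P x n) u) \<longlonglongrightarrow> GG x u"
proof -
  obtain l where "(\<lambda>n. inv (P x n) u) \<longlonglongrightarrow> l"
    using geometric_limit[of "\<lambda>n. inv (P x n) u" 1] inv_P_step inverse_q_le_power
    by (metis mult_1 order_trans)
  then show ?thesis unfolding GG_def by (simp add: limI)
qed

lemma HH_close: "\<bar>HH x u - P x (Suc n) u\<bar> \<le> 2 * (1 / 2) ^ n"
proof (rule geometric_limit_dist[OF HH_tendsto])
  show "\<bar>P x (Suc (Suc n + k)) u - P x (Suc n + k) u\<bar> \<le> (1 / 2) ^ n * (1 / 2) ^ k" for k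
    using P_step[of x "n + k" u] unfolding add_Suc power_add .
qed

lemma GG_close: "\<bar>GG x u - inv (P x n) u\<bar> \<le> 2 / q n"
proof -
  have "\<bar>inv (P x (Suc (n + k))) u - inv (P x (n + k)) u\<bar> \<le> 1 / q n * (1 / 2) ^ k" for k
    using inv_P_step[of x "n + k" u] inverse_q_le[of n k] by linarith
  from geometric_limit_dist[OF GG_tendsto this] show ?thesis by simp
qed

lemma GG_close_power: "\<bar>GG x u - inv (P x n) u\<bar> \<le> 2 * (1 / 2) ^ n"
  using GG_close[of x u n] inverse_q_le_power[of n] by simp

lemma continuous_GG: "continuous_on UNIV (GG x)"
proof (rule uniform_limit_theorem[where F = sequentially and f = "\<lambda>n. inv (P x n)"])
  show "uniform_limit UNIV (\<lambda>n. inv (P x n)) (GG x) sequentially"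
  proof (rule uniform_limitI)
    fix e :: real assume "e > 0"
    then obtain N where N: "(1 / 2) ^ N < e / 2" using real_arch_pow_inv[of "e / 2" "1 / 2"] by auto
    have "dist (inv (P x n) u) (GG x u) < e" if "n \<ge> N" for n u
    proof -
      have "(1 / 2 :: real) ^ n \<le> (1 / 2) ^ N" using that by (intro power_decreasing) auto
      then show ?thesis using GG_close_power[of x u n] N unfolding dist_real_def by linarith
    qed
    then show "\<forall>\<^sub>F n in sequentially. \<forall>u\<in>UNIV. dist (inv (P x n) u) (GG x u) < e"
      by (intro eventually_sequentiallyI) auto
  qed
  show "\<forall>\<^sub>F n in sequentially. continuous_on UNIV (inv (P x n))"
    using deg_one_inv[OF deg_one_P] by (intro always_eventually) (simp add: deg_one_def)
qed auto

text \<open>The error 2 / \<open>q (Suc n)\<close> of \<open>GG x u\<close> against the inverse of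
  \<open>P x (Suc n)\<close> lies in the range (n + 1) / \<open>q (Suc n)\<close> of
  \<open>level_close\<close> as soon as n \<ge> 1, so \<open>P x (Suc n)\<close> returns it close to
  u.\<close>

lemma HH_GG: "HH x (GG x u) = u"
proof -
  have "\<bar>P x (Suc n) (GG x u) - u\<bar> \<le> (1 / 2) ^ n" if "n \<ge> 1" for n
  proof -
    have "2 / q (Suc n) \<le> real (n + 1) / q (Suc n)" using that by (intro divide_right_mono) auto
    then have "\<bar>GG x u - inv (P x (Suc n)) u\<bar> \<le> real (n + 1) / q (Suc n)"
      using GG_close[of x u "Suc n"] by linarith
    from level_close(1)[OF P_level this, of x] show ?thesis by (simp only: deg_one_inv_cancel[OF deg_one_P])
  qed
  then have "(\<lambda>n. P x (Suc n) (GG x u)) \<longlonglongrightarrow> u" by (intro tendsto_of_geometric_bound[where C = 1 and N = 1]) auto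
  then show ?thesis using LIMSEQ_Suc[OF HH_tendsto] LIMSEQ_unique by blast
qed

text \<open>\<open>GG_close_power\<close> at the point \<open>P x n u\<close> shows that
  \<open>GG x\<close> nearly undoes \<open>P x n\<close>; continuity of \<open>GG x\<close> carries
  this to the limit.\<close>

lemma GG_HH: "GG x (HH x u) = u"
proof -
  have "isCont (GG x) (HH x u)" using continuous_GG by (simp add: continuous_on_eq_continuous_at)
  then have "(\<lambda>n. GG x (P x n u)) \<longlonglongrightarrow> GG x (HH x u)" by (rule isCont_tendsto_compose) (rule HH_tendsto)
  moreover have "\<bar>GG x (P x n u) - u\<bar> \<le> 2 * (1 / 2) ^ n" for n
    using GG_close_power[of x "P x n u" n] by (simp add: deg_one_inv_cancel[OF deg_one_P])
  then have "(\<lambda>n. GG x (P x n u)) \<longlonglongrightarrow> u" by (intro tendsto_of_geometric_bound) auto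
  ultimately show ?thesis using LIMSEQ_unique by blast
qed

lemma deg_one_HH: "deg_one (HH x)"
proof (rule deg_oneI[where G = "GG x"])
  show "mono (HH x)"
    using deg_one_le_iff[OF deg_one_P] by (intro monoI LIMSEQ_le[OF HH_tendsto HH_tendsto]) auto
  show "HH x (t + 1) = HH x t + 1" for t
  proof -
    have "(\<lambda>n. P x n (t + 1)) = (\<lambda>n. P x n t + 1)" using deg_one_P by (auto simp: deg_one_def)
    then have "(\<lambda>n. P x n (t + 1)) \<longlonglongrightarrow> HH x t + 1"
      using tendsto_add[OF HH_tendsto[of x t] tendsto_const[of 1]] by simp
    then show ?thesis using HH_tendsto LIMSEQ_unique by blast
  qed
qed (auto simp: HH_GG GG_HH)

lemma inv_HH: "inv (HH x) = GG x"
  by (rule inv_equality) (auto simp: HH_GG GG_HH)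

lemma deg_one_GG: "deg_one (GG x)"
  using deg_one_inv[OF deg_one_HH] by (simp add: inv_HH)

lemma P_cong: "(\<And>m. m < n \<Longrightarrow> x m = y m) \<Longrightarrow> P x n = P y n"
  by (induction n) auto

text \<open>From stage N on both compositions receive the same maps on the inside, so they keep
  differing by one fixed smooth map on the outside.\<close>

lemma HH_tail_equivalent:
  assumes "\<And>n. n \<ge> N \<Longrightarrow> x n = y n"
  shows "HH x u = P x N (inv (P y N) (HH y u))"
proof -
  define D where "D = (\<lambda>t. P x N (inv (P y N) t))"
  have *: "P x n u = D (P y n u)" if "n \<ge> N" for n u
    using that
  proof (induction n arbitrary: u rule: dec_induct)
    case base
    show ?case by (simp add: D_def deg_one_inv_cancel[OF deg_one_P])
  next
    case (step n)
    then show ?case using assms[of n] by auto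
  qed
  have "deg_one D" unfolding D_def by (intro deg_one_comp[OF deg_one_P] deg_one_inv[OF deg_one_P])
  then have "isCont D (HH y u)" by (simp add: deg_one_def continuous_on_eq_continuous_at)
  then have "(\<lambda>n. D (P y n u)) \<longlonglongrightarrow> D (HH y u)" by (rule isCont_tendsto_compose) (rule HH_tendsto)
  then have "(\<lambda>n. P x n u) \<longlonglongrightarrow> D (HH y u)"
    by (rule Lim_transform_eventually) (use * in \<open>auto intro!: eventually_sequentiallyI[of N]\<close>)
  from LIMSEQ_unique[OF HH_tendsto this] show ?thesis by (simp add: D_def)
qed

section \<open>Conjugated translations and their smoothness for well approximated angles\<close>

definition flow :: "(nat \<Rightarrow> bool) \<Rightarrow> real \<Rightarrow> real \<Rightarrow> real"
  where "flow x b u = HH x (b + GG x u)"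

lemma deg_one_flow: "deg_one (flow x b)"
  unfolding flow_def[abs_def]
  by (intro deg_one_comp[OF deg_one_HH] deg_one_comp[OF deg_one_add[of b] deg_one_GG])

lemma flow_add: "flow x (b + c) u = flow x b (flow x c u)"
  by (simp add: flow_def GG_HH add.assoc)

lemma inv_flow: "inv (flow x b) = flow x (- b)"
  by (rule inv_equality) (auto simp: flow_def GG_HH HH_GG)

text \<open>A Liouville condition adapted to the denominators \<open>q\<close>. The starting index N
  delays the error bound, so that angles with large integer coefficients qualify as well.\<close>

definition admissible :: "nat \<Rightarrow> (nat \<Rightarrow> real) \<Rightarrow> real \<Rightarrow> bool"
  where "admissible N a b \<longleftrightarrow> (\<forall>n. a n * real (q n) \<in> \<int>) \<and> a \<longlonglongrightarrow> b \<and>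
    (\<forall>n\<ge>N. \<bar>a (Suc n) - a n\<bar> \<le> real (n + 1) / q (Suc n))"

lemma admissible_minus:
  assumes "admissible N a b"
  shows "admissible N (\<lambda>n. - a n) (- b)"
proof -
  have "\<bar>- a (Suc n) - - a n\<bar> = \<bar>a (Suc n) - a n\<bar>" for n by linarith
  then show ?thesis using assms by (auto simp: admissible_def intro: tendsto_minus)
qed

text \<open>A translation by a multiple of 1 / \<open>q n\<close> commutes with \<open>h n\<close>,
  which therefore cancels against its inverse.\<close>

lemma partial_flow_Suc:
  assumes "s * real (q n) \<in> \<int>"
  shows "P x (Suc n) (s + inv (P x (Suc n)) u) = P x n (s + inv (P x n) u)"
proof (cases "x n")
  case True
  obtain k where k: "s * real (q n) = of_int k" using assms by (auto elim: Ints_cases)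
  then have s: "s = of_int k * (1 / q n)" using q_pos[of n] by (simp add: field_simps)
  define g where "g v = h n (v / q n)" for v :: real
  have "g (v + 1) = g v + 1 / q n" for v
    using h_period[of n "v / q n"] by (simp add: g_def add_divide_distrib)
  then have "g (q n * w + of_int k) = g (q n * w) + of_int k * (1 / q n)" for w :: real
    by (rule shift_of_int)
  then have "h n (w + s) = h n w + s" for w
    using q_pos[of n] by (simp add: g_def s add_divide_distrib)
  then have "h n (s + inv (h n) v) = s + v" for v
    by (simp add: add.commute[of s] deg_one_inv_cancel[OF deg_one_h])
  then show ?thesis unfolding inv_P_Suc using True by simp
qed (simp add: inv_P_Suc)

text \<open>By \<open>HH_close\<close> the maps \<open>P x n\<close> converge uniformly, so they may
  be evaluated at the moving point w n.\<close>

lemma partial_flow_tendsto: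
  assumes "a \<longlonglongrightarrow> b"
  shows "(\<lambda>n. P x n (a n + inv (P x n) u)) \<longlonglongrightarrow> flow x b u"
proof -
  define w where "w n = a n + inv (P x n) u" for n
  have w: "w \<longlonglongrightarrow> b + GG x u" unfolding w_def[abs_def] by (intro tendsto_add assms GG_tendsto)
  have "isCont (HH x) (b + GG x u)"
    using deg_one_HH by (simp add: deg_one_def continuous_on_eq_continuous_at)
  then have H: "(\<lambda>n. HH x (w n)) \<longlonglongrightarrow> flow x b u"
    unfolding flow_def by (rule isCont_tendsto_compose) (rule w)
  have "(\<lambda>n. P x n (w n) - HH x (w n)) \<longlonglongrightarrow> 0"
  \<comment> \<open>\<open>HH_close\<close> concerns the index \<open>Suc m\<close>; for n =
    \<open>Suc m\<close> its bound 2 * (1 / 2) ^ m is 4 * (1 / 2) ^ n.\<close>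
  proof (rule tendsto_of_geometric_bound[where C = 4 and N = 1])
    fix n :: nat assume "1 \<le> n"
    then obtain m where "n = Suc m" by (cases n) auto
    then show "\<bar>P x n (w n) - HH x (w n) - 0\<bar> \<le> 4 * (1 / 2) ^ n"
      using HH_close[of x "w n" m] by simp
  qed
  from tendsto_add[OF this H] show ?thesis by (simp add: w_def)
qed

text \<open>By \<open>partial_flow_Suc\<close> stage n may be written with
  \<open>P x (Suc n)\<close>. Stages n and n + 1 then conjugate two nearby translations by the same
  map, which is the situation of \<open>level_close\<close>.\<close>

lemma flow_smooth:
  assumes a: "admissible N a b"
  shows "smooth (flow x b)"
    and "N \<le> n \<Longrightarrow> i \<le> n \<Longrightarrow>
      \<bar>(deriv ^^ i) (flow x b) u - (deriv ^^ i) (\<lambda>u. P x n (a n + inv (P x n) u)) u\<bar> \<le> 2 * (1 / 2) ^ n"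
proof -
  define F where "F n = (\<lambda>u. P x n (a n + inv (P x n) u))" for n
  have F: "F n = (\<lambda>u. P x (Suc n) (a n + inv (P x (Suc n)) u))" for n
    unfolding F_def using a by (intro ext partial_flow_Suc[symmetric]) (simp add: admissible_def)
  have 1: "smooth (F n)" for n
  proof -
    have "smooth (\<lambda>u. a n + inv (P x n) u)"
      using diff_lift_P[of x n] by (intro smooth_add[OF smooth_const]) (simp add: diff_lift_def)
    then show ?thesis using smooth_compose[of "P x n"] diff_lift_P[of x n] by (simp add: F_def diff_lift_def)
  qed
  have 2: "(\<lambda>n. F n u) \<longlonglongrightarrow> flow x b u" for u
    unfolding F_def using a by (intro partial_flow_tendsto) (simp add: admissible_def)
  have 3: "\<bar>(deriv ^^ i) (F (Suc n)) u - (deriv ^^ i) (F n) u\<bar> \<le> (1 / 2) ^ n" if "N \<le> n" "i \<le> n" for i n u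
    unfolding F[of n] unfolding F_def
    using a that by (intro level_close(2)[OF P_level]) (auto simp: admissible_def)
  show "smooth (flow x b)" using smooth_limit(1)[OF 1 2 3] by blast
  show "\<bar>(deriv ^^ i) (flow x b) u - (deriv ^^ i) (\<lambda>u. P x n (a n + inv (P x n) u)) u\<bar> \<le> 2 * (1 / 2) ^ n"
    if "N \<le> n" "i \<le> n"
    using smooth_limit(2)[OF 1 2 3 that] by (simp add: F_def)
qed

lemma diff_lift_flow: "admissible N a b \<Longrightarrow> diff_lift (flow x b)"
  using flow_smooth(1) flow_smooth(1)[OF admissible_minus] by (simp add: diff_lift_def deg_one_flow inv_flow)

text \<open>Both flows have the same approximation at stage n; each lies within 2 * (1 / 2) ^ n of
  it.\<close>

lemma flow_higher_deriv_close:
  assumes a: "admissible N a b" and n: "N \<le> n" "i \<le> n" and xy: "\<And>m. m < n \<Longrightarrow> x m = y m"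
  shows "\<bar>(deriv ^^ i) (flow x b) u - (deriv ^^ i) (flow y b) u\<bar> \<le> 4 * (1 / 2) ^ n"
proof -
  have "P x n = P y n" by (rule P_cong) (rule xy)
  then show ?thesis using flow_smooth(2)[OF a n, of x u] flow_smooth(2)[OF a n, of y u] by simp
qed

text \<open>At a level where only \<open>x\<close> uses the steep map, the transition map stretches an interval
  far beyond what a given modulus of continuity permits: the maps below that level distort by at
  most \<open>L\<close>, and those above it move points by much less than the length of the interval.\<close>

lemma transition_stretches:
  assumes n: "x n" "\<not> y n"
  obtains z1 z2 d where "z1 \<le> z2"
    "HH x (t + GG y z2) - HH x (t + GG y z1) = d" "z2 - z1 \<le> d ^ n" "0 < d" "d \<le> 1 / (4 * q n)"
proof -
  obtain L \<epsilon> :: real where L: "L \<ge> 1" and e: "\<epsilon> > 0"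
    and Lip: "\<And>H s t. H \<in> \<H> n \<Longrightarrow> \<bar>H s - H t\<bar> \<le> L * \<bar>s - t\<bar>"
      "\<And>H s t. H \<in> \<H> n \<Longrightarrow> \<bar>inv H s - inv H t\<bar> \<le> L * \<bar>s - t\<bar>"
    and st: "h n \<epsilon> - h n 0 \<ge> 1 / (4 * q n)" and small: "L * (\<epsilon> + 8 / q (Suc n)) \<le> (1 / (4 * q n * L)) ^ n"
    using steep[of n] by blast
  \<comment> \<open>The image under \<open>h n\<close> has length at least 1 / (4 * q n), and
    \<open>P x n\<close> shrinks it at most by the factor L.\<close>
  define d where "d = 1 / (4 * q n * L)"
  define \<eta> where "\<eta> = 2 / q (Suc n)"
  have eta: "\<eta> > 0" using q_pos[of "Suc n"] by (simp add: \<eta>_def)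
  have d: "0 < d" "d \<le> 1 / (4 * q n)" using L q_pos[of n] by (auto simp: d_def divide_simps)
  define K where "K z = HH x (t + GG y z)" for z
  have K: "deg_one K"
    unfolding K_def[abs_def] by (intro deg_one_comp[OF deg_one_HH] deg_one_comp[OF deg_one_add[of t] deg_one_GG])
  have Psx: "P x (Suc n) = (\<lambda>u. P x n (h n u))" and Psy: "P y (Suc n) = P y n" using n by auto
  \<comment> \<open>Of the margin 2 * \<eta> on each side, one \<eta> absorbs the error of
    \<open>GG y\<close> and the other that of \<open>GG x\<close>, both at level
    \<open>Suc n\<close>. Together the margins are the 8 / q' of \<open>tower_step\<close>.\<close>
  define z1 where "z1 = P y n (- t - 2 * \<eta>)"
  define z2 where "z2 = P y n (\<epsilon> + 2 * \<eta> - t)"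
  have "inv (P y (Suc n)) z1 = - t - 2 * \<eta>" "inv (P y (Suc n)) z2 = \<epsilon> + 2 * \<eta> - t"
    unfolding Psy z1_def z2_def by (simp_all only: deg_one_inv_cancel[OF deg_one_P])
  then have G: "t + GG y z1 \<le> - \<eta>" "\<epsilon> + \<eta> \<le> t + GG y z2"
    using GG_close[of y z1 "Suc n"] GG_close[of y z2 "Suc n"] by (auto simp: \<eta>_def abs_le_iff)
  have z12: "z1 \<le> z2"
    unfolding z1_def z2_def deg_one_le_iff[OF deg_one_P] using e eta by linarith
  have "K z1 \<le> P x (Suc n) 0"
  proof -
    have "inv (P x (Suc n)) (HH x (- \<eta>)) \<le> 0"
      using GG_close[of x "HH x (- \<eta>)" "Suc n"] by (simp add: GG_HH \<eta>_def abs_le_iff)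
    then have "HH x (- \<eta>) \<le> P x (Suc n) 0"
      by (metis deg_one_inv_cancel(1)[OF deg_one_P] deg_one_le_iff[OF deg_one_P])
    then show ?thesis unfolding K_def using G(1) deg_one_le_iff[OF deg_one_HH] order_trans by blast
  qed
  moreover have "K z2 \<ge> P x (Suc n) \<epsilon>"
  proof -
    have "inv (P x (Suc n)) (HH x (\<epsilon> + \<eta>)) \<ge> \<epsilon>"
      using GG_close[of x "HH x (\<epsilon> + \<eta>)" "Suc n"] by (simp add: GG_HH \<eta>_def abs_le_iff)
    then have "HH x (\<epsilon> + \<eta>) \<ge> P x (Suc n) \<epsilon>"
      by (metis deg_one_inv_cancel(1)[OF deg_one_P] deg_one_le_iff[OF deg_one_P])
    then show ?thesis unfolding K_def using G(2) deg_one_le_iff[OF deg_one_HH] order_trans by blast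
  qed
  moreover have "P x (Suc n) \<epsilon> - P x (Suc n) 0 \<ge> d"
  proof -
    have le: "P x n (h n 0) \<le> P x n (h n \<epsilon>)"
      using e deg_one_le_iff[OF deg_one_P] deg_one_le_iff[OF deg_one_h] by simp
    have "1 / (4 * q n) \<le> \<bar>h n \<epsilon> - h n 0\<bar>" using st by linarith
    also have "\<dots> \<le> L * \<bar>P x n (h n \<epsilon>) - P x n (h n 0)\<bar>"
      using Lip(2)[OF P_level, of x "P x n (h n \<epsilon>)" "P x n (h n 0)"]
      by (simp only: deg_one_inv_cancel[OF deg_one_P])
    finally have "1 / (4 * q n) \<le> L * (P x n (h n \<epsilon>) - P x n (h n 0))" using le by simp
    then have "1 / (4 * q n) / L \<le> P x n (h n \<epsilon>) - P x n (h n 0)"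
      using L by (subst pos_divide_le_eq) (auto simp: mult.commute)
    then show ?thesis unfolding Psx d_def by simp
  qed
  \<comment> \<open>The image may be longer than d. Cutting it down to length exactly d keeps it at
    most 1 / 4, where distances on the circle and on the line agree, and can only shorten the source
    interval.\<close>
  ultimately have "K z1 \<le> K z1 + d" "K z1 + d \<le> K z2" using d by linarith+
  then have "\<exists>z\<ge>z1. z \<le> z2 \<and> K z = K z1 + d"
    using z12 K by (intro IVT') (auto simp: deg_one_def intro: continuous_on_subset)
  then obtain z where z: "z1 \<le> z" "z \<le> z2" "K z = K z1 + d" by blast
  have "\<bar>z2 - z1\<bar> \<le> L * \<bar>(\<epsilon> + 2 * \<eta> - t) - (- t - 2 * \<eta>)\<bar>"
    unfolding z1_def z2_def by (rule Lip(1)[OF P_level])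
  also have "\<bar>(\<epsilon> + 2 * \<eta> - t) - (- t - 2 * \<eta>)\<bar> = \<epsilon> + 8 / q (Suc n)" using e eta by (simp add: \<eta>_def)
  finally have "z2 - z1 \<le> d ^ n" using small by (simp add: d_def)
  then show ?thesis using that[of z1 z d] z d by (simp add: K_def)
qed

text \<open>At a stretching level with n \<ge> 2 / \<beta>, a Hoelder bound gives d \<le> C * d powr
  (n * \<beta>) \<le> C * d powr 2, hence 1 \<le> C * d. But d \<le> (1 / 2) ^ n, which is below 1 /
  C once n \<ge> C.\<close>

lemma transition_not_Hoelder:
  assumes inf: "infinite {n. x n \<and> \<not> y n}" and \<beta>: "\<beta> > 0"
  shows "\<not> is_Hoelder \<beta> (circ (\<lambda>u. HH x (t + GG y u)))"
proof
  define K where "K u = HH x (t + GG y u)" for u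
  have K: "deg_one K"
    unfolding K_def[abs_def] by (intro deg_one_comp[OF deg_one_HH] deg_one_comp[OF deg_one_add[of t] deg_one_GG])
  assume "is_Hoelder \<beta> (circ (\<lambda>u. HH x (t + GG y u)))"
  then obtain C0 where C0: "\<And>x y. dist (circ K x) (circ K y) \<le> C0 * dist x y powr \<beta>"
    unfolding is_Hoelder_def K_def[abs_def] by blast
  define C where "C = max C0 1"
  have "C0 * dist x y powr \<beta> \<le> C * dist x y powr \<beta>" for x y :: circle
    by (intro mult_right_mono) (auto simp: C_def)
  then have C: "C \<ge> 1" "\<And>x y. dist (circ K x) (circ K y) \<le> C * dist x y powr \<beta>"
    using order_trans[OF C0] by (auto simp: C_def)
  obtain k :: nat where k: "k \<ge> 2 / \<beta>" "k \<ge> C" by (metis max.bounded_iff real_arch_simple)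
  obtain n where n: "n \<ge> k" "x n" "\<not> y n" using inf unfolding infinite_nat_iff_unbounded_le by blast
  obtain z1 z2 d where z: "z1 \<le> z2" "K z2 - K z1 = d" "z2 - z1 \<le> d ^ n" "0 < d" "d \<le> 1 / (4 * q n)"
    using transition_stretches[where x = x and y = y and n = n and t = t, OF n(2,3)] unfolding K_def by blast
  have "1 / q n \<le> (1 / 2) ^ n" by (rule inverse_q_le_power)
  also have "(1 / 2 :: real) ^ n \<le> 1" by (simp add: power_le_one)
  finally have d1: "d \<le> 1 / 4" using z(5) by simp
  have "real n < 2 ^ n" by (metis of_nat_less_two_power)
  then have "C < 2 ^ n" using k(2) n(1) by linarith
  have "d = dist (abs_circle (K z2)) (abs_circle (K z1))"
    using z(2,4) d1 by (subst dist_abs_circle_eq) auto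
  also have "\<dots> \<le> C * dist (abs_circle z2) (abs_circle z1) powr \<beta>"
    using C(2)[of "abs_circle z2" "abs_circle z1"] by (simp add: circ_abs[OF K])
  also have "\<dots> \<le> C * (d ^ n) powr \<beta>"
    using C(1) \<beta> dist_abs_circle_le[of z2 z1] z(1,3) by (intro mult_left_mono powr_mono2) auto
  also have "(d ^ n) powr \<beta> = d powr (n * \<beta>)" using z(4) by (simp add: powr_powr flip: powr_realpow)
  also have "C * d powr (n * \<beta>) \<le> C * d powr 2"
  proof -
    have "2 \<le> real k * \<beta>" using k(1) \<beta> by (simp add: field_simps)
    also have "\<dots> \<le> n * \<beta>" using n(1) \<beta> by (intro mult_right_mono) auto
    finally show ?thesis using z(4) d1 C(1) by (intro mult_left_mono powr_mono') auto
  qed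
  also have "d powr 2 = d * d" using z(4) by (simp add: power2_eq_square)
  finally have "1 \<le> C * d" using z(4) by simp
  also have "\<dots> \<le> C * (1 / 2) ^ n"
  proof (intro mult_left_mono)
    have "1 / real (4 * q n) = 1 / q n / 4" "0 \<le> 1 / real (q n)" by simp_all
    then show "d \<le> (1 / 2) ^ n" using z(5) inverse_q_le_power[of n] by linarith
  qed (use C(1) in simp)
  also have "\<dots> < 1" using \<open>C < 2 ^ n\<close> by (simp add: power_one_over field_simps)
  finally show False by simp
qed

end

section \<open>Angles, the actions they define, and the conjugacies between these\<close>

section \<open>The actions\<close>

lemma recurrent_sequence_exists: obtains e :: "nat \<Rightarrow> 'd::finite" where "\<And>i. infinite {n. e n = i}"
proof -
  obtain f :: "nat \<Rightarrow> 'd" where f: "bij_betw f {0..<CARD('d)} UNIV"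
    using ex_bij_betw_nat_finite[of "UNIV :: 'd set"] by auto
  have "infinite {n. f (n mod CARD('d)) = i}" for i
  proof -
    obtain j where j: "j < CARD('d)" "f j = i" using f by (metis UNIV_I atLeastLessThan_iff bij_betw_def imageE)
    have "\<exists>n\<ge>m. n \<in> {n. f (n mod CARD('d)) = i}" for m
    proof -
      have "m \<le> m * CARD('d) + j" using zero_less_card_finite[where 'a = 'd] by (simp add: trans_le_add1)
      then show ?thesis using j by (intro exI[of _ "m * CARD('d) + j"]) simp
    qed
    then show ?thesis unfolding infinite_nat_iff_unbounded_le by blast
  qed
  then show ?thesis using that[of "\<lambda>n. f (n mod CARD('d))"] by blast
qed

text \<open>Since \<open>e\<close> returns to every index infinitely often, each nonzero coordinate
  of a vector shows up in arbitrarily late terms of its angle.\<close>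

locale action_tower = tower q h \<H> for q h \<H> +
  fixes e :: "nat \<Rightarrow> 'd::finite"
  assumes e_recurrent: "infinite {n. e n = i}"
begin

text \<open>All coordinates share one series, whose term m reads only the coordinate
  \<open>e m\<close>. The angle of the i-th generator is thus the sum of 1 / q m over those m with
  \<open>e m = i\<close>.\<close>

definition rot_partial :: "int ^ 'd \<Rightarrow> nat \<Rightarrow> real"
  where "rot_partial v n = (\<Sum>m\<le>n. of_int (v $ e m) / q m)"

definition rot :: "int ^ 'd \<Rightarrow> real"
  where "rot v = lim (rot_partial v)"

lemma rot_partial_step: "\<bar>rot_partial v (Suc n) - rot_partial v n\<bar> = of_int \<bar>v $ e (Suc n)\<bar> / q (Suc n)"
  by (simp add: rot_partial_def)

lemma component_bound: obtains M :: nat where "\<And>i. real_of_int \<bar>v $ i\<bar> \<le> M"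
proof -
  have "\<bar>v $ i\<bar> \<le> (\<Sum>i\<in>UNIV. \<bar>v $ i\<bar>)" for i by (rule member_le_sum) auto
  then have "\<bar>v $ i\<bar> \<le> int (nat (\<Sum>i\<in>UNIV. \<bar>v $ i\<bar>))" for i by (metis int_nat_eq sum_nonneg abs_ge_zero)
  then have "real_of_int \<bar>v $ i\<bar> \<le> real (nat (\<Sum>i\<in>UNIV. \<bar>v $ i\<bar>))" for i
    by (metis of_int_le_iff of_int_of_nat_eq)
  then show ?thesis using that by blast
qed

lemma rot_partial_step_le:
  assumes "\<And>i. real_of_int \<bar>v $ i\<bar> \<le> M"
  shows "\<bar>rot_partial v (Suc n) - rot_partial v n\<bar> \<le> M / q (Suc n)"
  unfolding rot_partial_step by (intro divide_right_mono assms) auto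

lemma rot_tendsto: "rot_partial v \<longlonglongrightarrow> rot v"
proof -
  obtain M :: nat where M: "\<And>i. real_of_int \<bar>v $ i\<bar> \<le> M" using component_bound[of v] by blast
  have "\<bar>rot_partial v (Suc n) - rot_partial v n\<bar> \<le> M * (1 / 2) ^ n" for n
  proof -
    have "1 / q (Suc n) \<le> 1 * (1 / 2) ^ n" using inverse_q_le_power[of "Suc n"] power_decreasing[of n "Suc n" "1 / 2 :: real"] by linarith
    then have "M * (1 / q (Suc n)) \<le> M * (1 / 2) ^ n" by (intro mult_left_mono) auto
    then show ?thesis using rot_partial_step_le[OF M, of n] by simp
  qed
  then obtain l where "rot_partial v \<longlonglongrightarrow> l" by (rule geometric_limit)
  then show ?thesis unfolding rot_def by (simp add: limI)
qed

lemma rot_close: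
  assumes M: "\<And>i. real_of_int \<bar>v $ i\<bar> \<le> M"
  shows "\<bar>rot v - rot_partial v n\<bar> \<le> 2 * (M / q (Suc n))"
proof (rule geometric_limit_dist[OF rot_tendsto])
  fix k
  have "M \<ge> 0" using M[of undefined] by linarith
  then have "M * (1 / q (Suc n + k)) \<le> M * (1 / q (Suc n) * (1 / 2) ^ k)"
    by (intro mult_left_mono inverse_q_le)
  then show "\<bar>rot_partial v (Suc (n + k)) - rot_partial v (n + k)\<bar> \<le> M / q (Suc n) * (1 / 2) ^ k"
    using rot_partial_step_le[OF M, of "n + k"] by simp
qed

lemma rot_partial_Ints: "rot_partial v n * real (q n) \<in> \<int>"
proof -
  have "of_int (v $ e m) / q m * q n \<in> \<int>" if m: "m \<le> n" for m
  proof -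
    obtain k where "q n = q m * k" using q_dvd[OF m] by (auto elim: dvdE)
    then show ?thesis using q_pos[of m] by simp
  qed
  then show ?thesis unfolding rot_partial_def sum_distrib_right by (intro Ints_sum) auto
qed

lemma rot_admissible:
  assumes M: "\<And>i. real_of_int \<bar>v $ i\<bar> \<le> real M"
  shows "admissible M (rot_partial v) (rot v)"
  unfolding admissible_def
proof (intro conjI allI impI rot_tendsto rot_partial_Ints)
  fix n assume "M \<le> n"
  then have "real M / q (Suc n) \<le> real (n + 1) / q (Suc n)" by (intro divide_right_mono) auto
  then show "\<bar>rot_partial v (Suc n) - rot_partial v n\<bar> \<le> real (n + 1) / q (Suc n)"
    using rot_partial_step_le[OF M, of n] by linarith
qed

lemma rot_add: "rot (v + w) = rot v + rot w"
proof -
  have "rot_partial (v + w) = (\<lambda>n. rot_partial v n + rot_partial w n)"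
    by (auto simp: rot_partial_def sum.distrib add_divide_distrib)
  then have "rot_partial (v + w) \<longlonglongrightarrow> rot v + rot w" by (auto intro: tendsto_add rot_tendsto)
  then show ?thesis using LIMSEQ_unique rot_tendsto by blast
qed

lemma rot_axis: "rot (axis i k) = of_int k * rot (axis i 1)"
proof -
  have "rot_partial (axis i k) = (\<lambda>n. of_int k * rot_partial (axis i 1) n)"
    unfolding rot_partial_def sum_distrib_left by (intro ext sum.cong) (auto simp: axis_def)
  then have "rot_partial (axis i k) \<longlonglongrightarrow> of_int k * rot (axis i 1)"
    by (auto intro: tendsto_mult rot_tendsto)
  then show ?thesis using LIMSEQ_unique rot_tendsto by blast
qed

text \<open>If \<open>rot v\<close> is an integer, then the tails of its defining series are multiples of \<open>1 / q n\<close>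
  that are much smaller than \<open>1 / q n\<close>, so they vanish.\<close>

lemma rot_Ints_imp_zero:
  assumes "rot v \<in> \<int>"
  shows "v = 0"
proof -
  obtain M :: nat where M: "\<And>i. real_of_int \<bar>v $ i\<bar> \<le> M" using component_bound[of v] by blast
  \<comment> \<open>From 2 * M on, the growth factor n + 2 of the denominators beats the constant 2
    * M in the bound on the tail.\<close>
  have eq: "rot v = rot_partial v n" if n: "n \<ge> 2 * M" for n
  proof (rule ccontr)
    assume ne: "rot v \<noteq> rot_partial v n"
    have "rot v * q n - rot_partial v n * q n \<in> \<int>"
      by (rule Ints_diff[OF Ints_mult[OF assms Ints_of_nat] rot_partial_Ints])
    then have "(rot v - rot_partial v n) * q n \<in> \<int>" by (simp add: left_diff_distrib)
    moreover have "(rot v - rot_partial v n) * q n \<noteq> 0" using ne q_pos[of n] by simp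
    ultimately have "1 \<le> \<bar>(rot v - rot_partial v n) * q n\<bar>" by (rule Ints_nonzero_abs_ge1)
    also have "\<dots> = \<bar>rot v - rot_partial v n\<bar> * q n" by (simp add: abs_mult)
    also have "\<dots> \<le> 2 * (M / q (Suc n)) * q n" by (intro mult_right_mono rot_close[OF M]) auto
    finally have "real (q (Suc n)) \<le> real (2 * M * q n)" using q_pos[of "Suc n"] by (simp add: field_simps)
    then have "q (Suc n) \<le> 2 * M * q n" by (simp only: of_nat_le_iff)
    then have "(n + 2) * q n \<le> 2 * M * q n" using q_growth[of n] by linarith
    then have "n + 2 \<le> 2 * M" using q_pos[of n] by (simp only: mult_le_cancel2)
    then show False using n by simp
  qed
  have zero: "v $ e (Suc n) = 0" if "n \<ge> 2 * M" for n
    using rot_partial_step[of v n] eq[of n] eq[of "Suc n"] that q_pos[of "Suc n"] by simp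
  have "v $ i = 0" for i
  proof -
    obtain n where "n \<ge> 2 * M + 1" "e n = i"
      using e_recurrent[of i] unfolding infinite_nat_iff_unbounded_le by blast
    then show ?thesis using zero[of "n - 1"] by (cases n) auto
  qed
  then show ?thesis by (simp add: vec_eq_iff)
qed

text \<open>Clearing the denominator would produce a nonzero vector with an integral angle.\<close>

lemma rot_axis_irrational: "rot (axis i 1) \<notin> \<rat>"
proof
  assume "rot (axis i 1) \<in> \<rat>"
  then obtain a b :: int where ab: "b > 0" "rot (axis i 1) = of_int a / of_int b" by (auto elim: Rats_cases')
  then have "rot (axis i b) = of_int a" using rot_axis[of i b] by simp
  then have "axis i b = 0" by (intro rot_Ints_imp_zero) auto
  then show False using ab(1) by (simp add: axis_eq_0_iff)
qed

definition rho :: "(nat \<Rightarrow> bool) \<Rightarrow> int ^ 'd \<Rightarrow> circle \<Rightarrow> circle"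
  where "rho x v = circ (flow x (rot v))"

lemma rho_free_action: "rho x \<in> free_actions"
proof -
  have "rho x v \<in> diffeo_smooth" for v
    unfolding rho_def by (metis component_bound rot_admissible diff_lift_flow circ_diffeo_smooth)
  moreover have "rho x (v + w) = rho x v \<circ> rho x w" for v w
    unfolding rho_def circ_comp[OF deg_one_flow] rot_add flow_add[symmetric] ..
  moreover have "rho x v p \<noteq> p" if v: "v \<noteq> 0" for v p
  proof
    define u where "u = rep_circle p"
    have p: "p = abs_circle u" by (simp add: u_def abs_rep_circle)
    assume "rho x v p = p"
    then have "abs_circle (flow x (rot v) u) = abs_circle u" by (simp add: rho_def p circ_abs[OF deg_one_flow])
    then obtain k where "flow x (rot v) u - u = of_int k" by (auto simp: circle.abs_eq_iff elim: Ints_cases)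
    then have "HH x (rot v + GG x u) = HH x (GG x u) + of_int k" by (simp add: flow_def HH_GG)
    then have "HH x (rot v + GG x u) = HH x (GG x u + of_int k)" by (simp add: deg_one_of_int[OF deg_one_HH])
    then have "rot v = of_int k" using injD[OF deg_one_inj[OF deg_one_HH]] by fastforce
    then show False using v rot_Ints_imp_zero[of v] by auto
  qed
  ultimately show ?thesis by (simp add: free_actions_def smooth_action_def)
qed

lemma rho_tail_conjugate:
  assumes xy: "\<And>n. n \<ge> N \<Longrightarrow> x n = y n" and D: "\<D> \<in> regularity_classes"
  shows "conjugate_by \<D> (rho x) (rho y)"
proof -
  define F where "F = (\<lambda>t. P x N (inv (P y N) t))"
  have dF: "diff_lift F" unfolding F_def by (intro diff_lift_comp[OF diff_lift_P] diff_lift_inv[OF diff_lift_P])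
  then have F: "deg_one F" by (simp add: diff_lift_def)
  have HF: "HH x u = F (HH y u)" for u using HH_tail_equivalent[OF xy] by (simp add: F_def)
  have GF: "GG x (F u) = GG y u" for u
    using GG_HH[of x "GG y u"] by (simp add: HF HH_GG)
  have "flow x b (F u) = F (flow y b u)" for b u by (simp add: flow_def GF HF)
  then have c: "circ (flow x b) \<circ> circ F = circ F \<circ> circ (flow y b)" for b
    by (simp add: circ_comp deg_one_flow F)
  have "rho x v = circ F \<circ> rho y v \<circ> inv (circ F)" for v
  proof -
    have "rho x v = (rho x v \<circ> circ F) \<circ> inv (circ F)"
      using circ_inv_comp(1)[OF F] by (simp add: inv_circ[OF F] comp_assoc)
    then show ?thesis unfolding rho_def c .
  qed
  then show ?thesis unfolding conjugate_by_def using circ_in_regularity_class[OF D dF] by blast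
qed

text \<open>In the coordinates given by \<open>HH\<close> the conjugacy becomes a lift M that
  commutes, up to an integer n, with the translation by an irrational a. Its displacement p is
  periodic, hence bounded, yet would drift by n with every step, so n = 0. Then p takes the value p
  0 on the dense set of all k * a - l and is constant by continuity.\<close>

lemma conjugacy_is_transition:
  assumes f: "f \<in> homeo_plus" and conj: "\<And>v. rho x v = f \<circ> rho y v \<circ> inv f"
  obtains t where "f = circ (\<lambda>u. HH x (t + GG y u))"
proof -
  obtain K where K: "deg_one K" "f = circ K" using homeo_plus_lift[OF f] by blast
  \<comment> \<open>A single generator suffices; \<open>undefined\<close> is some index.\<close>
  define a where "a = rot (axis undefined 1)"
  have a: "a \<notin> \<rat>" unfolding a_def by (rule rot_axis_irrational)
  have "circ (flow x a) = circ K \<circ> circ (flow y a) \<circ> inv (circ K)"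
    using conj[of "axis undefined 1"] by (simp add: rho_def a_def K)
  then have "circ (flow x a) \<circ> circ K = circ K \<circ> circ (flow y a)"
    using circ_inv_comp(2)[OF K(1)] by (simp add: inv_circ[OF K(1)] comp_assoc)
  then have ceq: "circ (\<lambda>u. flow x a (K u)) = circ (\<lambda>u. K (flow y a u))"
    by (simp add: circ_comp deg_one_flow K)
  have d1: "deg_one (\<lambda>u. flow x a (K u))" and d2: "deg_one (\<lambda>u. K (flow y a u))"
    by (rule deg_one_comp[OF deg_one_flow K(1)], rule deg_one_comp[OF K(1) deg_one_flow])
  have "abs_circle (flow x a (K u)) = abs_circle (K (flow y a u))" for u
    using fun_cong[OF ceq, of "abs_circle u"] by (simp add: circ_abs[OF d1] circ_abs[OF d2])
  then obtain n where n: "\<And>u. flow x a (K u) = K (flow y a u) + of_int n"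
    using lifts_differ_by_int d1 d2 unfolding deg_one_def by blast
  define M where "M = (\<lambda>u. GG x (K (HH y u)))"
  have M: "deg_one M" unfolding M_def
    by (intro deg_one_comp[OF deg_one_GG] deg_one_comp[OF K(1)] deg_one_HH)
  have Ma: "M (u + a) = M u + a - of_int n" for u
  proof -
    have "HH x (a + M u) = K (HH y (a + u)) + of_int n"
      using n[of "HH y u"] by (simp add: flow_def M_def GG_HH)
    then have "GG x (HH x (a + M u)) = GG x (K (HH y (a + u))) + of_int n"
      using deg_one_of_int[OF deg_one_GG] by simp
    then show ?thesis by (simp add: M_def GG_HH add.commute)
  qed
  define p where "p u = M u - u" for u
  have pc: "continuous_on UNIV p" unfolding p_def[abs_def]
    using M by (intro continuous_intros) (simp add: deg_one_def)
  have p1: "p (u + 1) = p u" for u using M by (simp add: p_def deg_one_def)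
  \<comment> \<open>Sampling p along the multiples of a turns the relation into a unit shift, to
    which \<open>shift_of_int\<close> applies.\<close>
  define g where "g u = p (u * a)" for u
  have "g (u + 1) = g u + (- of_int n)" for u
    using Ma[of "u * a"] by (simp add: g_def p_def algebra_simps)
  then have g: "g (u + of_int k) = g u + of_int k * (- of_int n)" for u k by (rule shift_of_int)
  obtain B where B: "B \<ge> 0" "\<And>t. \<bar>p t\<bar> \<le> B" using periodic_continuous_bounded[OF pc p1] by blast
  have "n = 0"
  proof (rule ccontr)
    assume "n \<noteq> 0"
    then have n1: "1 \<le> \<bar>real_of_int n\<bar>" by (metis Ints_nonzero_abs_ge1 Ints_of_int of_int_eq_0_iff)
    obtain k :: nat where k: "real k > 2 * B" using reals_Archimedean2 by blast
    have "real k * 1 \<le> real k * \<bar>real_of_int n\<bar>" using n1 by (intro mult_left_mono) auto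
    also have "\<dots> = \<bar>g (0 + of_int (int k)) - g 0\<bar>" unfolding g by (simp add: abs_mult)
    also have "\<dots> \<le> 2 * B" using B(2)[of "real k * a"] B(2)[of 0] by (simp add: g_def)
    finally show False using k by simp
  qed
  then have ga: "p (of_int k * a - of_int l) = p 0" for k l
    using g[of 0 k] shift_of_int[of p 0 "of_int k * a" "- l"] p1 by (simp add: g_def)
  have "p u = p 0" for u
  proof (rule ccontr)
    assume "p u \<noteq> p 0"
    then have "\<bar>p u - p 0\<bar> > 0" by simp
    then obtain d where d: "d > 0" "\<And>s. dist s u < d \<Longrightarrow> dist (p s) (p u) < \<bar>p u - p 0\<bar>"
      using pc unfolding continuous_on_iff by (metis UNIV_I)
    obtain l k where "\<bar>of_int k * a - of_int l - u\<bar> < d"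
      using sequence_of_fractional_parts_is_dense[OF a d(1)] by blast
    then have "dist (p (of_int k * a - of_int l)) (p u) < \<bar>p u - p 0\<bar>"
      by (intro d(2)) (simp add: dist_real_def)
    then show False by (simp add: ga dist_real_def abs_minus_commute)
  qed
  then have Mu: "M u = p 0 + u" for u unfolding p_def by (metis add.commute diff_add_cancel)
  have "K u = HH x (p 0 + GG y u)" for u
    using Mu[of "GG y u", symmetric] by (simp add: M_def HH_GG)
  then show ?thesis using that[of "p 0"] K(2) by presburger
qed

lemma rho_not_conjugate:
  assumes inf: "infinite {n. x n \<and> \<not> y n}" and D: "\<D> \<in> regularity_classes"
  shows "\<not> conjugate_by \<D> (rho x) (rho y)"
proof
  assume "conjugate_by \<D> (rho x) (rho y)"
  then obtain f where f: "f \<in> \<D>" "\<And>v. rho x v = f \<circ> rho y v \<circ> inv f"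
    unfolding conjugate_by_def by blast
  obtain \<beta> where \<beta>: "0 < \<beta>" "f \<in> homeo_plus" "is_Hoelder \<beta> f"
    using regularity_class_Hoelder[OF D f(1)] by blast
  obtain t where "f = circ (\<lambda>u. HH x (t + GG y u))"
    using conjugacy_is_transition[OF \<beta>(2) f(2)] by blast
  then show False using transition_not_Hoelder[OF inf \<beta>(1)] \<beta>(3) by blast
qed

end

section \<open>Continuous dependence of the actions on the sequence\<close>

section \<open>Continuity of the family of actions\<close>

text \<open>One summable majorant covers the orders up to n and those beyond. For the latter 1 / 2
  is split into 2 / 3 times 3 / 4: the powers of the first factor are at most (2 / 3) ^ n, those of
  the second remain summable.\<close>

lemma dist_smooth_le:
  assumes fg: "f \<in> diffeo_smooth" "g \<in> diffeo_smooth" and \<delta>: "\<And>k. k \<le> n \<Longrightarrow> dist_Ck k f g \<le> \<delta>" "0 \<le> \<delta>"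
  shows "dist_smooth f g \<le> \<delta> + 3 * (2 / 3) ^ n"
proof -
  let ?c = "\<lambda>k. (1 / 2) * \<delta> * (1 / 2) ^ k + (2 / 3) ^ n * (3 / 4) * (3 / 4) ^ k"
  have c: "?c sums ((1 / 2) * \<delta> * 2 + (2 / 3) ^ n * (3 / 4) * 4)"
    using geometric_sums[of "1 / 2 :: real"] geometric_sums[of "3 / 4 :: real"]
    by (intro sums_add sums_mult) auto
  have "dist_summand (Suc k) f g \<le> ?c k" for k
  proof (cases "Suc k \<le> n")
    case True
    let ?d = "dist_Ck (Suc k) f g"
    have d: "0 \<le> ?d" "?d \<le> \<delta>" using dist_Ck_nonneg[OF fg] \<delta>(1)[OF True] by auto
    have "?d / (1 + ?d) \<le> ?d / 1" using d by (intro divide_left_mono) auto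
    then have "dist_summand (Suc k) f g \<le> (1 / 2) ^ Suc k * \<delta>"
      unfolding dist_summand_eq using d by (intro mult_left_mono) auto
    also have "\<dots> \<le> ?c k" by simp
    finally show ?thesis .
  next
    case False
    let ?d = "dist_Ck (Suc k) f g"
    have "?d / (1 + ?d) \<le> 1" using dist_Ck_nonneg[OF fg, of "Suc k"] by simp
    then have "dist_summand (Suc k) f g \<le> (1 / 2) ^ Suc k * 1"
      unfolding dist_summand_eq by (intro mult_left_mono) auto
    also have "\<dots> = (2 / 3) ^ Suc k * (3 / 4) ^ Suc k" by (simp flip: power_mult_distrib)
    also have "\<dots> \<le> (2 / 3) ^ n * (3 / 4) ^ Suc k" using False by (intro mult_right_mono power_decreasing) auto
    also have "\<dots> \<le> ?c k" using \<delta>(2) by simp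
    finally show ?thesis .
  qed
  then have "(\<Sum>k. dist_summand (Suc k) f g) \<le> suminf ?c"
    by (intro suminf_le summable_dist_summand fg sums_summable[OF c])
  also have "suminf ?c = \<delta> + 3 * (2 / 3) ^ n" using sums_unique[OF c] by simp
  finally show ?thesis by (simp add: dist_smooth_eq[OF fg])
qed

context tower
begin

lemma flow_deriv_dist_le:
  assumes a: "admissible N a b" and n: "N \<le> n" "i \<le> n" and xy: "\<And>m. m < n \<Longrightarrow> x m = y m"
  shows "deriv_dist i (circ (flow x b)) (circ (flow y b)) \<le> 4 * (1 / 2) ^ n"
  unfolding deriv_dist_def
proof (rule cSUP_least)
  fix p :: circle
  define u where "u = rep_circle p"
  have p: "p = abs_circle u" by (simp add: u_def abs_rep_circle)
  have close: "\<bar>(deriv ^^ i) (flow x b) u - (deriv ^^ i) (flow y b) u\<bar> \<le> 4 * (1 / 2) ^ n"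
    by (rule flow_higher_deriv_close[OF a n xy])
  show "deriv_gap i (circ (flow x b)) (circ (flow y b)) p \<le> 4 * (1 / 2) ^ n"
  proof (cases "i = 0")
    case True
    then show ?thesis
      using close dist_abs_circle_le[of "flow x b u" "flow y b u"]
      by (simp add: deriv_gap_def p circ_abs[OF deg_one_flow])
  next
    case False
    then show ?thesis
      using close flow_smooth(1)[OF a]
      by (simp add: deriv_gap_def circle_deriv_circ[OF deg_one_flow] u_def)
  qed
qed auto

text \<open>The inverse of a flow map belongs to the opposite angle, which is again admissible, so
  one estimate serves both halves of \<open>dist_Ck\<close>.\<close>

lemma flow_dist_Ck_le:
  assumes a: "admissible N a b" and n: "N \<le> n" "k \<le> n" and xy: "\<And>m. m < n \<Longrightarrow> x m = y m"
  shows "dist_Ck k (circ (flow x b)) (circ (flow y b)) \<le> 4 * (1 / 2) ^ n"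
proof -
  have "norm_diff k (circ (flow x b)) (circ (flow y b)) \<le> 4 * (1 / 2) ^ n" if "admissible N a b" for a b
    unfolding norm_diff_def using n by (intro Max.boundedI) (auto intro!: flow_deriv_dist_le[OF that] xy)
  from this[OF a] this[OF admissible_minus[OF a]] show ?thesis
    by (simp add: dist_Ck_def inv_circ[OF deg_one_flow] inv_flow)
qed

end

context action_tower
begin

lemma rho_generators_close:
  assumes n: "1 \<le> n" and xy: "\<And>m. m < n \<Longrightarrow> x m = y m"
  shows "dist_smooth (generators (rho x) i) (generators (rho y) i) \<le> 4 * (1 / 2) ^ n + 3 * (2 / 3) ^ n"
proof -
  have "real_of_int \<bar>axis i 1 $ j\<bar> \<le> real 1" for j by (simp add: axis_def)
  then have a: "admissible 1 (rot_partial (axis i 1)) (rot (axis i 1))" by (rule rot_admissible)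
  then have "circ (flow x (rot (axis i 1))) \<in> diffeo_smooth" for x
    using diff_lift_flow circ_diffeo_smooth by blast
  then show ?thesis unfolding generators_def rho_def
    by (intro dist_smooth_le flow_dist_Ck_le[OF a n] xy) auto
qed

text \<open>The bound in \<open>rho_generators_close\<close> tends to 0 and is the same for all
  generators. As these are finitely many, one radius serves them all, and a cylinder around x is
  mapped into the given neighbourhood.\<close>

lemma rho_continuous:
  assumes U: "openin action_topology U" and x: "rho x \<in> U"
  obtains n where "\<And>y. (\<And>m. m < n \<Longrightarrow> x m = y m) \<Longrightarrow> rho y \<in> U"
proof -
  interpret S: Metric_space diffeo_smooth dist_smooth by (rule Metric_space_smooth)
  obtain V where V: "openin (product_topology (\<lambda>_. smooth_topology) UNIV) V" "U = generators -` V \<inter> free_actions"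
    using U unfolding action_topology_def openin_pullback_topology by blast
  have "generators (rho x) \<in> V" using x V(2) by blast
  then obtain W where W: "\<And>i. openin smooth_topology (W i)" "generators (rho x) \<in> Pi\<^sub>E UNIV W" "Pi\<^sub>E UNIV W \<subseteq> V"
    using V(1) unfolding openin_product_topology_alt by (metis UNIV_I)
  have "\<exists>r>0. S.mball (generators (rho x) i) r \<subseteq> W i" for i
    using W(1)[of i] W(2) unfolding smooth_topology_def S.openin_mtopology by (auto simp: PiE_iff)
  then obtain r where r: "\<And>i. r i > 0" "\<And>i. S.mball (generators (rho x) i) (r i) \<subseteq> W i" by metis
  define r0 where "r0 = Min (range r)"
  have r0: "r0 > 0" "\<And>i. r0 \<le> r i" using r(1) by (auto simp: r0_def)
  have "(\<lambda>n. 4 * (1 / 2) ^ n + 3 * (2 / 3 :: real) ^ n) \<longlonglongrightarrow> 4 * 0 + 3 * 0"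
    by (intro tendsto_intros LIMSEQ_power_zero) auto
  then have "\<forall>\<^sub>F n in sequentially. 4 * (1 / 2) ^ n + 3 * (2 / 3 :: real) ^ n < r0"
    using r0(1) by (intro order_tendstoD) auto
  then have "\<forall>\<^sub>F n in sequentially. 4 * (1 / 2) ^ n + 3 * (2 / 3 :: real) ^ n < r0 \<and> 1 \<le> n"
    by (intro eventually_conj eventually_ge_at_top)
  then obtain n where n: "4 * (1 / 2) ^ n + 3 * (2 / 3 :: real) ^ n < r0" "1 \<le> n"
    by (auto simp: eventually_sequentially)
  have sm: "generators (rho y) i \<in> diffeo_smooth" for y i
    using rho_free_action[of y] by (simp add: free_actions_def smooth_action_def generators_def)
  have "rho y \<in> U" if xy: "\<And>m. m < n \<Longrightarrow> x m = y m" for y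
  proof -
    have "generators (rho y) i \<in> W i" for i
    proof -
      have "dist_smooth (generators (rho x) i) (generators (rho y) i) < r i"
        using rho_generators_close[OF n(2) xy, where i = i] n(1) r0(2)[of i] by (meson le_less_trans less_le_trans)
      then show ?thesis using r(2)[of i] sm by (auto simp: S.in_mball)
    qed
    then have "generators (rho y) \<in> V" using W(3) by auto
    then show ?thesis using V(2) rho_free_action by blast
  qed
  then show ?thesis using that by blast
qed

end

section \<open>Random sequences, the zero-one law and the symmetry of the coin\<close>

section \<open>Fair coin tosses\<close>

abbreviation coin :: "bool measure"
  where "coin \<equiv> measure_pmf (pmf_of_set UNIV)"

abbreviation tosses :: "(nat \<Rightarrow> bool) measure"
  where "tosses \<equiv> PiM UNIV (\<lambda>_. coin)"

interpretation tosses: product_prob_space "\<lambda>_ :: nat. coin" UNIV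
  by (intro product_prob_spaceI measure_pmf.prob_space_axioms)

lemma space_tosses: "space tosses = UNIV"
  by (simp add: space_PiM)

lemma coordinate_measurable: "(\<lambda>x. x n) \<in> measurable tosses coin"
  by (rule measurable_component_singleton) simp

lemma cylinder_sets: "{x. \<forall>m<length l. x m = l ! m} \<in> sets tosses"
proof -
  have "(\<lambda>x. x m) -` {l ! m} \<inter> space tosses \<in> sets tosses" for m
    by (rule measurable_sets[OF coordinate_measurable]) simp
  then have "{x \<in> space tosses. x m = l ! m} \<in> sets tosses" for m
    by (simp add: vimage_def space_tosses)
  then have "{x \<in> space tosses. \<forall>m\<in>{..<length l}. x m = l ! m} \<in> sets tosses"
    by (intro sets.sets_Collect_finite_All) auto
  then show ?thesis by (simp add: space_tosses lessThan_def)
qed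

text \<open>Cylinders are indexed by finite words, so an open set of sequences is a countable union
  of cylinders.\<close>

lemma locally_determined_sets:
  assumes V: "\<And>x. x \<in> V \<Longrightarrow> \<exists>n. \<forall>y. (\<forall>m<n. x m = y m) \<longrightarrow> y \<in> V"
  shows "V \<in> sets tosses"
proof -
  define C where "C l = {x. \<forall>m<length l. x m = l ! m}" for l :: "bool list"
  have "V = (\<Union>l\<in>{l. C l \<subseteq> V}. C l)"
  proof (intro equalityI subsetI)
    fix x assume "x \<in> V"
    then obtain n where n: "\<And>y. (\<forall>m<n. x m = y m) \<Longrightarrow> y \<in> V" using V by blast
    have "C (map x [0..<n]) \<subseteq> V" using n by (auto simp: C_def)
    moreover have "x \<in> C (map x [0..<n])" by (simp add: C_def)
    ultimately show "x \<in> (\<Union>l\<in>{l. C l \<subseteq> V}. C l)" by blast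
  qed auto
  moreover have "(\<Union>l\<in>{l. C l \<subseteq> V}. C l) \<in> sets tosses"
    by (intro sets.countable_UN' countableI_type) (auto simp: C_def cylinder_sets)
  ultimately show ?thesis by simp
qed

text \<open>The identity has the product law, and the factors of that product are the laws of the
  coordinates.\<close>

lemma tosses_indep: "tosses.indep_vars (\<lambda>_. coin) (\<lambda>n x. x n) UNIV"
proof -
  have "distr tosses tosses (\<lambda>x. \<lambda>i\<in>UNIV. x i) = tosses"
    by (simp add: restrict_UNIV distr_id2[OF refl])
  also have "\<dots> = PiM UNIV (\<lambda>n. distr tosses coin (\<lambda>x. x n))"
    by (intro PiM_cong refl) (simp add: tosses.PiM_component)
  finally show ?thesis
    by (subst tosses.indep_vars_iff_distr_eq_PiM') (auto simp: coordinate_measurable)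
qed

text \<open>Erasing the first N tosses does not affect membership in A. Hence A is its own preimage
  under the erasing map s, which depends measurably on the tosses from N on, and A is a tail
  event.\<close>

lemma tail_invariant_zero_one:
  assumes A: "A \<in> sets tosses"
    and inv: "\<And>N x y. (\<And>n. n \<ge> N \<Longrightarrow> x n = y n) \<Longrightarrow> x \<in> A \<longleftrightarrow> y \<in> A"
  shows "tosses.prob A = 0 \<or> tosses.prob A = 1"
proof (rule tosses.kolmogorov_0_1_law)
  let ?F = "\<lambda>n. sigma_sets (space tosses) {(\<lambda>x. x n) -` B \<inter> space tosses | B. B \<in> sets coin}"
  show "sigma_algebra (space tosses) (?F n)" for n
    by (rule sigma_algebra_sigma_sets) auto
  show "tosses.indep_sets ?F UNIV"
    using tosses_indep unfolding tosses.indep_vars_def by blast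
  show "A \<in> tosses.tail_events ?F"
    unfolding tosses.tail_events_def
  proof (intro INT_I)
    fix N
    let ?G = "\<Union> (?F ` {N..})"
    let ?T = "sigma (space tosses) ?G"
    have G: "?G \<subseteq> Pow (space tosses)" by (simp add: space_tosses)
    define s where "s = (\<lambda>x n. if n < N then False else x n :: bool)"
    have "(\<lambda>x. if n < N then False else x n) \<in> measurable ?T coin" for n
    proof (cases "n < N")
      case False
      have "(\<lambda>x. x n) \<in> measurable ?T coin"
      proof (rule measurableI)
        fix B assume "B \<in> sets coin"
        then have "(\<lambda>x. x n) -` B \<inter> space tosses \<in> ?F n" by blast
        then have "(\<lambda>x. x n) -` B \<inter> space tosses \<in> ?G" using False by auto
        then show "(\<lambda>x. x n) -` B \<inter> space ?T \<in> sets ?T" using G by (simp add: space_tosses)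
      qed simp
      then show ?thesis using False by simp
    qed simp
    then have "s \<in> measurable ?T tosses"
      unfolding s_def by (intro measurable_PiM_single') auto
    from measurable_sets[OF this A] have "s -` A \<inter> space ?T \<in> sets ?T" .
    moreover have "s x \<in> A \<longleftrightarrow> x \<in> A" for x by (rule inv[of N]) (simp add: s_def)
    then have "s -` A \<inter> space ?T = A" by (auto simp: space_tosses)
    ultimately show "A \<in> sigma_sets (space tosses) ?G" using G by simp
  qed
qed

definition flip :: "(nat \<Rightarrow> bool) \<Rightarrow> nat \<Rightarrow> bool"
  where "flip x = (\<lambda>n. \<not> x n)"

lemma flip_measurable: "flip \<in> measurable tosses tosses"
proof -
  have "(\<lambda>x. \<not> x n) \<in> measurable tosses coin" for n
    using measurable_compose[OF coordinate_measurable, of Not coin n] by simp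
  then show ?thesis unfolding flip_def[abs_def] by (intro measurable_PiM_single') (auto simp: space_tosses)
qed

lemma distr_flip: "distr tosses tosses flip = tosses"
proof (rule tosses.PiM_eq)
  fix J :: "nat set" and F :: "nat \<Rightarrow> bool set"
  assume J: "finite J"
  have coin: "emeasure coin (Not -` B) = emeasure coin B" for B
  proof -
    have "map_pmf Not (pmf_of_set UNIV) = pmf_of_set UNIV"
      by (rule map_pmf_of_set_bij_betw) (auto intro!: bij_betwI[where g = Not])
    then show ?thesis by (metis emeasure_map_pmf)
  qed
  have "emeasure (distr tosses tosses flip) (prod_emb UNIV (\<lambda>_. coin) J (Pi\<^sub>E J F)) =
      emeasure tosses (flip -` prod_emb UNIV (\<lambda>_. coin) J (Pi\<^sub>E J F) \<inter> space tosses)"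
    using J by (intro emeasure_distr flip_measurable sets_PiM_I) auto
  also have "flip -` prod_emb UNIV (\<lambda>_. coin) J (Pi\<^sub>E J F) \<inter> space tosses =
      prod_emb UNIV (\<lambda>_. coin) J (\<Pi>\<^sub>E j\<in>J. Not -` F j)"
    by (auto simp: prod_emb_def flip_def PiE_iff space_tosses)
  also have "emeasure tosses \<dots> = (\<Prod>j\<in>J. emeasure coin (F j))"
    using J by (subst tosses.emeasure_PiM_emb) (auto simp: coin)
  finally show "emeasure (distr tosses tosses flip) (prod_emb UNIV (\<lambda>_. coin) J (Pi\<^sub>E J F)) =
      (\<Prod>j\<in>J. emeasure coin (F j))" .
qed simp

text \<open>For each threshold r the event f x < r has probability 0 or 1. As \<open>flip\<close>
  preserves the measure, x and \<open>flip x\<close> almost surely lie on the same side of r.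
  Countably many rational thresholds determine a real number.\<close>

lemma tail_invariant_flip:
  fixes f :: "(nat \<Rightarrow> bool) \<Rightarrow> real"
  assumes f: "f \<in> borel_measurable tosses"
    and inv: "\<And>N x y. (\<And>n. n \<ge> N \<Longrightarrow> x n = y n) \<Longrightarrow> f x = f y"
  obtains x where "f x = f (flip x)"
proof -
  have "AE x in tosses. f x < r \<longleftrightarrow> f (flip x) < r" for r
  proof -
    define A where "A = {x. f x < r}"
    have A: "A \<in> sets tosses"
      using borel_measurable_less[OF f borel_measurable_const[of r]] by (simp add: A_def space_tosses)
    have "x \<in> A \<longleftrightarrow> y \<in> A" if "\<And>n. n \<ge> N \<Longrightarrow> x n = y n" for N x y
      using inv[of N x y] that by (simp add: A_def)
    then have "tosses.prob A = 0 \<or> tosses.prob A = 1" by (rule tail_invariant_zero_one[OF A])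
    then have "(AE x in tosses. x \<notin> A) \<or> (AE x in tosses. x \<in> A)"
      using tosses.prob_eq_0[OF A] tosses.prob_eq_1[OF A] by blast
    moreover have flip: "AE x in tosses. Q (flip x)" if "AE x in tosses. Q x" for Q
      by (rule AE_distrD[OF flip_measurable]) (subst distr_flip, rule that)
    ultimately show ?thesis
    proof (elim disjE)
      assume a: "AE x in tosses. x \<notin> A"
      then show ?thesis using flip[OF a] by eventually_elim (simp add: A_def)
    next
      assume a: "AE x in tosses. x \<in> A"
      then show ?thesis using flip[OF a] by eventually_elim (simp add: A_def)
    qed
  qed
  then have "AE x in tosses. \<forall>r\<in>\<rat>. f x < r \<longleftrightarrow> f (flip x) < r"
    by (subst AE_ball_countable) (auto simp: countable_rat)
  then obtain x where x: "\<forall>r\<in>\<rat>. f x < r \<longleftrightarrow> f (flip x) < r"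
    using eventually_happens'[OF tosses.ae_filter_bot] by blast
  have "f x = f (flip x)"
  proof (rule linorder_cases)
    assume "f x < f (flip x)"
    then obtain r where "r \<in> \<rat>" "f x < r" "r < f (flip x)" using Rats_dense_in_real by blast
    then show ?thesis using x by force
  next
    assume "f (flip x) < f x"
    then obtain r where "r \<in> \<rat>" "f (flip x) < r" "r < f x" using Rats_dense_in_real by blast
    then show ?thesis using x by force
  qed
  then show ?thesis using that by blast
qed

lemma (in action_tower) rho_measurable: "rho \<in> measurable tosses (borel_of action_topology)"
  unfolding borel_of_def
proof (rule measurable_measure_of)
  show "{U. openin action_topology U} \<subseteq> Pow (topspace action_topology)"
    using openin_subset by blast
  have "generators (rho x) i \<in> diffeo_smooth" for x i
    using rho_free_action[of x] by (simp add: free_actions_def smooth_action_def generators_def)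
  then show "rho \<in> space tosses \<rightarrow> topspace action_topology"
    using rho_free_action
    by (auto simp: action_topology_def topspace_pullback_topology smooth_topology_def
        Metric_space.topspace_mtopology[OF Metric_space_smooth])
  fix U :: "(int ^ 'd \<Rightarrow> circle \<Rightarrow> circle) set"
  assume "U \<in> {U. openin action_topology U}"
  then have "rho -` U \<in> sets tosses"
    by (intro locally_determined_sets) (metis CollectD rho_continuous vimage_eq)
  then show "rho -` U \<inter> space tosses \<in> sets tosses" by (simp add: space_tosses)
qed

theorem theorem2:
  fixes \<D> :: "(circle \<Rightarrow> circle) set"
  assumes "CARD('d::finite) \<ge> 2"
    and "\<D> \<in> regularity_classes"
  shows "\<not> (\<exists>\<phi> :: (int ^ 'd \<Rightarrow> circle \<Rightarrow> circle) \<Rightarrow> real.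
           \<phi> \<in> borel_measurable (borel_of action_topology) \<and>
           (\<forall>\<rho>\<in>free_actions. \<forall>\<sigma>\<in>free_actions.
              conjugate_by \<D> \<rho> \<sigma> \<longleftrightarrow> \<phi> \<rho> = \<phi> \<sigma>))"
proof
  assume "\<exists>\<phi> :: (int ^ 'd \<Rightarrow> circle \<Rightarrow> circle) \<Rightarrow> real.
           \<phi> \<in> borel_measurable (borel_of action_topology) \<and>
           (\<forall>\<rho>\<in>free_actions. \<forall>\<sigma>\<in>free_actions.
              conjugate_by \<D> \<rho> \<sigma> \<longleftrightarrow> \<phi> \<rho> = \<phi> \<sigma>)"
  then obtain \<phi> :: "(int ^ 'd \<Rightarrow> circle \<Rightarrow> circle) \<Rightarrow> real" where
    \<phi>: "\<phi> \<in> borel_measurable (borel_of action_topology)"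
      "\<And>\<rho> \<sigma>. \<rho> \<in> free_actions \<Longrightarrow> \<sigma> \<in> free_actions \<Longrightarrow> conjugate_by \<D> \<rho> \<sigma> \<longleftrightarrow> \<phi> \<rho> = \<phi> \<sigma>"
    by blast
  obtain q h \<H> where "tower q h \<H>" by (rule tower_exists)
  moreover obtain e :: "nat \<Rightarrow> 'd" where "\<And>i. infinite {n. e n = i}"
    using recurrent_sequence_exists by blast
  ultimately interpret action_tower q h \<H> e
    by (simp add: action_tower_def action_tower_axioms_def)
  have conj: "conjugate_by \<D> (rho x) (rho y) \<longleftrightarrow> \<phi> (rho x) = \<phi> (rho y)" for x y
    by (intro \<phi>(2) rho_free_action)
  have "(\<lambda>x. \<phi> (rho x)) \<in> borel_measurable tosses"
    using rho_measurable \<phi>(1) by (rule measurable_compose)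
  moreover have "\<phi> (rho x) = \<phi> (rho y)" if "\<And>n. n \<ge> N \<Longrightarrow> x n = y n" for N x y
    using rho_tail_conjugate[OF that assms(2)] conj by simp
  ultimately obtain x where x: "\<phi> (rho x) = \<phi> (rho (flip x))" by (rule tail_invariant_flip)
  \<comment> \<open>Equality of the invariant is symmetric and would give conjugacies in both
    orders. Every n lies in one of the two sets, so at least one order is excluded by
    \<open>rho_not_conjugate\<close>.\<close>
  have "{n. x n \<and> \<not> flip x n} \<union> {n. flip x n \<and> \<not> x n} = UNIV" by (auto simp: flip_def)
  then have "infinite {n. x n \<and> \<not> flip x n} \<or> infinite {n. flip x n \<and> \<not> x n}"
    using infinite_UNIV_nat by (metis finite_Un)
  then show False using rho_not_conjugate[OF _ assms(2)] conj x by metis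
qed

end
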